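(* Let $n\ge2$ and $m=1$. For each $1\le i\le k$ let $u^i_0$ be a positive function in $\mathbb R^n$. Let $\mathbf u=(u^1,\dots,u^k)$ be a weak solution in $\mathbb R^n\times[0,\infty)$ of $$(u^i)_t=\nabla\cdot\left(mU^{m-1}\mathcal A(\nabla u^i,u^i,x,t)+\mathcal B(u^i,x,t)\right),\qquad 1\le i\le k,$$ with initial data $\mathbf u_0=(u_0^1,\dots,u_0^k)$, satisfying the structure conditions listed in the context. Suppose that $$u_0^i\in L^1(\mathbb R^n)\cap L^p(\mathbb R^n)$$ for some constant $p>1$ and that $\mathbf C_5=0$ in the growth bound $|\mathcal B(u,x,t)|\le\mathbf C_5u^q$. Then for any $t>0$ $$\int_{\mathbb R^n}u^i(x,t)\,dx=\int_{\mathbb R^n}u_0^i(x)\,dx .$$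
   Context: Setting. $k\in\mathbb N$; $u^1,\dots,u^k$ are real functions on $\mathbb R^n\times(0,\infty)$; $U=U(\xi^1,\dots,\xi^k)$ is a real function on $\mathbb R^k$, and $U$ also denotes the function $U(x,t)=U(u^1(x,t),\dots,u^k(x,t))$; $U_{u^i}$ is the partial derivative of $U$ in its $i$-th argument. $\mathcal A(p,z,x,t)\in\mathbb R^n$ and $\mathcal B(z,x,t)\in\mathbb R^n$, $(z,p)\in\mathbb R^+\times\mathbb R^n$, are measurable in $(x,t)\in\mathbb R^n\times[0,\infty)$ and continuous in the remaining variables for almost all $(x,t)$. Structure conditions. There are constants $\lambda_i>0$, $\beta_i\ge0$ with $u^i\ge0$ and $0\le\lambda_i(u^i)^{\beta_i}\le U$ for all $1\le i\le k$ in $\mathbb R^n\times(0,\infty)$, and - $U^mU_{u^i}\in H^1_0(\mathbb R^n\times(0,\infty))$ for all $i$; - $U(0,\dots,0)=0$, $\sum_{i=1}^k|U_{\xi^i}(\xi)\xi^i|\le\mathbf C_1U(\xi)$ and $U_{\xi^i}(\xi)\ge0$ for all $i$ and all $\xi\in\mathbb R^k$; - $\sum_{i=1}^k\left(mU^{m-1}\mathcal A(\nabla u^i,u^i,x,t)+\mathcal B(u^i,x,t)\right)\cdot\nabla U_{u^i}\ge0$; - $\nabla U\cdot\left[\sum_{i=1}^kU_{u^i}\mathcal A(\nabla u^i,u^i,x,t)\right]\ge\mathbf c|\nabla U|^2-\mathbf C_2U^2$; - for any function $u\ge0$: $\mathcal A(\nabla u,u,x,t)\cdot\nabla u\ge\mathbf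 c|\nabla u|^2-\mathbf C_2u^2$, $|\mathcal A(\nabla u,u,x,t)|\le\mathbf C_3|\nabla u|+\mathbf C_4u$, $|\mathcal B(u,x,t)|\le\mathbf C_5u^q$. Here $0<\mathbf c\le1\le\mathbf C_1,\dots,\mathbf C_5<\infty$, except where a constant is explicitly assumed to be $0$; when $\mathbf C_5=0$ (so $\mathcal B=0$) the exponent $q$ plays no role and no condition on $q$ is imposed. Weak solution. For $\Omega\subset\mathbb R^n$ open and $T>0$ let $\Omega_T=\Omega\times(0,T]$; for $h>0$ the Steklov average is $(v)_h(\cdot,t)=\frac1h\int_t^{t+h}v(\cdot,\tau)\,d\tau$. $\mathbf u$ is a weak solution in $\Omega_T$ if each $u^i$ is locally integrable, $U^{m-1}|\mathcal A(\nabla u^i,u^i,x,t)|\in L^2(0,T;L^2(\Omega))$, and for every compact $\mathcal K\subset\Omega$, every small $h>0$, every $0<t<T-h$ and every $\varphi\in H^1_0(\mathcal K)$, $$\int_{\mathcal K\times\{t\}}\left[((u^i)_h)_t\varphi+m\left(U^{m-1}\mathcal A(\nabla u^i,u^i,x,t)\right)_h\cdot\nabla\varphi+\left(\mathcal B(u^i,x,t)\right)_h\cdot\nabla\varphi\right]dx=0 .$$ A weak solution in $\mathbb R^n\times[0,\infty)$ with initial data $\mathbf u_0$ is a weak solution in $\Omega_T$, $\Omega=\mathbb R^n$, for every $T>0$, with $t\mapsto u^i(\cdot,t)$ continuous from $[0,\infty)$ into $L^1_{loc}(\mathbb R^n)$ and $u^i(\cdot,0)=u_0^i$. *)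

theory Defs
  imports "HOL-Analysis.Analysis"
begin

text \<open>
  A point of space-time is a pair \<open>(x, t)\<close>.  Measurability and integrals are Lebesgue.
  Real powers with the convention \<open>0\<^sup>0 = 1\<close> (whereas \<open>0 powr 0 = 0\<close>), so that
  \<open>U\<^sup>m\<^sup>-\<^sup>1 = 1\<close> everywhere when \<open>m = 1\<close>, also where \<open>U\<close> vanishes.
\<close>

definition rpow :: "real \<Rightarrow> real \<Rightarrow> real" where
  "rpow x a = (if a = 0 then 1 else x powr a)"

definition partial_deriv :: "(real ^ 'k \<Rightarrow> real) \<Rightarrow> 'k \<Rightarrow> real ^ 'k \<Rightarrow> real" where
  "partial_deriv U i \<xi> = deriv (\<lambda>s. U (\<xi> + s *\<^sub>R axis i 1)) 0"

definition partially_differentiable :: "(real ^ 'k \<Rightarrow> real) \<Rightarrow> bool" where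
  "partially_differentiable U \<longleftrightarrow>
     (\<forall>i \<xi>. (\<lambda>s. U (\<xi> + s *\<^sub>R axis i 1)) differentiable (at 0))"

definition loc_integrable :: "'a::euclidean_space set \<Rightarrow> ('a \<Rightarrow> 'b::euclidean_space) \<Rightarrow> bool" where
  "loc_integrable S f \<longleftrightarrow> (\<forall>K. compact K \<and> K \<subseteq> S \<longrightarrow> set_integrable lebesgue K f)"

definition L2_on :: "'a::euclidean_space set \<Rightarrow> ('a \<Rightarrow> 'b::euclidean_space) \<Rightarrow> bool" where
  "L2_on S f \<longleftrightarrow> set_borel_measurable lebesgue S f \<and>
                 set_integrable lebesgue S (\<lambda>x. (norm (f x))\<^sup>2)"

definition Lp_fun :: "real \<Rightarrow> ('a::euclidean_space \<Rightarrow> real) \<Rightarrow> bool" where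
  "Lp_fun p f \<longleftrightarrow> f \<in> borel_measurable lebesgue \<and> integrable lebesgue (\<lambda>x. \<bar>f x\<bar> powr p)"

text \<open>Convergence \<open>f s \<rightarrow> g\<close> in \<open>L\<^sup>1\<^sub>l\<^sub>o\<^sub>c(\<Omega>)\<close> along the filter \<open>F\<close>.\<close>

definition L1loc_lim ::
    "'a::euclidean_space set \<Rightarrow> ('s \<Rightarrow> 'a \<Rightarrow> real) \<Rightarrow> ('a \<Rightarrow> real) \<Rightarrow> 's filter \<Rightarrow> bool" where
  "L1loc_lim \<Omega> f g F \<longleftrightarrow> loc_integrable \<Omega> g \<and>
     (\<forall>K. compact K \<and> K \<subseteq> \<Omega> \<longrightarrow>
        (\<forall>\<^sub>F s in F. set_integrable lebesgue K (f s)) \<and>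
        ((\<lambda>s. LINT x:K|lebesgue. \<bar>f s x - g x\<bar>) \<longlongrightarrow> 0) F)"

text \<open>
  \<open>\<phi>\<close> is a \<open>C\<^sup>1\<close> function with gradient \<open>D\<phi>\<close> and compact support in the interior of \<open>S\<close>.
  Weak derivatives are tested with, and \<open>H\<^sup>1\<^sub>0\<close> is the closure of, \<open>C\<^sup>1\<close> functions of
  compact support (the definitions of Gilbarg and Trudinger).
\<close>

definition test_function ::
    "'a::euclidean_space set \<Rightarrow> ('a \<Rightarrow> real) \<Rightarrow> ('a \<Rightarrow> 'a) \<Rightarrow> bool" where
  "test_function S \<phi> D\<phi> \<longleftrightarrow> (\<forall>x. GDERIV \<phi> x :> D\<phi> x) \<and> continuous_on UNIV D\<phi> \<and>
     compact (closure {x. \<phi> x \<noteq> 0}) \<and> closure {x. \<phi> x \<noteq> 0} \<subseteq> interior S"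

text \<open>
  \<open>G\<close> is the weak gradient in the space variable of \<open>f\<close> on the open set \<open>Q\<close> of space-time;
  \<open>fst (D\<phi> z)\<close> is the spatial part of the full gradient.
\<close>

definition has_sgrad ::
    "('a::euclidean_space \<times> real) set \<Rightarrow> ('a \<times> real \<Rightarrow> real) \<Rightarrow> ('a \<times> real \<Rightarrow> 'a) \<Rightarrow> bool" where
  "has_sgrad Q f G \<longleftrightarrow> loc_integrable Q f \<and> loc_integrable Q G \<and>
     (\<forall>\<phi> D\<phi>. test_function Q \<phi> D\<phi> \<longrightarrow>
        (LINT z:Q|lebesgue. f z *\<^sub>R fst (D\<phi> z)) = - (LINT z:Q|lebesgue. \<phi> z *\<^sub>R G z))"

text \<open>
  \<open>(v, g)\<close> lies in the closure of the pairs \<open>(\<phi>, P \<circ> D\<phi>)\<close>, \<open>\<phi>\<close> a test function, in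
  \<open>L\<^sup>2(S) \<times> L\<^sup>2(S)\<close>.  With \<open>P\<close> the identity this says that \<open>v \<in> H\<^sup>1\<^sub>0(S)\<close> with gradient \<open>g\<close>.
\<close>

definition H10_wrt :: "('a::euclidean_space \<Rightarrow> 'b::euclidean_space) \<Rightarrow>
    'a set \<Rightarrow> ('a \<Rightarrow> real) \<Rightarrow> ('a \<Rightarrow> 'b) \<Rightarrow> bool" where
  "H10_wrt P S v g \<longleftrightarrow> L2_on S v \<and> L2_on S g \<and>
     (\<exists>\<phi> D\<phi>. (\<forall>j::nat. test_function S (\<phi> j) (D\<phi> j)) \<and>
        (\<lambda>j. LINT x:S|lebesgue. (\<phi> j x - v x)\<^sup>2) \<longlonglongrightarrow> 0 \<and>
        (\<lambda>j. LINT x:S|lebesgue. (norm (P (D\<phi> j x) - g x))\<^sup>2) \<longlonglongrightarrow> 0)"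

definition H10 :: "'a::euclidean_space set \<Rightarrow> ('a \<Rightarrow> real) \<Rightarrow> ('a \<Rightarrow> 'a) \<Rightarrow> bool" where
  "H10 S v g \<longleftrightarrow> H10_wrt (\<lambda>y. y) S v g"

text \<open>
  On space-time, \<open>H\<^sup>1\<^sub>0\<close> is the closure of the test functions in the norm
  \<open>(\<integral> v\<^sup>2 + |\<nabla>v|\<^sup>2)\<^sup>1\<^sup>/\<^sup>2\<close> with \<open>\<nabla>\<close> the gradient in \<open>x\<close>, as everywhere else.  Including
  \<open>v\<^sub>t\<close> in the norm would force zero trace at \<open>t = 0\<close>, against the positivity of the initial
  data; as a hypothesis the present condition is the weaker one (\<open>H10_imp_H10_st\<close>).
\<close>

definition H10_st :: "('a::euclidean_space \<times> real) set \<Rightarrow> ('a \<times> real \<Rightarrow> real) \<Rightarrow> bool" where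
  "H10_st Q v \<longleftrightarrow> (\<exists>g. H10_wrt fst Q v g)"

lemma test_function_gradient_L2:
  assumes "test_function S \<phi> D\<phi>" "open S"
  shows "L2_on S D\<phi>"
proof -
  let ?K = "closure {x. \<phi> x \<noteq> 0}"
  have D: "\<And>x. GDERIV \<phi> x :> D\<phi> x" and cont: "continuous_on UNIV D\<phi>" and K: "compact ?K"
    using assms(1) by (auto simp: test_function_def)
  have zero: "D\<phi> x = 0" if "x \<notin> ?K" for x
  proof -
    have "open (- ?K)" by auto
    moreover have "((\<lambda>h. h \<bullet> D\<phi> x) = (\<lambda>h. 0))"
    proof (rule has_derivative_unique)
      show "(\<phi> has_derivative (\<lambda>h. h \<bullet> D\<phi> x)) (at x)"
        using D by (simp add: gderiv_def)
      have "((\<lambda>_. 0) has_derivative (\<lambda>h. 0)) (at x)" by simp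
      then show "(\<phi> has_derivative (\<lambda>h. 0)) (at x)"
        by (rule has_derivative_transform_within_open[OF _ \<open>open (- ?K)\<close>])
           (use that closure_subset in force)+
    qed
    ultimately show ?thesis by (metis inner_eq_zero_iff)
  qed
  have S: "S \<in> sets lebesgue" using assms(2) by auto
  have meas: "D\<phi> \<in> borel_measurable lebesgue"
    using borel_measurable_continuous_onI[OF cont] by (simp add: measurable_completion)
  have "set_integrable lborel ?K (\<lambda>x. (norm (D\<phi> x))\<^sup>2)"
    by (intro borel_integrable_compact[OF K, folded set_integrable_def] continuous_intros
        continuous_on_subset[OF cont]) auto
  then have "integrable lborel (\<lambda>x. (norm (D\<phi> x))\<^sup>2)"
    unfolding set_integrable_def
    by (rule Bochner_Integration.integrable_cong[THEN iffD1, rotated -1])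
       (use zero in \<open>auto simp: indicator_def\<close>)
  then have "integrable lebesgue (\<lambda>x. (norm (D\<phi> x))\<^sup>2)"
    by (simp add: integrable_completion borel_measurable_integrable)
  then show ?thesis
    unfolding L2_on_def set_borel_measurable_def set_integrable_def
    using S meas by (auto intro!: integrable_mult_indicator[of _ _ "\<lambda>x. (norm (D\<phi> x))\<^sup>2", simplified])
qed

lemma H10_imp_H10_st:
  assumes "H10 Q v g" "open Q"
  shows "H10_st Q v"
proof -
  obtain \<phi> D\<phi> where v: "L2_on Q v" and g: "L2_on Q g"
    and tf: "\<And>j::nat. test_function Q (\<phi> j) (D\<phi> j)"
    and l1: "(\<lambda>j. LINT x:Q|lebesgue. (\<phi> j x - v x)\<^sup>2) \<longlonglongrightarrow> 0"
    and l2: "(\<lambda>j. LINT x:Q|lebesgue. (norm (D\<phi> j x - g x))\<^sup>2) \<longlonglongrightarrow> 0"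
    using assms(1) unfolding H10_def H10_wrt_def by blast
  have meas_fst: "set_borel_measurable lebesgue Q (\<lambda>x. fst (f x))"
    if "set_borel_measurable lebesgue Q f" for f :: "'a \<times> real \<Rightarrow> 'a \<times> real"
  proof -
    have "fst \<in> borel_measurable (borel :: ('a \<times> real) measure)"
      by (intro borel_measurable_continuous_onI continuous_intros)
    then have "(\<lambda>x. fst (indicator Q x *\<^sub>R f x)) \<in> borel_measurable lebesgue"
      using that[unfolded set_borel_measurable_def] by (rule measurable_compose[rotated])
    then show ?thesis by (simp add: set_borel_measurable_def)
  qed
  have fst_L2: "L2_on Q (\<lambda>x. fst (f x)) \<and>
      (LINT x:Q|lebesgue. (norm (fst (f x)))\<^sup>2) \<le> (LINT x:Q|lebesgue. (norm (f x))\<^sup>2)"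
    if f: "L2_on Q f" for f :: "'a \<times> real \<Rightarrow> 'a \<times> real"
  proof -
    have mf: "set_borel_measurable lebesgue Q (\<lambda>x. fst (f x))"
      using f meas_fst by (auto simp: L2_on_def)
    have le: "norm (fst y) \<le> norm y" for y :: "'a \<times> real"
      by (metis norm_fst_le prod.collapse)
    have "(\<lambda>x. (norm (indicator Q x *\<^sub>R fst (f x)))\<^sup>2) \<in> borel_measurable lebesgue"
      using mf unfolding set_borel_measurable_def by measurable
    moreover have "(\<lambda>x. (norm (indicator Q x *\<^sub>R fst (f x)))\<^sup>2)
        = (\<lambda>x. indicator Q x *\<^sub>R (norm (fst (f x)))\<^sup>2)"
      by (auto simp: indicator_def fun_eq_iff)
    ultimately have m: "(\<lambda>x. indicator Q x *\<^sub>R (norm (fst (f x)))\<^sup>2) \<in> borel_measurable lebesgue"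
      by simp
    have i: "set_integrable lebesgue Q (\<lambda>x. (norm (f x))\<^sup>2)" using f by (simp add: L2_on_def)
    have i': "set_integrable lebesgue Q (\<lambda>x. (norm (fst (f x)))\<^sup>2)"
      using i m unfolding set_integrable_def
      by (rule Bochner_Integration.integrable_bound)
         (auto simp: indicator_def intro!: power_mono le)
    show ?thesis
      using mf i i' by (auto simp: L2_on_def intro!: set_integral_mono power_mono le)
  qed
  have diff: "L2_on Q (\<lambda>x. D\<phi> j x - g x)" for j
  proof -
    have d: "L2_on Q (D\<phi> j)" by (rule test_function_gradient_L2[OF tf assms(2)])
    have m: "(\<lambda>x. indicator Q x *\<^sub>R (D\<phi> j x - g x)) \<in> borel_measurable lebesgue"
      using d g unfolding L2_on_def set_borel_measurable_def scaleR_diff_right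
      by (intro borel_measurable_diff) auto
    have "(\<lambda>x. (norm (indicator Q x *\<^sub>R (D\<phi> j x - g x)))\<^sup>2) \<in> borel_measurable lebesgue"
      using m by measurable
    moreover have "(\<lambda>x. (norm (indicator Q x *\<^sub>R (D\<phi> j x - g x)))\<^sup>2)
        = (\<lambda>x. indicator Q x *\<^sub>R (norm (D\<phi> j x - g x))\<^sup>2)"
      by (auto simp: indicator_def fun_eq_iff)
    ultimately have m2: "(\<lambda>x. indicator Q x *\<^sub>R (norm (D\<phi> j x - g x))\<^sup>2) \<in> borel_measurable lebesgue"
      by simp
    have i: "integrable lebesgue (\<lambda>x. 2 * (indicator Q x *\<^sub>R (norm (D\<phi> j x))\<^sup>2)
                                    + 2 * (indicator Q x *\<^sub>R (norm (g x))\<^sup>2))"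
      using d g unfolding L2_on_def set_integrable_def by auto
    have le: "(norm (a - b))\<^sup>2 \<le> 2 * (norm a)\<^sup>2 + 2 * (norm b)\<^sup>2" for a b :: "'a \<times> real"
    proof -
      have "(norm (a - b))\<^sup>2 \<le> (norm a + norm b)\<^sup>2"
        by (intro power_mono norm_triangle_ineq4) auto
      also have "\<dots> \<le> 2 * (norm a)\<^sup>2 + 2 * (norm b)\<^sup>2"
        using sum_squares_bound[of "norm a" "norm b"] by (simp add: power2_sum)
      finally show ?thesis .
    qed
    have "set_integrable lebesgue Q (\<lambda>x. (norm (D\<phi> j x - g x))\<^sup>2)"
      unfolding set_integrable_def using i m2
      by (rule Bochner_Integration.integrable_bound) (auto simp: indicator_def le)
    with m show ?thesis by (simp add: L2_on_def set_borel_measurable_def)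
  qed
  have "(\<lambda>j. LINT x:Q|lebesgue. (norm (fst (D\<phi> j x) - fst (g x)))\<^sup>2) \<longlonglongrightarrow> 0"
  proof (rule tendsto_sandwich[OF _ _ tendsto_const l2])
    show "\<forall>\<^sub>F j in sequentially. 0 \<le> (LINT x:Q|lebesgue. (norm (fst (D\<phi> j x) - fst (g x)))\<^sup>2)"
      by (auto simp: set_lebesgue_integral_def intro!: always_eventually)
    show "\<forall>\<^sub>F j in sequentially. (LINT x:Q|lebesgue. (norm (fst (D\<phi> j x) - fst (g x)))\<^sup>2)
             \<le> (LINT x:Q|lebesgue. (norm (D\<phi> j x - g x))\<^sup>2)"
      using fst_L2[OF diff] by (auto intro!: always_eventually)
  qed
  then have "H10_wrt fst Q v (\<lambda>x. fst (g x))"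
    unfolding H10_wrt_def using v fst_L2[OF g] tf l1 by blast
  then show ?thesis by (auto simp: H10_st_def)
qed

definition steklov ::
    "real \<Rightarrow> ('a \<times> real \<Rightarrow> 'b::euclidean_space) \<Rightarrow> real \<Rightarrow> 'a \<Rightarrow> 'b" where
  "steklov h v t x = (1 / h) *\<^sub>R (LINT \<tau>:{t..t + h}|lebesgue. v (x, \<tau>))"

definition caratheodory_A ::
    "(real ^ 'n \<Rightarrow> real \<Rightarrow> (real ^ 'n) \<times> real \<Rightarrow> real ^ 'n) \<Rightarrow> bool" where
  "caratheodory_A A \<longleftrightarrow>
     (\<forall>p z. 0 \<le> z \<longrightarrow> set_borel_measurable lebesgue (UNIV \<times> {0..}) (A p z)) \<and>
     (AE y in lebesgue. y \<in> UNIV \<times> {0..} \<longrightarrow>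
        continuous_on ({0..} \<times> UNIV) (\<lambda>(z, p). A p z y))"

definition caratheodory_B ::
    "(real \<Rightarrow> (real ^ 'n) \<times> real \<Rightarrow> real ^ 'n) \<Rightarrow> bool" where
  "caratheodory_B B \<longleftrightarrow>
     (\<forall>z. 0 \<le> z \<longrightarrow> set_borel_measurable lebesgue (UNIV \<times> {0..}) (B z)) \<and>
     (AE y in lebesgue. y \<in> UNIV \<times> {0..} \<longrightarrow> continuous_on {0..} (\<lambda>z. B z y))"

text \<open>
  \<open>Du i\<close> is the weak spatial gradient of the component \<open>u\<^sup>i\<close>.  In the third to last conjunct
  \<open>DUi i\<close> is the gradient of \<open>U\<^sub>u\<^sub>i(x,t)\<close>, in the next one \<open>DU\<close> that of \<open>U(x,t)\<close>; the last
  one concerns an arbitrary nonnegative \<open>v\<close> with gradient \<open>g\<close>.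
\<close>

definition structure_conditions ::
    "real \<Rightarrow> (real ^ 'k \<Rightarrow> real) \<Rightarrow>
     (real ^ 'n \<Rightarrow> real \<Rightarrow> (real ^ 'n) \<times> real \<Rightarrow> real ^ 'n) \<Rightarrow>
     (real \<Rightarrow> (real ^ 'n) \<times> real \<Rightarrow> real ^ 'n) \<Rightarrow>
     ('k \<Rightarrow> real) \<Rightarrow> ('k \<Rightarrow> real) \<Rightarrow> real \<Rightarrow>
     real \<Rightarrow> real \<Rightarrow> real \<Rightarrow> real \<Rightarrow> real \<Rightarrow> real \<Rightarrow>
     ((real ^ 'n) \<times> real \<Rightarrow> real ^ 'k) \<Rightarrow> ('k \<Rightarrow> (real ^ 'n) \<times> real \<Rightarrow> real ^ 'n) \<Rightarrow> bool" where
  "structure_conditions m U A B lam \<beta> q c C1 C2 C3 C4 C5 u Du \<longleftrightarrow>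
    (let Q = UNIV \<times> {0<..} in
     (\<forall>i. 0 < lam i \<and> 0 \<le> \<beta> i) \<and>
     (\<forall>i. \<forall>z\<in>Q. 0 \<le> u z $ i \<and> 0 \<le> lam i * rpow (u z $ i) (\<beta> i) \<and>
                 lam i * rpow (u z $ i) (\<beta> i) \<le> U (u z)) \<and>
     (\<forall>i. has_sgrad Q (\<lambda>z. u z $ i) (Du i)) \<and>
     partially_differentiable U \<and>
     (\<forall>i. H10_st Q (\<lambda>z. rpow (U (u z)) m * partial_deriv U i (u z))) \<and>
     U 0 = 0 \<and>
     (\<forall>\<xi>. (\<Sum>i\<in>UNIV. \<bar>partial_deriv U i \<xi> * \<xi> $ i\<bar>) \<le> C1 * U \<xi>) \<and>
     (\<forall>i \<xi>. 0 \<le> partial_deriv U i \<xi>) \<and>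
     (\<exists>DUi. (\<forall>i. has_sgrad Q (\<lambda>z. partial_deriv U i (u z)) (DUi i)) \<and>
        (AE z in lebesgue. z \<in> Q \<longrightarrow>
           0 \<le> (\<Sum>i\<in>UNIV. ((m * rpow (U (u z)) (m - 1)) *\<^sub>R A (Du i z) (u z $ i) z
                           + B (u z $ i) z) \<bullet> DUi i z))) \<and>
     (\<exists>DU. has_sgrad Q (\<lambda>z. U (u z)) DU \<and>
        (AE z in lebesgue. z \<in> Q \<longrightarrow>
           c * (norm (DU z))\<^sup>2 - C2 * (U (u z))\<^sup>2
             \<le> DU z \<bullet> (\<Sum>i\<in>UNIV. partial_deriv U i (u z) *\<^sub>R A (Du i z) (u z $ i) z))) \<and>
     (\<forall>v g. has_sgrad Q v g \<and> (\<forall>z\<in>Q. 0 \<le> v z) \<longrightarrow>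
        (AE z in lebesgue. z \<in> Q \<longrightarrow>
           c * (norm (g z))\<^sup>2 - C2 * (v z)\<^sup>2 \<le> A (g z) (v z) z \<bullet> g z \<and>
           norm (A (g z) (v z) z) \<le> C3 * norm (g z) + C4 * v z \<and>
           norm (B (v z) z) \<le> C5 * rpow (v z) q)))"

text \<open>
  Weak solution in \<open>\<Omega> \<times> (0,T]\<close>.  The time derivative \<open>w\<close> of the Steklov average is its derivative
  as an \<open>L\<^sup>1\<^sub>l\<^sub>o\<^sub>c\<close>-valued function of \<open>t\<close>: for a fixed \<open>t\<close> the pointwise derivative
  need not exist for almost every \<open>x\<close>.  The identity includes the existence of the integral.
\<close>

definition weak_solution ::
    "(real ^ 'n) set \<Rightarrow> real \<Rightarrow> real \<Rightarrow> (real ^ 'k \<Rightarrow> real) \<Rightarrow>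
     (real ^ 'n \<Rightarrow> real \<Rightarrow> (real ^ 'n) \<times> real \<Rightarrow> real ^ 'n) \<Rightarrow>
     (real \<Rightarrow> (real ^ 'n) \<times> real \<Rightarrow> real ^ 'n) \<Rightarrow>
     ((real ^ 'n) \<times> real \<Rightarrow> real ^ 'k) \<Rightarrow> ('k \<Rightarrow> (real ^ 'n) \<times> real \<Rightarrow> real ^ 'n) \<Rightarrow> bool" where
  "weak_solution \<Omega> T m U A B u Du \<longleftrightarrow> open \<Omega> \<and> 0 < T \<and>
    (\<forall>i.
      loc_integrable (\<Omega> \<times> {0<..T}) (\<lambda>z. u z $ i) \<and>
      has_sgrad (\<Omega> \<times> {0<..<T}) (\<lambda>z. u z $ i) (Du i) \<and>
      L2_on (\<Omega> \<times> {0<..<T})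
        (\<lambda>z. rpow (U (u z)) (m - 1) * norm (A (Du i z) (u z $ i) z)) \<and>
      (\<forall>K. compact K \<and> K \<subseteq> \<Omega> \<longrightarrow>
        (\<exists>h0>0. \<forall>h. 0 < h \<and> h < h0 \<longrightarrow> (\<forall>t. 0 < t \<and> t < T - h \<longrightarrow>
          (\<exists>w. L1loc_lim \<Omega>
                  (\<lambda>s x. (steklov h (\<lambda>z. u z $ i) s x - steklov h (\<lambda>z. u z $ i) t x) / (s - t))
                  w (at t) \<and>
             (\<forall>\<phi> D\<phi>. H10 K \<phi> D\<phi> \<longrightarrow>
                has_bochner_integral (lebesgue_on K)
                  (\<lambda>x. w x * \<phi> x
                     + m * (steklov h (\<lambda>z. rpow (U (u z)) (m - 1) *\<^sub>R A (Du i z) (u z $ i) z) t x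
                            \<bullet> D\<phi> x)
                     + steklov h (\<lambda>z. B (u z $ i) z) t x \<bullet> D\<phi> x) 0))))))"

definition weak_solution_ivp ::
    "real \<Rightarrow> (real ^ 'k \<Rightarrow> real) \<Rightarrow>
     (real ^ 'n \<Rightarrow> real \<Rightarrow> (real ^ 'n) \<times> real \<Rightarrow> real ^ 'n) \<Rightarrow>
     (real \<Rightarrow> (real ^ 'n) \<times> real \<Rightarrow> real ^ 'n) \<Rightarrow>
     (real ^ 'n \<Rightarrow> real ^ 'k) \<Rightarrow>
     ((real ^ 'n) \<times> real \<Rightarrow> real ^ 'k) \<Rightarrow> ('k \<Rightarrow> (real ^ 'n) \<times> real \<Rightarrow> real ^ 'n) \<Rightarrow> bool" where
  "weak_solution_ivp m U A B u0 u Du \<longleftrightarrow>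
     (\<forall>T>0. weak_solution UNIV T m U A B u Du) \<and>
     (\<forall>i. (\<forall>t\<ge>0. L1loc_lim UNIV (\<lambda>s x. u (x, s) $ i) (\<lambda>x. u (x, t) $ i) (at t within {0..})) \<and>
          (AE x in lebesgue. u (x, 0) $ i = u0 x $ i))"

end

theory Submission
  imports Defs
begin

text \<open>
  Since \<open>m = 1\<close>, a weak solution has its flux \<open>F = \<A>(\<nabla>u\<^sup>i, u\<^sup>i, x, t)\<close> in \<open>L\<^sup>2(\<real>\<^sup>n \<times> (0,T))\<close>.
  Testing the equation with cutoffs \<open>\<zeta>\<^sub>R\<close> of scale \<open>R\<close>, the mass inside a ball of radius \<open>R\<close> changes by at most
  \<open>4 / R \<integral>\<integral>\<^bsub>|x| \<le> R\<^esub> |F|\<close>, so it suffices that this quantity tends to \<open>0\<close>.  Where \<open>u\<^sup>i \<ge> 1\<close> one has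
  \<open>|F| \<le> |F|\<^sup>2 + u\<^sup>i\<close>.  Where \<open>u\<^sup>i < 1\<close>, one bounds \<open>|F|\<close> by \<open>|\<nabla>u\<^sup>i|\<close> and \<open>u\<^sup>i\<close> and uses the energy inequality
  for the entropy \<open>G\<close> with \<open>G' = g\<close>, \<open>g(s) = ln ((1 + L s) / (1 + s))\<close>, \<open>L\<close> a power of \<open>R\<close>: it is convex, \<open>g \<le> ln L\<close> grows only
  logarithmically in \<open>R\<close>, and \<open>1 / g'(s)\<close> is comparable to \<open>s + 1/L\<close>, so that \<open>\<integral>\<integral> |\<nabla>u\<^sup>i|\<close> is controlled by
  \<open>\<integral>\<integral> g'(u\<^sup>i) |\<nabla>u\<^sup>i|\<^sup>2\<close> and \<open>\<integral>\<integral> (u\<^sup>i + 1/L)\<close>.  The outcome is a recursive estimate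
  \<open>\<sigma>(R) \<le> K + k R\<^sup>-\<^sup>1\<^sup>/\<^sup>2 \<sigma>(4R)\<close> for \<open>\<sigma>(R) = 1 + \<integral>\<integral>\<^bsub>|x| \<le> R\<^esub> (u\<^sup>i + |F| / R)\<close>; as \<open>\<sigma>\<close> grows at most
  polynomially, it is bounded, and then the flux term decays.

  The energy inequality is obtained by mollifying in space only: convexity of \<open>G\<close> replaces the chain rule in time.
\<close>

section \<open>Translation and averaging in L1\<close>

text \<open>The flux is only known to be square integrable on space-time. Cauchy-Schwarz on the ball
  of radius R bounds \<open>1 / R\<close> times its L1 norm by O(R^(n/2 - 1)), which does not decay
  for n >= 2. The decay has to come from the finite mass: the square of the L1 norm of the gradient
  is at most the integral of g'(u) |grad u|^2 times that of 1 / g'(u), and the second factor is a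
  mass if g'(u) behaves like 1 / u. This would make g a logarithm, unbounded at u = 0, hence the
  truncation at 1 / L. The choice L = (4R)^n makes 1 / L times the volume of the ball of radius 4R
  independent of R. The truncation costs a factor ln L in front of the initial mass and of the
  cutoff error. The two factors are therefore balanced by Young's inequality with weight R^(-1/2),
  which keeps both losses of order sqrt R; the factor 1 / R from the gradient of the cutoff beats
  them.\<close>

lemma lborel_distr_add: "distr lborel borel (\<lambda>x::'a::euclidean_space. x + a) = lborel"
  using lborel_affine[of 1 a] by (simp add: density_1 add.commute)

lemma lborel_distr_diff: "distr lborel borel (\<lambda>x::'a::euclidean_space. a - x) = lborel"
  using lborel_affine[of "-1" a] by (simp add: density_1)

lemma lborel_translate:
  fixes f :: "'a::euclidean_space \<Rightarrow> 'b::{banach,second_countable_topology}"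
  assumes [measurable]: "f \<in> borel_measurable borel"
  shows lborel_integrable_translate: "integrable lborel (\<lambda>x. f (x + a)) \<longleftrightarrow> integrable lborel f"
    and lborel_integral_translate: "integral\<^sup>L lborel (\<lambda>x. f (x + a)) = integral\<^sup>L lborel f"
    and lborel_integral_reflect: "integral\<^sup>L lborel (\<lambda>x. f (a - x)) = integral\<^sup>L lborel f"
proof -
  show "integrable lborel (\<lambda>x. f (x + a)) \<longleftrightarrow> integrable lborel f"
    using integrable_distr_eq[of "\<lambda>x. x + a" lborel borel f] by (simp add: lborel_distr_add)
  show "integral\<^sup>L lborel (\<lambda>x. f (x + a)) = integral\<^sup>L lborel f"
    using integral_distr[of "\<lambda>x. x + a" lborel borel f] by (simp add: lborel_distr_add)
  show "integral\<^sup>L lborel (\<lambda>x. f (a - x)) = integral\<^sup>L lborel f"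
    using integral_distr[of "\<lambda>x. a - x" lborel borel f] by (simp add: lborel_distr_diff)
qed

definition trans_cont :: "('a::euclidean_space \<Rightarrow> 'b::euclidean_space) \<Rightarrow> bool" where
  "trans_cont f \<longleftrightarrow> ((\<lambda>v. LINT x|lborel. norm (f (x + v) - f x)) \<longlongrightarrow> 0) (at 0)"

text \<open>A three-epsilon argument: by translation invariance the shifted error
  \<open>f (x + v) - g (x + v)\<close> has the same norm as \<open>f - g\<close>.\<close>

lemma trans_cont_approx:
  fixes f :: "'a::euclidean_space \<Rightarrow> 'b::euclidean_space"
  assumes f: "integrable lborel f"
    and ap: "\<And>e. e > 0 \<Longrightarrow> \<exists>g. integrable lborel g \<and> trans_cont g \<and> (LINT x|lborel. norm (f x - g x)) < e"
  shows "trans_cont f"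
  unfolding trans_cont_def
proof (rule tendstoI)
  fix e :: real assume "e > 0"
  then obtain g where g: "integrable lborel g" "trans_cont g" and
    fg: "(LINT x|lborel. norm (f x - g x)) < e/3" using ap[of "e/3"] by auto
  have mf[measurable]: "f \<in> borel_measurable borel" and mg[measurable]: "g \<in> borel_measurable borel"
    using f g(1) by auto
  have "\<forall>\<^sub>F v in at 0. dist (LINT x|lborel. norm (g (x + v) - g x)) 0 < e/3"
    using g(2) \<open>e > 0\<close> unfolding trans_cont_def by (intro tendstoD) auto
  then show "\<forall>\<^sub>F v in at 0. dist (LINT x|lborel. norm (f (x + v) - f x)) 0 < e"
  proof eventually_elim
    case (elim v)
    have fv: "integrable lborel (\<lambda>x. f (x + v))" and gv: "integrable lborel (\<lambda>x. g (x + v))"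
      using f g(1) lborel_integrable_translate[OF mf] lborel_integrable_translate[OF mg] by auto
    have d: "integrable lborel (\<lambda>x. norm (f x - g x))" using f g by auto
    have "(LINT x|lborel. norm (f (x + v) - g (x + v))) = (LINT x|lborel. norm (f x - g x))"
      by (rule lborel_integral_translate[of "\<lambda>x. norm (f x - g x)"]) measurable
    moreover have "(LINT x|lborel. norm (f (x + v) - f x)) \<le>
      (LINT x|lborel. norm (f (x + v) - g (x + v)) + norm (g (x + v) - g x) + norm (f x - g x))"
    proof (rule integral_mono)
      show "norm (f (x + v) - f x) \<le> norm (f (x + v) - g (x + v)) + norm (g (x + v) - g x) + norm (f x - g x)" for x
        using norm_triangle_ineq4[of "(f (x + v) - g (x + v)) + (g (x + v) - g x)" "f x - g x"]
          norm_triangle_ineq[of "f (x + v) - g (x + v)" "g (x + v) - g x"] by simp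
    qed (use fv gv f g in auto)
    moreover have "\<dots> = (LINT x|lborel. norm (f (x + v) - g (x + v))) + (LINT x|lborel. norm (g (x + v) - g x))
        + (LINT x|lborel. norm (f x - g x))"
      using fv gv f g by simp
    moreover have "(LINT x|lborel. norm (f (x + v) - f x)) \<ge> 0" by simp
    ultimately show ?case using elim fg by auto
  qed
qed

text \<open>The points that leave \<open>U\<close> under a small shift are controlled by dominated
  convergence, since openness makes the loss vanish pointwise. The gain has the same integral as the
  loss because both indicators have the same total mass; this is the identity |a - b| = 2 max(0, b -
  a) + (a - b).\<close>

lemma trans_cont_open:
  fixes c :: "'b::euclidean_space"
  assumes U: "open U" and fin: "emeasure lborel (U::'a::euclidean_space set) < \<infinity>"
  shows "trans_cont (\<lambda>x. indicator U x *\<^sub>R c)"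
proof -
  let ?i = "indicator U :: 'a \<Rightarrow> real"
  have [measurable]: "U \<in> sets borel" using U by auto
  have i: "integrable lborel ?i" using fin U by auto
  have "((\<lambda>v. LINT x|lborel. norm (?i (x + v) *\<^sub>R c - ?i x *\<^sub>R c)) \<longlongrightarrow> 0) (at 0)"
    unfolding tendsto_at_iff_sequentially
  proof (intro allI impI)
    fix X :: "nat \<Rightarrow> 'a" assume X: "\<forall>i. X i \<in> UNIV - {0}" "X \<longlonglongrightarrow> 0"
    have iv: "integrable lborel (\<lambda>x. ?i (x + v))" for v
      using i lborel_integrable_translate[of ?i v] by auto
    have l: "(\<lambda>n. LINT x|lborel. max 0 (?i x - ?i (x + X n))) \<longlonglongrightarrow> (LINT x::'a|lborel. 0)"
    proof (rule integral_dominated_convergence[where w = ?i])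
      show "AE x in lborel. (\<lambda>n. max 0 (?i x - ?i (x + X n))) \<longlonglongrightarrow> 0"
      proof (rule AE_I2)
        fix x
        show "(\<lambda>n. max 0 (?i x - ?i (x + X n))) \<longlonglongrightarrow> 0"
        proof (cases "x \<in> U")
          case True
          have "(\<lambda>n. x + X n) \<longlonglongrightarrow> x + 0" by (intro tendsto_intros X)
          then have "\<forall>\<^sub>F n in sequentially. x + X n \<in> U"
            using True U by (auto intro: topological_tendstoD)
          then show ?thesis
            by (intro tendsto_eventually) (auto elim: eventually_mono simp: indicator_def)
        qed (auto simp: indicator_def)
      qed
    qed (use i in \<open>auto simp: indicator_def\<close>)
    have eq: "(LINT x|lborel. norm (?i (x + v) *\<^sub>R c - ?i x *\<^sub>R c)) =
       norm c * (2 * (LINT x|lborel. max 0 (?i x - ?i (x + v))))" for v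
    proof -
      have "(LINT x|lborel. norm (?i (x + v) *\<^sub>R c - ?i x *\<^sub>R c)) =
         (LINT x|lborel. norm c * (2 * max 0 (?i x - ?i (x + v)) + (?i (x + v) - ?i x)))"
        by (rule Bochner_Integration.integral_cong) (auto simp: indicator_def)
      also have "\<dots> = norm c * (2 * (LINT x|lborel. max 0 (?i x - ?i (x + v))) +
          ((LINT x|lborel. ?i (x + v)) - (LINT x|lborel. ?i x)))"
        using i iv by simp
      also have "(LINT x|lborel. ?i (x + v)) = (LINT x|lborel. ?i x)"
        by (rule lborel_integral_translate) measurable
      finally show ?thesis by simp
    qed
    have "(\<lambda>n. norm c * (2 * (LINT x|lborel. max 0 (?i x - ?i (x + X n))))) \<longlonglongrightarrow> norm c * (2 * 0)"
      using l by (intro tendsto_intros) simp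
    then show "((\<lambda>v. LINT x|lborel. norm (?i (x + v) *\<^sub>R c - ?i x *\<^sub>R c)) \<circ> X) \<longlonglongrightarrow> 0"
      by (simp only: eq o_def) simp
  qed
  then show ?thesis unfolding trans_cont_def .
qed

lemma L1_translation_continuous:
  fixes f :: "'a::euclidean_space \<Rightarrow> 'b::euclidean_space"
  assumes "integrable lborel f"
  shows "trans_cont f"
  using assms
proof (induction f rule: integrable_induct)
  case (base A c)
  then have A[measurable]: "A \<in> sets borel" by auto
  show ?case
  proof (rule trans_cont_approx)
    show "integrable lborel (\<lambda>x. indicator A x *\<^sub>R c)" using base by auto
  next
    fix e :: real assume "e > 0"
    \<comment> \<open>The \<open>+ 1\<close> covers \<open>c = 0\<close>; what is needed at the end
      is \<open>norm c * d < e\<close>.\<close>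
    define d where "d = e / (norm c + 1)"
    have "d > 0" using \<open>e > 0\<close> by (simp add: d_def add_nonneg_pos)
    then obtain U where U: "open U" "A \<subseteq> U" and em: "emeasure lborel (U - A) < d"
      using outer_regular_lborel[of A d] A by auto
    have fin: "emeasure lborel U < \<infinity>"
    proof -
      have "emeasure lborel U = emeasure lborel ((U - A) \<union> A)" using U by (simp add: Un_absorb2)
      also have "\<dots> \<le> emeasure lborel (U - A) + emeasure lborel A"
        using U by (intro emeasure_subadditive) auto
      also have "\<dots> < \<infinity>" using em base(2) by (auto simp: ennreal_add_eq_top less_top[symmetric])
      finally show ?thesis .
    qed
    have m: "measure lborel (U - A) < d"
      using em \<open>d > 0\<close> unfolding measure_def
      by (metis enn2real_less_iff ennreal_less_top less_trans linorder_not_less ennreal_enn2real_if order_less_imp_le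
          enn2real_nonneg ennreal_less_iff)
    have "(LINT x|lborel. norm (indicator A x *\<^sub>R c - indicator U x *\<^sub>R c)) = (LINT x|lborel. norm c * indicator (U - A) x)"
      using U by (intro Bochner_Integration.integral_cong) (auto simp: indicator_def)
    also have "\<dots> = norm c * measure lborel (U - A)" by simp
    also have "\<dots> \<le> norm c * d" using m by (intro mult_left_mono) auto
    also have "\<dots> < e"
    proof -
      have "norm c * e < e * (norm c + 1)" using \<open>e > 0\<close> by (simp add: algebra_simps)
      then show ?thesis by (simp add: d_def pos_divide_less_eq add_nonneg_pos)
    qed
    finally show "\<exists>g. integrable lborel g \<and> trans_cont g \<and> (LINT x|lborel. norm (indicator A x *\<^sub>R c - g x)) < e"
      using trans_cont_open[OF U(1) fin] fin U(1) by (intro exI[of _ "\<lambda>x. indicator U x *\<^sub>R c"]) auto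
  qed
next
  case (add f g)
  have [measurable]: "f \<in> borel_measurable borel" "g \<in> borel_measurable borel"
    using add by auto
  have v: "integrable lborel (\<lambda>x. f (x + v))" "integrable lborel (\<lambda>x. g (x + v))" for v
    using add by (auto simp: lborel_integrable_translate)
  have "((\<lambda>v. LINT x|lborel. norm (f (x + v) + g (x + v) - (f x + g x))) \<longlongrightarrow> 0) (at 0)"
  proof (rule tendsto_sandwich[OF _ _ tendsto_const])
    show "((\<lambda>v. (LINT x|lborel. norm (f (x + v) - f x)) + (LINT x|lborel. norm (g (x + v) - g x))) \<longlongrightarrow> 0) (at 0)"
      using tendsto_add[OF add(3)[unfolded trans_cont_def] add(4)[unfolded trans_cont_def]] by simp
    show "\<forall>\<^sub>F v in at 0. (LINT x|lborel. norm (f (x + v) + g (x + v) - (f x + g x))) \<le>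
      (LINT x|lborel. norm (f (x + v) - f x)) + (LINT x|lborel. norm (g (x + v) - g x))"
    proof (intro always_eventually allI)
      fix v
      have "(LINT x|lborel. norm (f (x + v) + g (x + v) - (f x + g x))) \<le>
        (LINT x|lborel. norm (f (x + v) - f x) + norm (g (x + v) - g x))"
        using v add by (intro integral_mono) (auto intro: norm_diff_triangle_ineq)
      then show "(LINT x|lborel. norm (f (x + v) + g (x + v) - (f x + g x))) \<le>
         (LINT x|lborel. norm (f (x + v) - f x)) + (LINT x|lborel. norm (g (x + v) - g x))"
        using v add by simp
    qed
  qed auto
  then show ?case by (simp add: trans_cont_def)
next
  case (lim f s)
  show ?case
  proof (rule trans_cont_approx[OF lim(4)])
    fix e :: real assume "e > 0"
    have [measurable]: "f \<in> borel_measurable lborel" "\<And>i. s i \<in> borel_measurable lborel" using lim by auto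
    \<comment> \<open>The approximating functions of the induction satisfy norm (s i x) <= 2 norm (f
      x), whence the dominating factor 3.\<close>
    have "(\<lambda>i. LINT x|lborel. norm (f x - s i x)) \<longlonglongrightarrow> (LINT x::'a|lborel. 0)"
    proof (rule integral_dominated_convergence[where w = "\<lambda>x. 3 * norm (f x)"])
      show "AE x in lborel. (\<lambda>i. norm (f x - s i x)) \<longlonglongrightarrow> 0"
      proof (rule AE_I2)
        fix x
        have "(\<lambda>i. norm (f x - s i x)) \<longlonglongrightarrow> norm (f x - f x)" by (intro tendsto_intros lim(2)) auto
        then show "(\<lambda>i. norm (f x - s i x)) \<longlonglongrightarrow> 0" by simp
      qed
      show "AE x in lborel. norm (norm (f x - s i x)) \<le> 3 * norm (f x)" for i
      proof (rule AE_I2)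
        fix x
        show "norm (norm (f x - s i x)) \<le> 3 * norm (f x)"
          using lim(3)[of x i] norm_triangle_ineq4[of "f x" "s i x"] by simp
      qed
    qed (use lim in auto)
    then have "(\<lambda>i. LINT x|lborel. norm (f x - s i x)) \<longlonglongrightarrow> 0" by simp
    then have "\<forall>\<^sub>F i in sequentially. (LINT x|lborel. norm (f x - s i x)) < e"
      using \<open>e > 0\<close> by (rule order_tendstoD)
    then obtain i where "(LINT x|lborel. norm (f x - s i x)) < e"
      by (auto simp: eventually_sequentially)
    then show "\<exists>g. integrable lborel g \<and> trans_cont g \<and> (LINT x|lborel. norm (f x - g x)) < e"
      using lim(1)[of i] lim(5)[of i] by blast
  qed
qed

text \<open>The map \<iota> lets the kernel live on a space of lower dimension than
  \<open>f\<close>: with \<open>\<iota> y = (y, 0)\<close> the average is taken in the space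
  variable alone, with the identity in all variables. Fubini applies because a shift does not change
  the L1 norm.\<close>

lemma L1_averaging:
  fixes f :: "'a::euclidean_space \<Rightarrow> 'b::euclidean_space" and \<iota> :: "'c::euclidean_space \<Rightarrow> 'a"
  assumes f: "integrable lborel f" and \<iota>: "bounded_linear \<iota>"
    and k: "integrable lborel k" "\<And>y. 0 \<le> k y"
  shows L1_averaging_product: "integrable (lborel \<Otimes>\<^sub>M lborel) (\<lambda>(y, z). k y *\<^sub>R f (z - \<iota> y))"
    and L1_averaging_integrable: "integrable lborel (\<lambda>z. LINT y|lborel. k y *\<^sub>R f (z - \<iota> y))"
    and L1_averaging_AE: "AE z in lborel. integrable lborel (\<lambda>y. k y *\<^sub>R f (z - \<iota> y))"
proof -
  have mf[measurable]: "f \<in> borel_measurable borel" and [measurable]: "k \<in> borel_measurable borel"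
    using f k(1) by auto
  have "continuous_on UNIV \<iota>" using \<iota> by (rule linear_continuous_on)
  then have [measurable]: "\<iota> \<in> borel_measurable borel" by (rule borel_measurable_continuous_onI)
  have shift: "integrable lborel (\<lambda>z. f (z + v))" for v
    using f lborel_integrable_translate[OF mf] by auto
  show int2: "integrable (lborel \<Otimes>\<^sub>M lborel) (\<lambda>(y, z). k y *\<^sub>R f (z - \<iota> y))"
  proof (rule lborel_pair.Fubini_integrable)
    have "(LINT z|lborel. norm (f (z - \<iota> y))) = (LINT z|lborel. norm (f z))" for y
      using lborel_integral_translate[of "\<lambda>z. norm (f z)" "- \<iota> y"] by simp
    then have "(LINT z|lborel. norm (case (y, z) of (y, z) \<Rightarrow> k y *\<^sub>R f (z - \<iota> y))) =
      k y * (LINT z|lborel. norm (f z))" for y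
      using k(2) by simp
    then show "integrable lborel (\<lambda>y. LINT z|lborel. norm (case (y, z) of (y, z) \<Rightarrow> k y *\<^sub>R f (z - \<iota> y)))"
      using k(1) by simp
    show "AE y in lborel. integrable lborel (\<lambda>z. case (y, z) of (y, z) \<Rightarrow> k y *\<^sub>R f (z - \<iota> y))"
      using shift[of "- \<iota> y" for y] by (intro AE_I2) simp
  qed measurable
  show "integrable lborel (\<lambda>z. LINT y|lborel. k y *\<^sub>R f (z - \<iota> y))"
    using lborel_pair.integrable_snd[OF int2] .
  show "AE z in lborel. integrable lborel (\<lambda>y. k y *\<^sub>R f (z - \<iota> y))"
    using lborel_pair.AE_integrable_snd[OF int2] by simp
qed

text \<open>Minkowski's inequality: the L1 error is at most the \<open>k j\<close>-average of the
  translation modulus \<open>T\<close>, evaluated on shifts whose size tends to 0 with the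
  supports.\<close>

lemma L1_averaging_converges:
  fixes f :: "'a::euclidean_space \<Rightarrow> 'b::euclidean_space" and \<iota> :: "'c::euclidean_space \<Rightarrow> 'a"
  assumes f: "integrable lborel f" and \<iota>: "bounded_linear \<iota>"
    and k: "\<And>j::nat. integrable lborel (k j)" "\<And>j y. 0 \<le> k j y" "\<And>j. integral\<^sup>L lborel (k j) = 1"
    and supp: "\<And>j y. k j y \<noteq> 0 \<Longrightarrow> norm y \<le> \<delta> j" and \<delta>: "\<delta> \<longlonglongrightarrow> 0"
  defines "a \<equiv> \<lambda>j z. LINT y|lborel. k j y *\<^sub>R f (z - \<iota> y)"
  shows "(\<lambda>j. LINT z|lborel. norm (a j z - f z)) \<longlonglongrightarrow> 0"
proof -
  have mf[measurable]: "f \<in> borel_measurable borel" using f by auto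
  have mk[measurable]: "k j \<in> borel_measurable borel" for j using k(1)[of j] by auto
  have "continuous_on UNIV \<iota>" using \<iota> by (rule linear_continuous_on)
  then have [measurable]: "\<iota> \<in> borel_measurable borel" by (rule borel_measurable_continuous_onI)
  note int2 = L1_averaging_product[OF f \<iota> k(1,2)]
    and ik = L1_averaging_AE[OF f \<iota> k(1,2)]
  have ia: "integrable lborel (a j)" for j
    unfolding a_def by (rule L1_averaging_integrable[OF f \<iota> k(1,2)])
  define T where "T = (\<lambda>v. LINT z|lborel. norm (f (z + v) - f z))"
  have mT: "T \<in> borel_measurable borel" unfolding T_def by measurable
  have T0: "(T \<longlongrightarrow> 0) (at 0)"
    using L1_translation_continuous[OF f] by (simp add: trans_cont_def T_def)
  have Tnn: "0 \<le> T v" for v by (simp add: T_def)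
  obtain C where C: "C > 0" "\<And>y. norm (\<iota> y) \<le> norm y * C"
    using bounded_linear.pos_bounded[OF \<iota>] by blast
  have bound: "(LINT z|lborel. norm (a j z - f z)) \<le> (LINT y|lborel. k j y * T (- \<iota> y))" for j
  proof -
    have "integrable (lborel \<Otimes>\<^sub>M lborel) (\<lambda>(y, z). k j y *\<^sub>R f z)"
    proof (rule lborel_pair.Fubini_integrable)
      show "integrable lborel (\<lambda>y. LINT z|lborel. norm (case (y, z) of (y, z) \<Rightarrow> k j y *\<^sub>R f z))"
        using k by (simp add: integrable_mult_right)
    qed (use f in auto)
    then have "integrable (lborel \<Otimes>\<^sub>M lborel) (\<lambda>p. (\<lambda>(y, z). k j y *\<^sub>R f (z - \<iota> y)) p - (\<lambda>(y, z). k j y *\<^sub>R f z) p)"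
      using int2 by (rule Bochner_Integration.integrable_diff[rotated])
    then have "integrable (lborel \<Otimes>\<^sub>M lborel) (\<lambda>p. norm ((\<lambda>(y, z). k j y *\<^sub>R f (z - \<iota> y)) p - (\<lambda>(y, z). k j y *\<^sub>R f z) p))"
      by (rule integrable_norm)
    then have d: "integrable (lborel \<Otimes>\<^sub>M lborel) (\<lambda>(y, z). k j y * norm (f (z - \<iota> y) - f z))"
      by (rule Bochner_Integration.integrable_cong[THEN iffD1, rotated -1])
         (use k(2) in \<open>auto simp flip: scaleR_diff_right\<close>)
    have "(LINT z|lborel. norm (a j z - f z)) \<le> (LINT z|lborel. (LINT y|lborel. k j y * norm (f (z - \<iota> y) - f z)))"
    proof (rule integral_mono_AE)
      show "AE z in lborel. norm (a j z - f z) \<le> (LINT y|lborel. k j y * norm (f (z - \<iota> y) - f z))"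
        using ik[of j]
      proof eventually_elim
        case (elim z)
        have "a j z - f z = (LINT y|lborel. k j y *\<^sub>R f (z - \<iota> y)) - (LINT y|lborel. k j y *\<^sub>R f z)"
          using k by (simp add: a_def)
        also have "\<dots> = (LINT y|lborel. k j y *\<^sub>R f (z - \<iota> y) - k j y *\<^sub>R f z)"
          using elim k by (intro Bochner_Integration.integral_diff[symmetric]) auto
        also have "norm \<dots> \<le> (LINT y|lborel. norm (k j y *\<^sub>R f (z - \<iota> y) - k j y *\<^sub>R f z))"
          by (rule integral_norm_bound)
        also have "\<dots> = (LINT y|lborel. k j y * norm (f (z - \<iota> y) - f z))"
          using k(2) by (intro Bochner_Integration.integral_cong) (auto simp flip: scaleR_diff_right)
        finally show ?case .
      qed
    qed (use ia f lborel_pair.integrable_snd[OF d] in auto)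
    also have "\<dots> = (LINT y|lborel. (LINT z|lborel. k j y * norm (f (z - \<iota> y) - f z)))"
      using lborel_pair.Fubini_integral[OF d] by simp
    also have "\<dots> = (LINT y|lborel. k j y * T (- \<iota> y))" by (simp add: T_def)
    finally show ?thesis .
  qed
  show "(\<lambda>j. LINT z|lborel. norm (a j z - f z)) \<longlonglongrightarrow> 0"
  proof (rule LIMSEQ_I)
    fix e :: real assume "e > 0"
    then have "\<forall>\<^sub>F v in at 0. dist (T v) 0 < e/2" by (intro tendstoD T0) auto
    then obtain d where d: "d > 0" "\<And>v. v \<noteq> 0 \<Longrightarrow> norm v < d \<Longrightarrow> T v < e/2"
      unfolding eventually_at using Tnn by auto
    \<comment> \<open>The filter \<open>at 0\<close> says nothing about the shift 0, where
      \<open>T\<close> vanishes.\<close>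
    have d': "T v \<le> e/2" if "norm v < d" for v
      using d(2)[of v] that \<open>e > 0\<close> by (cases "v = 0") (auto simp: T_def)
    have "\<forall>\<^sub>F j in sequentially. \<delta> j < d / C"
      using \<delta> d(1) C(1) by (auto intro: order_tendstoD)
    then obtain J where J: "\<And>j. j \<ge> J \<Longrightarrow> \<delta> j < d / C" by (auto simp: eventually_sequentially)
    show "\<exists>N. \<forall>j\<ge>N. norm ((LINT z|lborel. norm (a j z - f z)) - 0) < e"
    proof (intro exI[of _ J] allI impI)
      fix j assume "J \<le> j"
      have le: "k j y * T (- \<iota> y) \<le> k j y * (e/2)" for y
      proof (cases "k j y = 0")
        case False
        then have "norm (\<iota> y) < d"
          using supp[OF False] J[OF \<open>J \<le> j\<close>] C(2)[of y] C(1) by (simp add: pos_less_divide_eq) (smt (verit) mult_right_mono)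
        then show ?thesis using k(2) d' by (intro mult_left_mono) auto
      qed auto
      have "(LINT y|lborel. k j y * T (- \<iota> y)) \<le> (LINT y|lborel. k j y * (e/2))"
      proof (rule integral_mono)
        show "integrable lborel (\<lambda>y. k j y * T (- \<iota> y))"
          by (rule Bochner_Integration.integrable_bound[OF integrable_mult_left[OF k(1)[of j], of "e/2"]])
             (use le Tnn k(2) \<open>e > 0\<close> mT in auto)
      qed (use le k in auto)
      also have "\<dots> = e/2" using k by simp
      finally show "norm ((LINT z|lborel. norm (a j z - f z)) - 0) < e"
        using bound[of j] \<open>e > 0\<close> by simp
    qed
  qed
qed

text \<open>Along a subsequence with errors below 2^(-k) the sum of the errors is integrable, hence
  finite almost everywhere. Its terms then tend to 0, and the limit plus this sum is a common
  majorant.\<close>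

lemma L1_convergent_dominated_subseq:
  fixes u :: "nat \<Rightarrow> 'a \<Rightarrow> 'b::{banach, second_countable_topology}"
  assumes u: "\<And>n. integrable M (u n)" and f: "integrable M f"
    and lim: "(\<lambda>n. LINT x|M. norm (u n x - f x)) \<longlonglongrightarrow> 0"
  obtains r h where "strict_mono (r::nat \<Rightarrow> nat)" "integrable M (h::'a \<Rightarrow> real)"
    "AE x in M. (\<lambda>n. u (r n) x) \<longlonglongrightarrow> f x" "AE x in M. \<forall>n. norm (u (r n) x) \<le> h x"
proof -
  have "\<exists>n>m. (LINT x|M. norm (u n x - f x)) < (1/2)^k" for m k
  proof -
    have "\<forall>\<^sub>F n in sequentially. (LINT x|M. norm (u n x - f x)) < (1/2)^k"
      using lim by (rule order_tendstoD) auto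
    with eventually_gt_at_top[of m] have "\<forall>\<^sub>F n in sequentially. n > m \<and> (LINT x|M. norm (u n x - f x)) < (1/2)^k"
      by (rule eventually_conj)
    then show ?thesis by (auto simp: eventually_sequentially)
  qed
  note ex = this
  have "\<exists>r. \<forall>k. (LINT x|M. norm (u (r k) x - f x)) < (1/2)^k \<and> r k < r (Suc k)"
  proof (rule dependent_nat_choice)
    show "\<exists>n. (LINT x|M. norm (u n x - f x)) < (1/2)^0" using ex by blast
    show "\<exists>y. (LINT x|M. norm (u y x - f x)) < (1/2)^Suc k \<and> n < y" for n k using ex by blast
  qed
  then obtain r where r: "\<And>k. (LINT x|M. norm (u (r k) x - f x)) < (1/2)^k" "strict_mono r"
    by (auto simp: strict_mono_Suc_iff)
  define d where "d = (\<lambda>k x. norm (u (r k) x - f x))"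
  have d: "integrable M (d k)" "0 \<le> d k x" for k x using u f by (auto simp: d_def)
  have sm: "summable (\<lambda>k. LINT x|M. d k x)"
    by (rule summable_comparison_test'[OF summable_geometric[of "1/2::real"]])
       (use r(1) d in \<open>auto simp: d_def less_imp_le\<close>)
  have "(\<integral>\<^sup>+x. (\<Sum>k. ennreal (d k x)) \<partial>M) = (\<Sum>k. \<integral>\<^sup>+x. ennreal (d k x) \<partial>M)"
    using d by (intro nn_integral_suminf) auto
  also have "\<dots> = (\<Sum>k. ennreal (LINT x|M. d k x))" using d by (simp add: nn_integral_eq_integral)
  also have "\<dots> = ennreal (\<Sum>k. LINT x|M. d k x)"
    using sm d by (intro suminf_ennreal2) auto
  finally have "(\<integral>\<^sup>+x. (\<Sum>k. ennreal (d k x)) \<partial>M) \<noteq> \<infinity>" by simp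
  then have "AE x in M. (\<Sum>k. ennreal (d k x)) \<noteq> \<infinity>"
    using d by (intro nn_integral_PInf_AE) auto
  then have s: "AE x in M. summable (\<lambda>k. d k x)"
    by eventually_elim (auto intro!: summable_suminf_not_top d)
  show ?thesis
  proof
    show "strict_mono r" by fact
    show "integrable M (\<lambda>x. norm (f x) + (\<Sum>k. d k x))"
      using f s sm d by (intro Bochner_Integration.integrable_add integrable_norm integrable_suminf) auto
    show "AE x in M. (\<lambda>n. u (r n) x) \<longlonglongrightarrow> f x"
      using s
    proof eventually_elim
      case (elim x)
      from summable_LIMSEQ_zero[OF this] show ?case
        by (simp add: d_def tendsto_norm_zero_iff LIM_zero_iff)
    qed
    show "AE x in M. \<forall>n. norm (u (r n) x) \<le> norm (f x) + (\<Sum>k. d k x)"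
      using s
    proof eventually_elim
      case (elim x)
      show ?case
      proof
        fix n
        have "d n x \<le> (\<Sum>k. d k x)"
          using sum_le_suminf[OF elim, of "{n}"] d by auto
        then show "norm (u (r n) x) \<le> norm (f x) + (\<Sum>k. d k x)"
          using norm_triangle_ineq2[of "u (r n) x" "f x"] by (simp add: d_def)
      qed
    qed
  qed
qed

section \<open>Test functions and convolution\<close>

lemma test_function_UNIV_iff:
  "test_function UNIV \<phi> D \<longleftrightarrow>
    (\<forall>x. GDERIV \<phi> x :> D x) \<and> continuous_on UNIV D \<and> (\<exists>R. \<forall>x. R < norm x \<longrightarrow> \<phi> x = 0)" (is "?l = ?r")
proof
  assume ?l
  then have c: "compact (closure {x. \<phi> x \<noteq> 0})" by (simp add: test_function_def)
  then obtain R where "\<And>x. x \<in> closure {x. \<phi> x \<noteq> 0} \<Longrightarrow> norm x \<le> R"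
    by (meson compact_imp_bounded bounded_iff)
  then have "\<forall>x. R < norm x \<longrightarrow> \<phi> x = 0" using closure_subset[of "{x. \<phi> x \<noteq> 0}"] by force
  with \<open>?l\<close> show ?r by (auto simp: test_function_def)
next
  assume r: ?r
  then obtain R where R: "\<forall>x. R < norm x \<longrightarrow> \<phi> x = 0" by blast
  have "{x. \<phi> x \<noteq> 0} \<subseteq> cball 0 R" using R by (auto simp: not_less[symmetric])
  then have "bounded {x. \<phi> x \<noteq> 0}" by (rule bounded_subset[OF bounded_cball])
  then show ?l using r by (simp add: test_function_def compact_closure)
qed

lemma GDERIV_zero_outside:
  assumes g: "GDERIV \<phi> x :> D" and z: "\<And>y. R < norm y \<Longrightarrow> \<phi> y = 0" and x: "R < norm x"
  shows "D = 0"
proof -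
  have "open (- cball (0::'a) R)" by auto
  have "((\<lambda>h. h \<bullet> D) = (\<lambda>h. 0))"
  proof (rule has_derivative_unique)
    show "(\<phi> has_derivative (\<lambda>h. h \<bullet> D)) (at x)" using g by (simp add: gderiv_def)
    have "((\<lambda>_. 0) has_derivative (\<lambda>h. 0)) (at x)" by simp
    then show "(\<phi> has_derivative (\<lambda>h. 0)) (at x)"
      by (rule has_derivative_transform_within_open[OF _ \<open>open (- cball 0 R)\<close>]) (use x z in auto)
  qed
  then show "D = 0" by (metis inner_eq_zero_iff)
qed

lemma continuous_compact_support_bounded:
  fixes f :: "'a::euclidean_space \<Rightarrow> 'b::real_normed_vector"
  assumes c: "continuous_on UNIV f" and z: "\<And>x. R < norm x \<Longrightarrow> f x = 0"
  obtains B where "B > 0" "\<And>x. norm (f x) \<le> B"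
proof -
  have "compact (f ` cball 0 R)" by (intro compact_continuous_image continuous_on_subset[OF c]) auto
  then obtain B where B: "B > 0" "\<And>y. y \<in> f ` cball 0 R \<Longrightarrow> norm y \<le> B"
    using compact_imp_bounded bounded_pos by metis
  have "norm (f x) \<le> B" for x
    using B z[of x] by (cases "R < norm x") auto
  with B(1) show ?thesis by (rule that)
qed

lemma continuous_compact_support_uniform:
  fixes f :: "'a::euclidean_space \<Rightarrow> 'b::real_normed_vector"
  assumes c: "continuous_on UNIV f" and z: "\<And>x. R < norm x \<Longrightarrow> f x = 0" and "e > 0"
  obtains d where "d > 0" "\<And>x y. norm (x - y) < d \<Longrightarrow> norm (f x - f y) < e"
proof -
  have "uniformly_continuous_on (cball 0 (R + 1)) f"
    by (intro compact_uniformly_continuous continuous_on_subset[OF c]) auto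
  then obtain d where d: "d > 0" "\<And>x y. x \<in> cball 0 (R+1) \<Longrightarrow> y \<in> cball 0 (R+1) \<Longrightarrow> dist x y < d \<Longrightarrow> dist (f x) (f y) < e"
    using \<open>e > 0\<close> unfolding uniformly_continuous_on_def by metis
  \<comment> \<open>With distance below 1, either both points lie in the ball of radius
    \<open>R + 1\<close>, where uniform continuity acts, or both lie beyond \<open>R\<close>, where
    \<open>f\<close> vanishes.\<close>
  show ?thesis
  proof (rule that[of "min d 1"])
    fix x y :: 'a assume xy: "norm (x - y) < min d 1"
    show "norm (f x - f y) < e"
    proof (cases "norm x \<le> R + 1 \<and> norm y \<le> R + 1")
      case True
      with xy d(2)[of x y] show ?thesis by (simp add: dist_norm)
    next
      case False
      have "\<bar>norm x - norm y\<bar> < 1" using xy norm_triangle_ineq3[of x y] by simp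
      with False have "R < norm x" "R < norm y" by auto
      then show ?thesis using z \<open>e > 0\<close> by simp
    qed
  qed (use d in auto)
qed

lemma test_functionE:
  assumes "test_function UNIV \<phi> D"
  obtains R B where "R > 0" "B > 0" "\<And>x. R < norm x \<Longrightarrow> \<phi> x = 0" "\<And>x. R < norm x \<Longrightarrow> D x = 0"
    "\<And>x. norm (\<phi> x) \<le> B" "\<And>x. norm (D x) \<le> B" "continuous_on UNIV \<phi>" "continuous_on UNIV D" "\<And>x. GDERIV \<phi> x :> D x"
proof -
  from assms obtain R0 where R0: "\<And>x. R0 < norm x \<Longrightarrow> \<phi> x = 0" and g: "\<And>x. GDERIV \<phi> x :> D x"
    and c: "continuous_on UNIV D" by (auto simp: test_function_UNIV_iff)
  define R where "R = max R0 1"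
  have R: "R > 0" "\<And>x. R < norm x \<Longrightarrow> \<phi> x = 0" using R0 by (auto simp: R_def)
  have z: "\<And>x. R < norm x \<Longrightarrow> D x = 0" using GDERIV_zero_outside[OF g R(2)] by blast
  have cp: "continuous_on UNIV \<phi>"
    using g unfolding gderiv_def
    by (intro continuous_at_imp_continuous_on ballI) (rule has_derivative_continuous)
  obtain B1 where B1: "B1 > 0" "\<And>x. norm (\<phi> x) \<le> B1"
    using continuous_compact_support_bounded[OF cp R(2)] by blast
  obtain B2 where B2: "B2 > 0" "\<And>x. norm (D x) \<le> B2"
    using continuous_compact_support_bounded[OF c z] by blast
  show ?thesis
  proof (rule that[of R "max B1 B2"])
    show "0 < max B1 B2" "\<And>x. norm (\<phi> x) \<le> max B1 B2" "\<And>x. norm (D x) \<le> max B1 B2"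
      using B1 B2 by (auto intro: max.coboundedI1 max.coboundedI2)
  qed (use R z cp c g in auto)
qed

section \<open>Local integrability and convolution with compactly supported kernels\<close>

definition locally_integrable :: "('a::euclidean_space \<Rightarrow> 'b::euclidean_space) \<Rightarrow> bool" where
  "locally_integrable v \<longleftrightarrow> (\<forall>R. integrable lborel (\<lambda>x. indicator (cball 0 R) x *\<^sub>R v x))"

text \<open>Integrability against \<open>lborel\<close> makes every truncation Borel, and
  \<open>v\<close> is their pointwise limit. The product-measure arguments below rest on Borel
  rather than Lebesgue measurability.\<close>

lemma locally_integrable_borel:
  assumes "locally_integrable v"
  shows "v \<in> borel_measurable borel"
proof -
  have "(\<lambda>n. indicator (cball 0 (real n)) x *\<^sub>R v x) \<longlonglongrightarrow> v x" for x
  proof (rule tendsto_eventually)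
    obtain N where "norm x \<le> real N" using real_arch_simple by blast
    then show "\<forall>\<^sub>F n in sequentially. indicator (cball 0 (real n)) x *\<^sub>R v x = v x"
      unfolding eventually_sequentially by (intro exI[of _ N]) auto
  qed
  moreover have "(\<lambda>x. indicator (cball 0 (real n)) x *\<^sub>R v x) \<in> borel_measurable lborel" for n
    using assms unfolding locally_integrable_def by (intro borel_measurable_integrable) auto
  ultimately show ?thesis
    using borel_measurable_LIMSEQ_metric[of "\<lambda>n x. indicator (cball 0 (real n)) x *\<^sub>R v x" lborel v] by simp
qed

lemma locally_integrable_mult:
  fixes v :: "'a::euclidean_space \<Rightarrow> real" and k :: "'a \<Rightarrow> 'b::euclidean_space"
  assumes v: "locally_integrable v" and k: "k \<in> borel_measurable borel" "\<And>x. R < norm x \<Longrightarrow> k x = 0" "\<And>x. norm (k x) \<le> B"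
  shows "integrable lborel (\<lambda>x. v x *\<^sub>R k x)"
    and "norm (LINT x|lborel. v x *\<^sub>R k x) \<le> (LINT x|lborel. indicator (cball 0 R) x * \<bar>v x\<bar>) * B"
proof -
  have [measurable]: "v \<in> borel_measurable borel" using v by (rule locally_integrable_borel)
  note [measurable] = k(1)
  have vi: "integrable lborel (\<lambda>x. indicator (cball 0 R) x * \<bar>v x\<bar>)"
  proof -
    have "integrable lborel (\<lambda>x. norm (indicator (cball 0 R) x *\<^sub>R v x))"
      using v unfolding locally_integrable_def by (intro integrable_norm) auto
    then show ?thesis by (simp add: abs_mult)
  qed
  have B: "0 \<le> B" using k(3)[of 0] norm_ge_zero order_trans by blast
  have b: "norm (v x *\<^sub>R k x) \<le> (indicator (cball 0 R) x * \<bar>v x\<bar>) * B" for x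
    using k(2)[of x] k(3)[of x] B by (auto simp: indicator_def intro: mult_left_mono)
  show i: "integrable lborel (\<lambda>x. v x *\<^sub>R k x)"
    by (rule Bochner_Integration.integrable_bound[OF integrable_mult_left[OF vi, of B]])
       (use b order_trans[OF b abs_ge_self] in auto)
  have "norm (LINT x|lborel. v x *\<^sub>R k x) \<le> (LINT x|lborel. (indicator (cball 0 R) x * \<bar>v x\<bar>) * B)"
    by (rule order_trans[OF integral_norm_bound])
       (intro integral_mono b integrable_norm i integrable_mult_left vi)
  then show "norm (LINT x|lborel. v x *\<^sub>R k x) \<le> (LINT x|lborel. indicator (cball 0 R) x * \<bar>v x\<bar>) * B"
    by simp
qed

text \<open>The kernel may be vector valued, so that one operator covers a kernel and its gradient,
  and both mollified functions and mollified test fields.\<close>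

definition conv :: "('a::euclidean_space \<Rightarrow> real) \<Rightarrow> ('a \<Rightarrow> 'b::euclidean_space) \<Rightarrow> 'a \<Rightarrow> 'b" where
  "conv v k x = (LINT y|lborel. v y *\<^sub>R k (x - y))"

lemma norm_diff_gt:
  fixes x y :: "'a::real_normed_vector"
  assumes "norm x + R < norm y" shows "R < norm (x - y)"
  using assms norm_triangle_ineq2[of y x] by (simp add: norm_minus_commute)

lemma conv_facts:
  fixes v :: "'a::euclidean_space \<Rightarrow> real" and k :: "'a \<Rightarrow> 'b::euclidean_space"
  assumes v: "locally_integrable v" and c: "continuous_on UNIV k" and z: "\<And>x. R < norm x \<Longrightarrow> k x = 0"
    and b: "\<And>x. norm (k x) \<le> B"
  shows conv_integrable: "integrable lborel (\<lambda>y. v y *\<^sub>R k (x - y))"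
    and conv_norm_le: "norm (conv v k x) \<le> (LINT y|lborel. indicator (cball 0 (norm x + R)) y * \<bar>v y\<bar>) * B"
proof -
  have [measurable]: "k \<in> borel_measurable borel" using c by (rule borel_measurable_continuous_onI)
  have m: "(\<lambda>y. k (x - y)) \<in> borel_measurable borel" by measurable
  have z': "k (x - y) = 0" if "norm x + R < norm y" for y using z norm_diff_gt[OF that] by blast
  show "integrable lborel (\<lambda>y. v y *\<^sub>R k (x - y))"
    by (rule locally_integrable_mult(1)[OF v m z' b])
  show "norm (conv v k x) \<le> (LINT y|lborel. indicator (cball 0 (norm x + R)) y * \<bar>v y\<bar>) * B"
    unfolding conv_def by (rule locally_integrable_mult(2)[OF v m z' b])
qed

lemma locally_integrable_abs_ball_mono:
  fixes v :: "'a::euclidean_space \<Rightarrow> real"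
  assumes v: "locally_integrable v" and "R \<le> S"
  shows "(LINT x|lborel. indicator (cball 0 R) x * \<bar>v x\<bar>) \<le> (LINT x|lborel. indicator (cball 0 S) x * \<bar>v x\<bar>)"
proof (rule integral_mono)
  have "integrable lborel (\<lambda>x. norm (indicator (cball 0 R) x *\<^sub>R v x))" for R
    using v unfolding locally_integrable_def by (intro integrable_norm) auto
  then show "integrable lborel (\<lambda>x. indicator (cball 0 R) x * \<bar>v x\<bar>)" for R by (simp add: abs_mult)
  then show "integrable lborel (\<lambda>x. indicator (cball 0 S) x * \<bar>v x\<bar>)" .
qed (use \<open>R \<le> S\<close> in \<open>auto simp: indicator_def\<close>)

lemma conv_continuous:
  fixes v :: "'a::euclidean_space \<Rightarrow> real" and k :: "'a \<Rightarrow> 'b::euclidean_space"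
  assumes v: "locally_integrable v" and c: "continuous_on UNIV k" and z: "\<And>x. R < norm x \<Longrightarrow> k x = 0"
  shows "continuous_on UNIV (conv v k)"
  unfolding continuous_on_eq_continuous_at[OF open_UNIV] continuous_at_eps_delta
proof (intro ballI allI impI)
  fix x :: 'a and e :: real assume "e > 0"
  obtain B where B: "\<And>x. norm (k x) \<le> B" using continuous_compact_support_bounded[OF c z] by blast
  \<comment> \<open>This radius contains the supports of all \<open>k (x' - y)\<close> with
    \<open>x'\<close> within distance 1 of \<open>x\<close>. Dividing by \<open>I + 1\<close> avoids
    the case of zero mass.\<close>
  define I where "I = (LINT y|lborel. indicator (cball 0 (norm x + 1 + R)) y * \<bar>v y\<bar>)"
  have "I \<ge> 0" by (simp add: I_def)
  then have "e / (I + 1) > 0" using \<open>e > 0\<close> by simp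
  then obtain d where d: "d > 0" "\<And>x y. norm (x - y) < d \<Longrightarrow> norm (k x - k y) < e / (I + 1)"
    using continuous_compact_support_uniform[OF c z] by blast
  show "\<exists>d>0. \<forall>x'. dist x' x < d \<longrightarrow> dist (conv v k x') (conv v k x) < e"
  proof (intro exI[of _ "min d 1"] conjI allI impI)
    fix x' assume x': "dist x' x < min d 1"
    then have nx: "norm x' \<le> norm x + 1" using norm_triangle_ineq2[of x' x] by (simp add: dist_norm)
    have "conv v k x' - conv v k x = (LINT y|lborel. v y *\<^sub>R (k (x' - y) - k (x - y)))"
      unfolding conv_def scaleR_diff_right
      by (rule Bochner_Integration.integral_diff[symmetric]; rule conv_integrable[OF v c z B])
    also have "norm \<dots> \<le> I * (e / (I + 1))"
      unfolding I_def
    proof (rule locally_integrable_mult(2)[OF v])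
      have [measurable]: "k \<in> borel_measurable borel" using c by (rule borel_measurable_continuous_onI)
      show "(\<lambda>y. k (x' - y) - k (x - y)) \<in> borel_measurable borel" by measurable
      show "k (x' - y) - k (x - y) = 0" if "norm x + 1 + R < norm y" for y
      proof -
        have "norm x + R < norm y" "norm x' + R < norm y" using that nx by auto
        then show ?thesis using z norm_diff_gt by (metis diff_self)
      qed
      show "norm (k (x' - y) - k (x - y)) \<le> e / ((LINT y|lborel. indicator (cball 0 (norm x + 1 + R)) y * \<bar>v y\<bar>) + 1)" for y
        using d(2)[of "x' - y" "x - y"] x' by (simp add: I_def[symmetric] dist_norm less_imp_le)
    qed
    also have "\<dots> < e" using \<open>I \<ge> 0\<close> \<open>e > 0\<close> by (simp add: pos_divide_less_eq)
    finally show "dist (conv v k x') (conv v k x) < e" by (simp add: dist_norm)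
  qed (use d in auto)
qed

text \<open>The mean value inequality for \<open>\<phi>\<close> minus its linear part at
  \<open>x\<close>, whose gradient at \<open>y\<close> is \<open>D y - D x\<close>. The bound is
  uniform in \<open>x\<close>, as differentiation under an integral requires.\<close>

lemma GDERIV_taylor:
  fixes \<phi> :: "'a::euclidean_space \<Rightarrow> real"
  assumes g: "\<And>x. GDERIV \<phi> x :> D x" and d: "\<And>x y. norm (x - y) < d \<Longrightarrow> norm (D x - D y) \<le> e" and h: "norm h < d"
  shows "\<bar>\<phi> (x + h) - \<phi> x - h \<bullet> D x\<bar> \<le> e * norm h"
proof -
  define f where "f = (\<lambda>y. \<phi> y - y \<bullet> D x)"
  have fd: "(f has_derivative (\<lambda>h. h \<bullet> (D y - D x))) (at y within ball x d)" for y
  proof -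
    have "(\<phi> has_derivative (\<lambda>h. h \<bullet> D y)) (at y within ball x d)"
      using g[of y] unfolding gderiv_def by (rule has_derivative_at_withinI)
    then show ?thesis unfolding f_def
      by (auto intro!: derivative_eq_intros simp: inner_diff_right)
  qed
  have "norm (f (x + h) - f x) \<le> e * norm ((x + h) - x)"
  proof (rule differentiable_bound[OF convex_ball fd])
    fix y assume "y \<in> ball x d"
    then have "norm (D y - D x) \<le> e" by (intro d) (simp add: dist_norm norm_minus_commute)
    then have "norm (h \<bullet> (D y - D x)) \<le> norm h * e" for h
      using Cauchy_Schwarz_ineq2[of h "D y - D x"] mult_left_mono[OF _ norm_ge_zero[of h]]
      by (simp add: order_trans)
    then show "onorm (\<lambda>h. h \<bullet> (D y - D x)) \<le> e"
      by (intro onorm_bound) (auto simp: mult.commute intro: order_trans[OF norm_ge_zero \<open>norm (D y - D x) \<le> e\<close>])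
  next
    have "0 < d" using h norm_ge_zero le_less_trans by blast
    then show "x \<in> ball x d" by simp
  qed (use h in \<open>auto simp: dist_norm\<close>)
  then show ?thesis by (simp add: f_def inner_add_left algebra_simps)
qed

text \<open>\<open>D\<close> is uniformly continuous, so the Taylor remainder of
  \<open>\<phi>\<close> is uniformly small relative to \<open>norm h\<close>, and it is integrated
  against \<open>v\<close> over one fixed ball.\<close>

lemma conv_GDERIV:
  fixes v :: "'a::euclidean_space \<Rightarrow> real"
  assumes v: "locally_integrable v" and t: "test_function UNIV \<phi> D"
  shows "GDERIV (conv v \<phi>) x :> conv v D x"
proof -
  obtain R B where R: "R > 0" and B: "B > 0" and R': "\<And>x. R < norm x \<Longrightarrow> \<phi> x = 0" "\<And>x. R < norm x \<Longrightarrow> D x = 0"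
    and B': "\<And>x. norm (\<phi> x) \<le> B" "\<And>x. norm (D x) \<le> B" and c: "continuous_on UNIV \<phi>" "continuous_on UNIV D"
    and g: "\<And>x. GDERIV \<phi> x :> D x"
    by (rule test_functionE[OF t], rule that)
  define I where "I = (LINT y|lborel. indicator (cball 0 (norm x + 1 + R)) y * \<bar>v y\<bar>)"
  have I: "I \<ge> 0" by (simp add: I_def)
  have i1: "integrable lborel (\<lambda>y. v y *\<^sub>R \<phi> (x - y))" for x by (rule conv_integrable[OF v c(1) R'(1) B'(1)])
  have i2: "integrable lborel (\<lambda>y. v y *\<^sub>R D (x - y))" for x by (rule conv_integrable[OF v c(2) R'(2) B'(2)])
  have "(conv v \<phi> has_derivative (\<lambda>h. h \<bullet> conv v D x)) (at x)"
    unfolding has_derivative_at_alt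
  proof (intro conjI allI impI)
    show "bounded_linear (\<lambda>h. h \<bullet> conv v D x)" by (rule bounded_linear_inner_left)
    fix e :: real assume "e > 0"
    have "e / (I + 1) > 0" using \<open>e > 0\<close> I by simp
    then obtain d where d: "d > 0" "\<And>x y. norm (x - y) < d \<Longrightarrow> norm (D x - D y) < e / (I + 1)"
      using continuous_compact_support_uniform[OF c(2) R'(2)] by blast
    show "\<exists>d>0. \<forall>y. norm (y - x) < d \<longrightarrow> norm (conv v \<phi> y - conv v \<phi> x - (y - x) \<bullet> conv v D x) \<le> e * norm (y - x)"
    proof (intro exI[of _ "min d 1"] conjI allI impI)
      fix x' assume x': "norm (x' - x) < min d 1"
      define h where "h = x' - x"
      have x'eq: "x' = x + h" by (simp add: h_def)
      have nx: "norm x' \<le> norm x + 1" using x' norm_triangle_ineq2[of x' x] by simp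
      have ih: "h \<bullet> conv v D x = (LINT y|lborel. v y *\<^sub>R (h \<bullet> D (x - y)))"
      proof -
        have "h \<bullet> conv v D x = (LINT y|lborel. h \<bullet> (v y *\<^sub>R D (x - y)))"
          unfolding conv_def by (rule integral_inner_right[symmetric]) (rule i2)
        then show ?thesis by simp
      qed
      have i3: "integrable lborel (\<lambda>y. v y *\<^sub>R (h \<bullet> D (x - y)))"
        using integrable_inner_right[of h lborel "\<lambda>y. v y *\<^sub>R D (x - y)"] i2[of x] by simp
      have "conv v \<phi> x' - conv v \<phi> x - h \<bullet> conv v D x =
         (LINT y|lborel. v y *\<^sub>R (\<phi> (x' - y) - \<phi> (x - y) - h \<bullet> D (x - y)))"
        unfolding scaleR_diff_right conv_def
        by (simp only: ih[unfolded conv_def] Bochner_Integration.integral_diff[OF Bochner_Integration.integrable_diff[OF i1 i1] i3]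
              Bochner_Integration.integral_diff[OF i1 i1])
      also have "norm \<dots> \<le> I * (e / (I + 1) * norm h)"
        unfolding I_def
      proof (rule locally_integrable_mult(2)[OF v])
        have [measurable]: "\<phi> \<in> borel_measurable borel" "D \<in> borel_measurable borel"
          using c by (auto intro: borel_measurable_continuous_onI)
        show "(\<lambda>y. \<phi> (x' - y) - \<phi> (x - y) - h \<bullet> D (x - y)) \<in> borel_measurable borel" by measurable
        show "\<phi> (x' - y) - \<phi> (x - y) - h \<bullet> D (x - y) = 0" if "norm x + 1 + R < norm y" for y
        proof -
          have "norm x + R < norm y" "norm x' + R < norm y" using that nx by auto
          then have "R < norm (x - y)" "R < norm (x' - y)" using norm_diff_gt by blast+
          then show ?thesis using R' by simp
        qed
        show "norm (\<phi> (x' - y) - \<phi> (x - y) - h \<bullet> D (x - y)) \<le>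
          e / ((LINT y|lborel. indicator (cball 0 (norm x + 1 + R)) y * \<bar>v y\<bar>) + 1) * norm h" for y
        proof -
          have "\<bar>\<phi> (x - y + h) - \<phi> (x - y) - h \<bullet> D (x - y)\<bar> \<le> e / (I + 1) * norm h"
            using d(2) x' by (intro GDERIV_taylor[OF g]) (auto simp: h_def less_imp_le)
          moreover have "x - y + h = x' - y" by (simp add: h_def)
          ultimately show ?thesis by (simp add: I_def[symmetric])
        qed
      qed
      also have "\<dots> \<le> e * norm h"
      proof -
        have "I * (e / (I + 1)) \<le> e" using I \<open>e > 0\<close> by (simp add: pos_divide_le_eq)
        from mult_right_mono[OF this, of "norm h"] show ?thesis by (simp add: mult.assoc)
      qed
      finally show "norm (conv v \<phi> x' - conv v \<phi> x - (x' - x) \<bullet> conv v D x) \<le> e * norm (x' - x)"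
        by (simp add: h_def)
    qed (use d in auto)
  qed
  then show ?thesis by (simp add: gderiv_def)
qed

text \<open>Later \<open>v\<close> is a mollifier and \<open>\<phi>\<close> a test function: when
  the mollification is moved from the solution to the test function, the result must still be
  admissible in the equation.\<close>

lemma conv_test_function:
  fixes v :: "'a::euclidean_space \<Rightarrow> real"
  assumes v: "locally_integrable v" and t: "test_function UNIV \<phi> D" and s: "\<And>x. S < norm x \<Longrightarrow> v x = 0"
  shows "test_function UNIV (conv v \<phi>) (conv v D)"
proof -
  obtain R where R: "\<And>x. R < norm x \<Longrightarrow> \<phi> x = 0" "\<And>x. R < norm x \<Longrightarrow> D x = 0" and c: "continuous_on UNIV D"
    by (rule test_functionE[OF t], rule that)
  have "conv v \<phi> x = 0" if x: "S + R < norm x" for x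
  proof -
    have "v y *\<^sub>R \<phi> (x - y) = 0" for y
    proof (cases "S < norm y")
      case False
      then have "R < norm (x - y)" using x norm_triangle_ineq2[of x y] by simp
      then show ?thesis using R by simp
    qed (use s in simp)
    then have "(\<lambda>y. v y *\<^sub>R \<phi> (x - y)) = (\<lambda>y. 0)" by (rule ext)
    then show ?thesis by (simp only: conv_def) simp
  qed
  then show ?thesis
    using conv_GDERIV[OF v t] conv_continuous[OF v c R(2)] by (auto simp: test_function_UNIV_iff)
qed

section \<open>Cutoffs and the logarithmic entropy\<close>

text \<open>The outer square makes the profile C^1 across the sphere of radius \<open>R\<close>. The
  function serves both as cutoff and, after normalisation, as mollification kernel; in the second
  role its evenness matters.\<close>

definition bump :: "real \<Rightarrow> 'a::euclidean_space \<Rightarrow> real" where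
  "bump R x = (max 0 (1 - (norm x / R)\<^sup>2))\<^sup>2"

definition bump_grad :: "real \<Rightarrow> 'a::euclidean_space \<Rightarrow> 'a" where
  "bump_grad R x = (- (4 / R\<^sup>2 * max 0 (1 - (norm x / R)\<^sup>2))) *\<^sub>R x"

lemma DERIV_pos_part_square: "((\<lambda>s::real. (max 0 s)\<^sup>2) has_real_derivative 2 * max 0 s) (at s)"
proof (cases s "0::real" rule: linorder_cases)
  case less
  have "((\<lambda>s. 0) has_real_derivative 0) (at s)" by simp
  then have "((\<lambda>s::real. (max 0 s)\<^sup>2) has_real_derivative 0) (at s)"
    by (rule has_field_derivative_transform_within_open[of _ _ _ "{..<0}"]) (use less in auto)
  then show ?thesis using less by simp
next
  case equal
  have "\<bar>(max 0 h)\<^sup>2 / h\<bar> \<le> \<bar>h\<bar>" for h :: real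
    by (cases "h > 0") (auto simp: power2_eq_square max_def)
  then have "((\<lambda>h::real. (max 0 h)\<^sup>2 / h) \<longlongrightarrow> 0) (at 0)"
    by (intro Lim_null_comparison[OF _ tendsto_rabs_zero[OF tendsto_ident_at]]) (auto intro: always_eventually)
  then show ?thesis using equal by (simp add: DERIV_def)
next
  case greater
  have "((\<lambda>s. s\<^sup>2) has_real_derivative 2 * s) (at s)" by (auto intro!: derivative_eq_intros)
  then have "((\<lambda>s::real. (max 0 s)\<^sup>2) has_real_derivative 2 * s) (at s)"
    by (rule has_field_derivative_transform_within_open[of _ _ _ "{0<..}"]) (use greater in auto)
  then show ?thesis using greater by simp
qed

lemma
  assumes "R > 0" "R \<le> norm x"
  shows bump_zero: "bump R x = 0" and bump_grad_zero: "bump_grad R x = 0"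
proof -
  have "1 \<le> (norm x / R)\<^sup>2" using assms by (intro one_le_power) simp
  then have "max 0 (1 - (norm x / R)\<^sup>2) = 0" by simp
  then show "bump R x = 0" "bump_grad R x = 0" by (simp_all add: bump_def bump_grad_def)
qed

lemma bump_nonneg: "0 \<le> bump R x"
  by (simp add: bump_def)

lemma bump_le_1: "bump R x \<le> 1"
  by (simp add: bump_def power_le_one)

lemma bump_even: "bump R (- x) = bump R x"
  by (simp add: bump_def)

text \<open>9/16 is (1 - (1/2)^2)^2. This is the origin of every factor 16/9 below.\<close>

lemma bump_ge:
  assumes "R > 0" "norm x \<le> R / 2"
  shows "bump R x \<ge> 9 / 16"
proof -
  have "(norm x / R)\<^sup>2 \<le> (1/2)\<^sup>2" using assms by (intro power_mono) (auto simp: divide_simps)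
  also have "(1/2)\<^sup>2 = (1/4::real)" by (simp add: power2_eq_square)
  finally have "3/4 \<le> 1 - (norm x / R)\<^sup>2" by simp
  then have "3/4 \<le> max 0 (1 - (norm x / R)\<^sup>2)" by (rule max.coboundedI2)
  then have "(3/4)\<^sup>2 \<le> bump R x" unfolding bump_def by (rule power_mono) simp
  then show ?thesis by (simp add: power2_eq_square)
qed

lemma bump_GDERIV:
  assumes "R > 0"
  shows "GDERIV (bump R) x :> bump_grad R x"
proof -
  have "GDERIV (\<lambda>x. 1 - (norm x / R)\<^sup>2) x :> - (2 / R\<^sup>2) *\<^sub>R x"
  proof -
    have eq: "(\<lambda>x::'a. 1 - (norm x / R)\<^sup>2) = (\<lambda>x. 1 - inverse (R\<^sup>2) * (x \<bullet> x))"
      by (auto simp: power_mult_distrib power_inverse dot_square_norm divide_inverse)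
    show ?thesis unfolding eq gderiv_def
      by (auto intro!: derivative_eq_intros simp: inner_commute divide_inverse)
  qed
  from GDERIV_DERIV_compose[OF this DERIV_pos_part_square]
  have "GDERIV (\<lambda>x. (max 0 (1 - (norm x / R)\<^sup>2))\<^sup>2) x :> (2 * max 0 (1 - (norm x / R)\<^sup>2)) *\<^sub>R (- (2 / R\<^sup>2) *\<^sub>R x)" .
  moreover have "(\<lambda>x::'a. (max 0 (1 - (norm x / R)\<^sup>2))\<^sup>2) = bump R" by (auto simp: bump_def)
  moreover have "(2 * max 0 (1 - (norm x / R)\<^sup>2)) *\<^sub>R (- (2 / R\<^sup>2) *\<^sub>R x) = bump_grad R x"
    by (simp add: bump_grad_def)
  ultimately show ?thesis by simp
qed

lemma bump_test_function:
  assumes "R > 0"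
  shows "test_function UNIV (bump R) (bump_grad R :: 'a::euclidean_space \<Rightarrow> 'a)"
  unfolding test_function_UNIV_iff
proof (intro conjI allI)
  show "continuous_on UNIV (bump_grad R :: 'a \<Rightarrow> 'a)"
    unfolding bump_grad_def by (intro continuous_intros) (use assms in auto)
  show "\<exists>S. \<forall>x::'a. S < norm x \<longrightarrow> bump R x = 0"
    using assms by (intro exI[of _ R]) (auto intro: bump_zero)
qed (rule bump_GDERIV[OF assms])

lemma bump_grad_le:
  assumes "R > 0"
  shows "norm (bump_grad R x) \<le> 4 / R"
proof (cases "norm x \<le> R")
  case True
  have "max 0 (1 - (norm x / R)\<^sup>2) \<le> 1" by simp
  then have "4 / R\<^sup>2 * max 0 (1 - (norm x / R)\<^sup>2) * norm x \<le> 4 / R\<^sup>2 * 1 * R"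
    using True assms by (intro mult_mono) auto
  also have "\<dots> = 4 / R" using assms by (simp add: power2_eq_square)
  finally show ?thesis by (simp add: bump_grad_def abs_mult)
next
  case False
  then show ?thesis using assms by (simp add: bump_grad_zero)
qed

lemma continuous_locally_integrable:
  fixes k :: "'a::euclidean_space \<Rightarrow> 'b::euclidean_space"
  assumes c: "continuous_on UNIV k"
  shows "locally_integrable k"
proof -
  have "set_integrable lborel (cball 0 R) k" for R
    unfolding set_integrable_def
    by (intro borel_integrable_compact continuous_on_subset[OF c]) auto
  then show ?thesis by (auto simp: locally_integrable_def set_integrable_def)
qed

lemma continuous_compact_support_integrable:
  fixes k :: "'a::euclidean_space \<Rightarrow> 'b::euclidean_space"
  assumes c: "continuous_on UNIV k" and z: "\<And>x. R < norm x \<Longrightarrow> k x = 0"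
  shows "integrable lborel k"
proof -
  have "integrable lborel (\<lambda>x. indicator (cball 0 R) x *\<^sub>R k x)"
    using continuous_locally_integrable[OF c] by (simp add: locally_integrable_def)
  moreover have "(\<lambda>x. indicator (cball 0 R) x *\<^sub>R k x) = k"
    using z by (auto simp: indicator_def not_le)
  ultimately show ?thesis by simp
qed

lemma bump_continuous: "R > 0 \<Longrightarrow> continuous_on UNIV (bump R)"
  unfolding bump_def by (intro continuous_intros) auto

lemma bump_integrable: "R > 0 \<Longrightarrow> integrable lborel (bump R)"
  by (rule continuous_compact_support_integrable[OF bump_continuous, of _ R]) (auto intro: bump_zero)

lemma bump_integral_pos:
  assumes "R > 0"
  shows "0 < integral\<^sup>L lborel (bump R :: 'a::euclidean_space \<Rightarrow> real)"
proof -
  let ?B = "ball (0::'a) (R/2)"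
  have "0 < measure lborel ?B * (9/16)"
    using content_ball_pos[of "R/2" "0::'a"] assms by simp
  also have "\<dots> = (LINT x|lborel. indicator ?B x * (9/16))"
    using emeasure_lborel_ball_finite[of "0::'a" "R/2"] by simp
  also have "\<dots> \<le> (LINT x|lborel. bump R (x::'a))"
  proof (rule integral_mono)
    show "integrable lborel (\<lambda>x. indicator ?B x * (9/16) :: real)"
      using emeasure_lborel_ball_finite[of "0::'a" "R/2"] by simp
    show "indicator ?B x * (9/16) \<le> bump R x" for x
      using bump_ge[OF assms, of x] bump_nonneg[of R x] by (auto simp: indicator_def)
  qed (rule bump_integrable[OF assms])
  finally show ?thesis .
qed

definition mollifier :: "real \<Rightarrow> 'a::euclidean_space \<Rightarrow> real" where
  "mollifier R x = bump R x / integral\<^sup>L lborel (bump R :: 'a \<Rightarrow> real)"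

lemma mollifier_facts:
  assumes R: "R > 0"
  shows mollifier_nonneg: "0 \<le> mollifier R (x::'a::euclidean_space)"
    and mollifier_zero: "R \<le> norm x \<Longrightarrow> mollifier R x = 0"
    and mollifier_even: "mollifier R (- x) = mollifier R x"
    and mollifier_integrable: "integrable lborel (mollifier R :: 'a \<Rightarrow> real)"
    and mollifier_integral: "integral\<^sup>L lborel (mollifier R :: 'a \<Rightarrow> real) = 1"
    and mollifier_test_function: "\<exists>D. test_function UNIV (mollifier R :: 'a \<Rightarrow> real) D"
proof -
  let ?I = "integral\<^sup>L lborel (bump R :: 'a \<Rightarrow> real)"
  have I: "?I > 0" by (rule bump_integral_pos[OF R])
  show "0 \<le> mollifier R x" using I bump_nonneg[of R x] by (simp add: mollifier_def)
  show "mollifier R x = 0" if "R \<le> norm x" using bump_zero[OF R that] by (simp add: mollifier_def)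
  show "mollifier R (- x) = mollifier R x" by (simp add: mollifier_def bump_even)
  show "integrable lborel (mollifier R :: 'a \<Rightarrow> real)" unfolding mollifier_def
    using bump_integrable[OF R] by (intro integrable_divide) 
  show "integral\<^sup>L lborel (mollifier R :: 'a \<Rightarrow> real) = 1" unfolding mollifier_def using I by simp
  have "test_function UNIV (mollifier R :: 'a \<Rightarrow> real) (\<lambda>x. inverse ?I *\<^sub>R bump_grad R x)"
    unfolding test_function_UNIV_iff
  proof (intro conjI allI)
    fix x :: 'a
    have "GDERIV (\<lambda>x. inverse ?I * bump R x) x :> inverse ?I *\<^sub>R bump_grad R x + bump R x *\<^sub>R 0"
      by (rule GDERIV_mult[OF GDERIV_const bump_GDERIV[OF R]])
    then show "GDERIV (mollifier R) x :> inverse ?I *\<^sub>R bump_grad R x"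
      by (simp add: mollifier_def[abs_def] divide_inverse mult.commute)
    show "continuous_on UNIV (\<lambda>x::'a. inverse ?I *\<^sub>R bump_grad R x)"
      using bump_test_function[OF R, where 'a='a] unfolding test_function_UNIV_iff by (intro continuous_intros) blast
    show "\<exists>S. \<forall>x::'a. S < norm x \<longrightarrow> mollifier R x = 0"
      by (intro exI[of _ R] allI impI) (simp add: mollifier_def bump_zero[OF R] less_imp_le)
  qed
  then show "\<exists>D. test_function UNIV (mollifier R :: 'a \<Rightarrow> real) D" by blast
qed

text \<open>\<open>M\<close> bounds the slope and so compares the entropy with the mass. The two
  bounds on \<open>g'\<close> are the ones that dominate the mollified energy: the mollified
  gradient is estimated by an average of the flux, which meets \<open>g' s \<le> L\<close>, plus a
  multiple of the mollified solution itself, which meets \<open>s * g' s \<le> 1\<close>.\<close>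

locale entropy =
  fixes G g g' :: "real \<Rightarrow> real" and L M :: real
  assumes G_deriv: "0 \<le> s \<Longrightarrow> (G has_real_derivative g s) (at s)"
    and g_deriv: "0 \<le> s \<Longrightarrow> (g has_real_derivative g' s) (at s)"
    and g'_cont: "continuous_on {0..} g'"
    and g'_nonneg: "0 \<le> s \<Longrightarrow> 0 \<le> g' s"
    and g'_le: "0 \<le> s \<Longrightarrow> g' s \<le> L"
    and g'_decay: "0 \<le> s \<Longrightarrow> s * g' s \<le> 1"
    and g_nonneg: "0 \<le> s \<Longrightarrow> 0 \<le> g s"
    and g_le: "0 \<le> s \<Longrightarrow> g s \<le> M"
    and G_zero: "G 0 = 0"
begin

lemma g_mono:
  assumes "0 \<le> a" "a \<le> b" shows "g a \<le> g b"
  using assms g_deriv g'_nonneg by (intro DERIV_nonneg_imp_nondecreasing[OF assms(2)]) (meson order_trans)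

text \<open>Mean value theorem and monotonicity of \<open>g\<close>. The slope is taken at
  \<open>a\<close>, which will be the value at the later time, so that the test function can be
  frozen there.\<close>

lemma G_tangent:
  assumes "0 \<le> a" "0 \<le> b" shows "G a - G b \<le> g a * (a - b)"
proof (cases a b rule: linorder_cases)
  case less
  then obtain z where z: "a < z" "z < b" "G b - G a = (b - a) * g z"
    using MVT2[OF less, of G g] G_deriv assms by (meson order_trans)
  have "(b - a) * g a \<le> (b - a) * g z" using less z assms by (intro mult_left_mono g_mono) auto
  then show ?thesis using z by (simp add: algebra_simps)
next
  case greater
  then obtain z where z: "b < z" "z < a" "G a - G b = (a - b) * g z"
    using MVT2[OF greater, of G g] G_deriv assms by (meson order_trans)
  have "(a - b) * g z \<le> (a - b) * g a" using greater z assms by (intro mult_left_mono g_mono) auto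
  then show ?thesis using z by (simp add: algebra_simps)
qed simp

lemma M_nonneg: "0 \<le> M"
  using g_nonneg[of 0] g_le[of 0] by simp

lemma G_le: "0 \<le> s \<Longrightarrow> G s \<le> M * s"
  using G_tangent[of s 0] G_zero mult_right_mono[OF g_le[of s], of s] by simp

lemma G_nonneg: "0 \<le> s \<Longrightarrow> 0 \<le> G s"
  using G_tangent[of 0 s] G_zero mult_nonneg_nonneg[OF g_nonneg[of 0], of s] by simp

lemma cont_G: "continuous_on {0..} G"
  using G_deriv by (intro continuous_at_imp_continuous_on ballI) (auto intro: DERIV_isCont)

lemma cont_g: "continuous_on {0..} g"
  using g_deriv by (intro continuous_at_imp_continuous_on ballI) (auto intro: DERIV_isCont)

end

text \<open>The derivative of (1 + k s) ln(1 + k s) / k is ln(1 + k s) + 1; in the difference for k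
  = L and k = 1 the constants cancel. For s <= 1 the second derivative is comparable to L / (1 + L
  s) = 1 / (s + 1/L), and the factor 1 / (1 + s) makes it integrable at infinity, so that the slope
  increases to the finite limit ln L.\<close>

lemma log_entropy:
  assumes L: "2 \<le> L"
  shows "entropy (\<lambda>s. (1 + L * s) * ln (1 + L * s) / L - (1 + s) * ln (1 + s))
    (\<lambda>s. ln (1 + L * s) - ln (1 + s)) (\<lambda>s. (L - 1) / ((1 + L * s) * (1 + s))) L (ln L)"
proof
  fix s :: real assume s: "0 \<le> s"
  have p: "1 + s > 0" "1 + L * s > 0" using s L by (auto intro: add_pos_nonneg)
  show "((\<lambda>s. (1 + L * s) * ln (1 + L * s) / L - (1 + s) * ln (1 + s)) has_real_derivative
     ln (1 + L * s) - ln (1 + s)) (at s)"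
  proof -
    have "((\<lambda>s. (1 + k * s) * ln (1 + k * s)) has_real_derivative k * ln (1 + k * s) + k) (at s)"
      if "1 + k * s > 0" for k
      using that by (auto intro!: derivative_eq_intros)
    from DERIV_diff[OF DERIV_cdivide[OF this[OF p(2)], of L] this[of 1]] show ?thesis
      using p L by (simp add: add_divide_distrib)
  qed
  show "((\<lambda>s. ln (1 + L * s) - ln (1 + s)) has_real_derivative (L - 1) / ((1 + L * s) * (1 + s))) (at s)"
    using p L by (auto intro!: derivative_eq_intros simp: field_simps)
  show "0 \<le> (L - 1) / ((1 + L * s) * (1 + s))" using p L by simp
  have ge1: "1 \<le> (1 + L * s) * (1 + s)"
    using mult_mono[of 1 "1 + L * s" 1 "1 + s"] s L by simp
  show "(L - 1) / ((1 + L * s) * (1 + s)) \<le> L"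
  proof -
    have "L - 1 \<le> L * ((1 + L * s) * (1 + s))"
      using mult_left_mono[OF ge1, of L] L by linarith
    then show ?thesis using p by (simp add: pos_divide_le_eq)
  qed
  show "s * ((L - 1) / ((1 + L * s) * (1 + s))) \<le> 1"
  proof -
    have "s * (L - 1) \<le> (1 + L * s) * 1" using s by (simp add: algebra_simps)
    also have "\<dots> \<le> (1 + L * s) * (1 + s)" using s p by (intro mult_left_mono) auto
    finally show ?thesis using p by (simp add: pos_divide_le_eq)
  qed
  have "1 + s \<le> 1 + L * s" using mult_right_mono[of 1 L s] s L by simp
  then have "ln (1 + s) \<le> ln (1 + L * s)" using p by simp
  then show "0 \<le> ln (1 + L * s) - ln (1 + s)" by simp
  have "1 + L * s \<le> L * (1 + s)" using L by (simp add: algebra_simps)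
  then have "ln (1 + L * s) \<le> ln (L * (1 + s))" using p by simp
  also have "\<dots> = ln L + ln (1 + s)" using p L by (intro ln_mult_pos) auto
  finally show "ln (1 + L * s) - ln (1 + s) \<le> ln L" by simp
next
  show "continuous_on {0..} (\<lambda>s. (L - 1) / ((1 + L * s) * (1 + s)))"
  proof (intro continuous_intros ballI)
    fix s :: real assume "s \<in> {0..}"
    then have "1 + s > 0" "1 + L * s > 0" using L by (auto intro: add_pos_nonneg)
    then show "(1 + L * s) * (1 + s) \<noteq> 0" by simp
  qed
qed simp

section \<open>The energy inequality for a mollified solution\<close>

text \<open>On a fine subdivision the errors telescope to \<open>e * (\<mu> T - \<mu> 0)\<close>,
  and \<open>e\<close> is arbitrary. This yields an integrated inequality from estimates on short
  time steps, with no differentiability in time.\<close>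

lemma increments_nonpos:
  fixes H \<mu> :: "real \<Rightarrow> real"
  assumes "0 < T"
    and small: "\<And>e. 0 < e \<Longrightarrow> \<exists>d>0. \<forall>s t. 0 \<le> s \<and> s \<le> t \<and> t \<le> T \<and> t - s < d \<longrightarrow> H t - H s \<le> e * (\<mu> t - \<mu> s)"
  shows "H T \<le> H 0"
proof -
  have *: "H T - H 0 \<le> e * (\<mu> T - \<mu> 0)" if e: "e > 0" for e
  proof -
    obtain d where d: "d > 0" "\<And>s t. 0 \<le> s \<Longrightarrow> s \<le> t \<Longrightarrow> t \<le> T \<Longrightarrow> t - s < d \<Longrightarrow> H t - H s \<le> e * (\<mu> t - \<mu> s)"
      using small[OF e] by blast
    obtain N :: nat where N: "T / d < real N" using reals_Archimedean2 by blast
    then have N0: "0 < real N" using \<open>0 < T\<close> d(1) by (meson divide_pos_pos less_trans)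
    define h where "h = T / real N"
    have h: "0 < h" "h < d" using N N0 d(1) \<open>0 < T\<close> by (auto simp: h_def field_simps)
    have hN: "real N * h = T" using N0 by (simp add: h_def)
    have "H (real k * h) - H 0 \<le> e * (\<mu> (real k * h) - \<mu> 0)" if "k \<le> N" for k
      using that
    proof (induction k)
      case (Suc k)
      have "real (Suc k) * h \<le> real N * h" using Suc.prems h by (intro mult_right_mono) auto
      then have "H (real (Suc k) * h) - H (real k * h) \<le> e * (\<mu> (real (Suc k) * h) - \<mu> (real k * h))"
        using h hN by (intro d(2)) (auto simp: algebra_simps)
      with Suc show ?case by (simp add: algebra_simps)
    qed simp
    from this[of N] show ?thesis using N0 by (simp add: h_def)
  qed
  show ?thesis
  proof (rule ccontr)
    assume "\<not> H T \<le> H 0"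
    then have p: "0 < H T - H 0" by simp
    \<comment> \<open>With this \<open>a\<close> the choice e = (H T - H 0) / (2 a) makes the error
      at most half of the supposed gap.\<close>
    define a where "a = \<bar>\<mu> T - \<mu> 0\<bar> + 1"
    have a: "a > 0" by (simp add: a_def)
    have "H T - H 0 \<le> (H T - H 0) / (2 * a) * (\<mu> T - \<mu> 0)" using p a by (intro *) auto
    also have "\<dots> \<le> (H T - H 0) / (2 * a) * a"
      using p a by (intro mult_left_mono) (auto simp: a_def)
    also have "\<dots> = (H T - H 0) / 2" using a by simp
    finally show False using p by simp
  qed
qed

lemma integrable_tensor:
  fixes f :: "'a::euclidean_space \<Rightarrow> real" and g :: "'b::euclidean_space \<Rightarrow> real"
  assumes f: "integrable lborel f" and g: "integrable lborel g"
  shows "integrable (lborel \<Otimes>\<^sub>M lborel) (\<lambda>(x, y). f x * g y)"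
proof (rule lborel_pair.Fubini_integrable)
  show "integrable lborel (\<lambda>x. LINT y|lborel. norm (case (x, y) of (x, y) \<Rightarrow> f x * g y))"
    using f g by (simp add: abs_mult)
qed (use f g in auto)

lemma conv_swap:
  fixes v :: "'a::euclidean_space \<Rightarrow> real"
  assumes v: "locally_integrable v"
    and r: "continuous_on UNIV r" "\<And>x. R < norm x \<Longrightarrow> r x = 0" "\<And>x. r (- x) = r x"
    and p: "continuous_on UNIV p" "\<And>x. S < norm x \<Longrightarrow> p x = 0"
  shows "(LINT x|lborel. conv v r x * p x) = (LINT y|lborel. v y * conv r p y)"
proof -
  note [measurable] = locally_integrable_borel[OF v] borel_measurable_continuous_onI[OF r(1)]
    borel_measurable_continuous_onI[OF p(1)]
  obtain A where A: "A > 0" "\<And>x. norm (r x) \<le> A" using continuous_compact_support_bounded[OF r(1,2)] by blast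
  obtain B where B: "B > 0" "\<And>x. norm (p x) \<le> B" using continuous_compact_support_bounded[OF p] by blast
  have "integrable lborel (\<lambda>y. norm (indicator (cball 0 (S + R)) y *\<^sub>R v y))"
    using v unfolding locally_integrable_def by (intro integrable_norm) auto
  then have vi: "integrable lborel (\<lambda>y. indicator (cball 0 (S + R)) y * \<bar>v y\<bar>)" by (simp add: abs_mult)
  have ci: "integrable lborel (\<lambda>x::'a. indicator (cball 0 S) x * (A * B) :: real)"
    using emeasure_lborel_cball_finite[of "0::'a" S] by simp
  have int: "integrable (lborel \<Otimes>\<^sub>M lborel) (\<lambda>(x, y). v y * r (x - y) * p x)"
  proof (rule Bochner_Integration.integrable_bound[OF integrable_tensor[OF ci vi]])
    show "AE z in lborel \<Otimes>\<^sub>M lborel. norm (case z of (x, y) \<Rightarrow> v y * r (x - y) * p x)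
       \<le> norm (case z of (x, y) \<Rightarrow> indicator (cball 0 S) x * (A * B) * (indicator (cball 0 (S + R)) y * \<bar>v y\<bar>))"
    proof (rule AE_I2, clarify)
      fix x y :: 'a
      show "norm (v y * r (x - y) * p x)
       \<le> norm (indicator (cball 0 S) x * (A * B) * (indicator (cball 0 (S + R)) y * \<bar>v y\<bar>))"
      proof (cases "S < norm x \<or> R < norm (x - y)")
        case True
        then have "v y * r (x - y) * p x = 0" using r p by auto
        then show ?thesis by (simp only: norm_zero norm_ge_zero)
      next
        case False
        then have "norm x \<le> S" "norm y \<le> S + R" using norm_triangle_ineq2[of y x] by (auto simp: norm_minus_commute)
        moreover have "\<bar>r (x - y)\<bar> * \<bar>p x\<bar> \<le> A * B" using A(2)[of "x - y"] B(2)[of x] A(1) by (intro mult_mono) auto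
        then have "\<bar>v y\<bar> * (\<bar>r (x - y)\<bar> * \<bar>p x\<bar>) \<le> \<bar>v y\<bar> * (A * B)" by (intro mult_left_mono) auto
        ultimately show ?thesis using A(1) B(1) by (simp add: abs_mult mult_ac)
      qed
    qed
  qed measurable
  have "(LINT x|lborel. conv v r x * p x) = (LINT x|lborel. (LINT y|lborel. v y * r (x - y) * p x))"
    by (simp add: conv_def)
  also have "\<dots> = (LINT y|lborel. (LINT x|lborel. v y * r (x - y) * p x))"
    using lborel_pair.Fubini_integral[OF int] by simp
  also have "\<dots> = (LINT y|lborel. v y * conv r p y)"
  proof (rule Bochner_Integration.integral_cong[OF refl])
    fix y :: 'a
    have "(LINT x|lborel. v y * r (x - y) * p x) = v y * (LINT x|lborel. r (x - y) * p x)"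
      by (simp add: mult.assoc)
    also have "(LINT x|lborel. r (x - y) * p x) = (LINT x|lborel. (\<lambda>z. r z * p (y - z)) (y - x))"
    proof (rule Bochner_Integration.integral_cong[OF refl])
      fix x show "r (x - y) * p x = (\<lambda>z. r z * p (y - z)) (y - x)"
        using r(3)[of "x - y"] by simp
    qed
    also have "\<dots> = (LINT z|lborel. r z * p (y - z))"
      by (rule lborel_integral_reflect) measurable
    finally show "(LINT x|lborel. v y * r (x - y) * p x) = v y * conv r p y" by (simp add: conv_def)
  qed
  finally show ?thesis .
qed

lemma locally_integrable_diff:
  "locally_integrable u \<Longrightarrow> locally_integrable v \<Longrightarrow> locally_integrable (\<lambda>x. u x - v x)"
  unfolding locally_integrable_def scaleR_diff_right by auto

text \<open>
  \<open>v t\<close> is the time slice of the solution, and \<open>w\<close>, \<open>D\<close>, \<open>F\<close> are Borel versions of the solution, its spatial gradient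
  and its flux on space-time, set to \<open>0\<close> outside the time interval \<open>(0,T)\<close>.
\<close>

locale parabolic_flow =
  fixes v :: "real \<Rightarrow> 'a::euclidean_space \<Rightarrow> real" and w :: "'a \<times> real \<Rightarrow> real"
    and D F :: "'a \<times> real \<Rightarrow> 'a" and T c C2 C3 C4 :: real
  assumes T_pos: "0 < T" and c_pos: "0 < c" and c_le: "c \<le> 1" and C2_ge: "1 \<le> C2" and C3_ge: "1 \<le> C3" and C4_ge: "1 \<le> C4"
    and v_loc: "\<And>t. t \<in> {0..T} \<Longrightarrow> locally_integrable (v t)"
    and v_nonneg: "\<And>t x. t \<in> {0..T} \<Longrightarrow> 0 \<le> v t x"
    and v_cont: "\<And>t R. t \<in> {0..T} \<Longrightarrow>
      ((\<lambda>s. LINT x|lborel. indicator (cball 0 R) x * \<bar>v s x - v t x\<bar>) \<longlongrightarrow> 0) (at t within {0..T})"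
    and w_borel[measurable]: "w \<in> borel_measurable borel"
    and D_borel[measurable]: "D \<in> borel_measurable borel"
    and F_borel[measurable]: "F \<in> borel_measurable borel"
    and w_nonneg: "\<And>z. 0 \<le> w z"
    and outside: "\<And>z. snd z \<notin> {0<..<T} \<Longrightarrow> w z = 0 \<and> D z = 0 \<and> F z = 0"
    and w_slice: "AE t in lborel. t \<in> {0<..<T} \<longrightarrow> (AE x in lborel. w (x, t) = v t x)"
    and F_L2: "integrable lborel (\<lambda>z. (norm (F z))\<^sup>2)"
    and flux: "\<And>\<phi> D\<phi> s t. test_function UNIV \<phi> D\<phi> \<Longrightarrow> 0 \<le> s \<Longrightarrow> s \<le> t \<Longrightarrow> t \<le> T \<Longrightarrow>
      (LINT x|lborel. v t x * \<phi> x) - (LINT x|lborel. v s x * \<phi> x) =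
        - (LINT z|lborel. indicator {s<..t} (snd z) * (F z \<bullet> D\<phi> (fst z)))"
    and sgrad: "\<And>\<phi> D\<phi> \<theta> D\<theta>. test_function UNIV \<phi> D\<phi> \<Longrightarrow> test_function {0<..<T} \<theta> D\<theta> \<Longrightarrow>
      (LINT z|lborel. w z *\<^sub>R (\<theta> (snd z) *\<^sub>R D\<phi> (fst z))) = - (LINT z|lborel. (\<theta> (snd z) * \<phi> (fst z)) *\<^sub>R D z)"
    and coercive: "AE z in lborel. c * (norm (D z))\<^sup>2 - C2 * (w z)\<^sup>2 \<le> F z \<bullet> D z \<and>
      norm (F z) \<le> C3 * norm (D z) + C4 * w z"
begin

text \<open>Coercivity is a quadratic inequality for p = |D|: c p^2 <= |F| p + C2 w^2. If p exceeded
  the bound, then c <= 1 <= C2 would give w <= p, so w^2 <= w p, and division by p contradicts the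
  assumption.\<close>

lemma D_bound: "AE z in lborel. norm (D z) \<le> (norm (F z) + C2 * w z) / c"
  using coercive
proof eventually_elim
  case (elim z)
  show ?case
  proof (rule ccontr)
    assume "\<not> norm (D z) \<le> (norm (F z) + C2 * w z) / c"
    then have a: "norm (F z) + C2 * w z < c * norm (D z)" using c_pos by (simp add: not_le pos_divide_less_eq mult.commute)
    have Dp: "w z \<le> norm (D z)"
    proof -
      have "1 * w z \<le> C2 * w z" using C2_ge w_nonneg[of z] by (intro mult_right_mono) auto
      moreover have "c * norm (D z) \<le> 1 * norm (D z)" using c_le by (intro mult_right_mono) auto
      ultimately show ?thesis using a norm_ge_zero[of "F z"] by linarith
    qed
    have Dpos: "0 < norm (D z)"
    proof (rule ccontr)
      assume "\<not> 0 < norm (D z)"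
      then have "c * norm (D z) = 0" by simp
      moreover have "0 \<le> norm (F z) + C2 * w z" using C2_ge w_nonneg[of z] by simp
      ultimately show False using a by linarith
    qed
    have "F z \<bullet> D z \<le> norm (F z) * norm (D z)" by (rule norm_cauchy_schwarz)
    then have "c * (norm (D z))\<^sup>2 \<le> norm (F z) * norm (D z) + C2 * (w z)\<^sup>2" using elim by linarith
    also have "C2 * (w z)\<^sup>2 \<le> C2 * w z * norm (D z)"
      using Dp w_nonneg[of z] C2_ge by (simp add: power2_eq_square mult_left_mono mult.assoc)
    finally have "c * norm (D z) * norm (D z) \<le> (norm (F z) + C2 * w z) * norm (D z)"
      by (simp add: power2_eq_square algebra_simps)
    then have "c * norm (D z) \<le> norm (F z) + C2 * w z" using Dpos by simp
    then show False using a by simp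
  qed
qed

text \<open>Continuity in x at the fixed time t0 is that of a convolution. The change in time is at
  most the sup of the kernel times the local L1 distance of the time slices, uniformly for x within
  distance 1 of x0.\<close>

lemma conv_jointly_continuous:
  fixes k :: "'a \<Rightarrow> 'b::euclidean_space"
  assumes c: "continuous_on UNIV k" and z: "\<And>x. R < norm x \<Longrightarrow> k x = 0"
  shows "continuous_on (UNIV \<times> {0..T}) (\<lambda>z. conv (v (snd z)) k (fst z))"
  unfolding continuous_on_iff
proof (intro ballI allI impI)
  fix z0 :: "'a \<times> real" and e :: real
  assume z0: "z0 \<in> UNIV \<times> {0..T}" and "e > 0"
  define x0 t0 where "x0 = fst z0" and "t0 = snd z0"
  have t0: "t0 \<in> {0..T}" using z0 by (auto simp: t0_def)
  obtain B where B: "B > 0" "\<And>x. norm (k x) \<le> B" using continuous_compact_support_bounded[OF c z] by blast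
  define m where "m = (\<lambda>t. LINT x|lborel. indicator (cball 0 (norm x0 + 1 + R)) x * \<bar>v t x - v t0 x\<bar>)"
  have "\<forall>\<^sub>F t in at t0 within {0..T}. dist (m t) 0 < e / (2 * B)"
    using v_cont[OF t0] \<open>e > 0\<close> B(1) unfolding m_def by (intro tendstoD) auto
  then obtain d1 where d1: "d1 > 0" "\<And>t. t \<in> {0..T} \<Longrightarrow> t \<noteq> t0 \<Longrightarrow> dist t t0 < d1 \<Longrightarrow> m t < e / (2 * B)"
    unfolding eventually_at by (metis dist_real_def diff_zero abs_ge_self le_less_trans)
  have m: "m t * B < e / 2" if "t \<in> {0..T}" "dist t t0 < d1" for t
  proof (cases "t = t0")
    case True
    then show ?thesis using \<open>e > 0\<close> by (simp add: m_def)
  next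
    case False
    from d1(2)[OF that(1) this that(2)] show ?thesis using B(1) by (simp add: field_simps)
  qed
  have "continuous_on UNIV (conv (v t0) k)" by (rule conv_continuous[OF v_loc[OF t0] c z])
  then obtain d2 where d2: "d2 > 0" "\<And>x. dist x x0 < d2 \<Longrightarrow> dist (conv (v t0) k x) (conv (v t0) k x0) < e / 2"
    using \<open>e > 0\<close> unfolding continuous_on_iff by (metis UNIV_I half_gt_zero)
  show "\<exists>d>0. \<forall>z\<in>UNIV \<times> {0..T}. dist z z0 < d \<longrightarrow>
      dist (conv (v (snd z)) k (fst z)) (conv (v (snd z0)) k (fst z0)) < e"
  proof (intro exI[of _ "min 1 (min d1 d2)"] conjI ballI impI)
    fix z :: "'a \<times> real" assume zz: "z \<in> UNIV \<times> {0..T}" "dist z z0 < min 1 (min d1 d2)"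
    define x t where "x = fst z" and "t = snd z"
    have t: "t \<in> {0..T}" using zz by (auto simp: t_def)
    have dx: "dist x x0 < min 1 (min d1 d2)" and dt: "dist t t0 < min 1 (min d1 d2)"
      using zz dist_fst_le[of z z0] dist_snd_le[of z z0] by (auto simp: x_def x0_def t_def t0_def)
    have nx: "norm x + R \<le> norm x0 + 1 + R" using dx norm_triangle_ineq2[of x x0] by (simp add: dist_norm)
    have l: "locally_integrable (\<lambda>y. v t y - v t0 y)" using v_loc t t0 by (intro locally_integrable_diff) auto
    have "conv (v t) k x - conv (v t0) k x = conv (\<lambda>y. v t y - v t0 y) k x"
      unfolding conv_def scaleR_diff_left
      by (rule Bochner_Integration.integral_diff[symmetric]; rule conv_integrable[OF v_loc c z B(2)]) (use t t0 in auto)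
    moreover have "norm (conv (\<lambda>y. v t y - v t0 y) k x) \<le>
      (LINT y|lborel. indicator (cball 0 (norm x + R)) y * \<bar>v t y - v t0 y\<bar>) * B"
      by (rule conv_norm_le[OF l c z B(2)])
    moreover have "(LINT y|lborel. indicator (cball 0 (norm x + R)) y * \<bar>v t y - v t0 y\<bar>) \<le> m t"
      unfolding m_def by (rule locally_integrable_abs_ball_mono[OF l nx])
    ultimately have "norm (conv (v t) k x - conv (v t0) k x) \<le> m t * B"
      using B(1) by (smt (verit) mult_right_mono)
    then have "dist (conv (v t) k x) (conv (v t0) k x) < e / 2" using m[OF t] dt by (simp add: dist_norm)
    moreover have "dist (conv (v t0) k x) (conv (v t0) k x0) < e / 2" using dx by (intro d2) auto
    ultimately have "dist (conv (v t) k x) (conv (v t0) k x0) < e"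
      using dist_triangle_half_l dist_commute by metis
    then show "dist (conv (v (snd z)) k (fst z)) (conv (v (snd z0)) k (fst z0)) < e"
      by (simp add: x_def t_def x0_def t0_def)
  qed (use d1 d2 in auto)
qed

end

lemma borel_measurable_fst[measurable]: "fst \<in> borel_measurable (borel :: ('a::euclidean_space \<times> 'b::euclidean_space) measure)"
  and borel_measurable_snd[measurable]: "snd \<in> borel_measurable (borel :: ('a::euclidean_space \<times> 'b::euclidean_space) measure)"
  by (intro borel_measurable_continuous_onI continuous_intros)+

lemma cball_borel[measurable]: "cball (a::'a::euclidean_space) r \<in> sets borel"
  by (intro borel_closed closed_cball)

section \<open>Local integrability of solution, flux and gradient up to the end times\<close>

context parabolic_flow
begin

lemma F_support: "F z \<noteq> 0 \<Longrightarrow> snd z \<in> {0<..<T}"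
  using outside by blast

text \<open>The mass in a ball is dominated by the pairing with a cutoff, that is, by a convolution
  evaluated at 0. This is continuous in time on a compact interval, hence bounded there.\<close>

lemma v_ball_bounded:
  obtains B where "\<And>t. t \<in> {0..T} \<Longrightarrow> integrable lborel (\<lambda>x. indicator (cball 0 R) x * v t x)"
    "\<And>t. t \<in> {0..T} \<Longrightarrow> (LINT x|lborel. indicator (cball 0 R) x * v t x) \<le> B"
proof -
  \<comment> \<open>The ball of radius \<open>R\<close> has to lie in the half-radius ball of the
    cutoff, where \<open>bump_ge\<close> applies; the \<open>max\<close> keeps \<open>S\<close>
    positive.\<close>
  define S where "S = 2 * max R 1"
  have S: "S > 0" by (simp add: S_def)
  let ?b = "bump S :: 'a \<Rightarrow> real"
  have bc: "continuous_on UNIV ?b" "\<And>x. S < norm x \<Longrightarrow> ?b x = 0"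
    using bump_continuous[OF S] by (auto intro!: bump_zero[OF S])
  have "continuous_on {0..T} (\<lambda>t. (\<lambda>z. conv (v (snd z)) ?b (fst z)) (0, t))"
    by (rule continuous_on_compose2[OF conv_jointly_continuous[OF bc]]) (auto intro!: continuous_intros)
  then have "continuous_on {0..T} (\<lambda>t. conv (v t) ?b 0)" by simp
  then have "compact ((\<lambda>t. conv (v t) ?b 0) ` {0..T})" by (intro compact_continuous_image) auto
  from compact_imp_bounded[OF this]
  obtain B where "\<forall>y\<in>(\<lambda>t. conv (v t) ?b 0) ` {0..T}. norm y \<le> B" unfolding bounded_iff by blast
  then have B: "\<And>t. t \<in> {0..T} \<Longrightarrow> norm (conv (v t) ?b 0) \<le> B" by blast
  show ?thesis
  proof (rule that)
    fix t assume t: "t \<in> {0..T}"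
    show i: "integrable lborel (\<lambda>x. indicator (cball 0 R) x * v t x)"
      using v_loc[OF t] by (simp add: locally_integrable_def)
    have "(LINT x|lborel. indicator (cball 0 R) x * v t x) \<le> (LINT x|lborel. (16/9) * (v t x *\<^sub>R ?b (0 - x)))"
    proof (rule integral_mono[OF i])
      show "integrable lborel (\<lambda>x. (16/9) * (v t x *\<^sub>R ?b (0 - x)))"
        by (intro integrable_mult_right conv_integrable[OF v_loc[OF t] bc(1), of S 1])
           (simp_all add: bc(2) bump_nonneg bump_le_1)
      show "indicator (cball 0 R) x * v t x \<le> (16/9) * (v t x *\<^sub>R ?b (0 - x))" for x
      proof (cases "norm x \<le> R")
        case True
        then have "9/16 \<le> ?b (0 - x)" by (intro bump_ge S) (auto simp: S_def)
        then show ?thesis using True mult_left_mono[OF _ v_nonneg[OF t, of x], of "9/16" "?b (0 - x)"] by simp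
      next
        case False
        then show ?thesis using v_nonneg[OF t, of x] bump_nonneg[of S "0 - x"] by (simp del: diff_0)
      qed
    qed
    also have "\<dots> = (16/9) * conv (v t) ?b 0" by (simp add: conv_def)
    also have "\<dots> \<le> (16/9) * B" using B[OF t] by simp
    finally show "(LINT x|lborel. indicator (cball 0 R) x * v t x) \<le> (16/9) * B" .
  qed
qed

lemma slab_finite: "emeasure lborel (cball (0::'a) R \<times> {0<..<T}) < \<infinity>"
  using emeasure_lborel_cball_finite[of "0::'a" R] T_pos
  by (simp add: lborel_prod[symmetric] lborel.emeasure_pair_measure_Times ennreal_mult_less_top)

lemma w_slice_nn: "AE t in lborel. (\<integral>\<^sup>+x. ennreal (indicator (cball 0 R) x * w (x, t)) \<partial>lborel) =
    indicator {0<..<T} t * ennreal (LINT x|lborel. indicator (cball 0 R) x * v t x)"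
  using w_slice
proof eventually_elim
  case (elim t)
  show ?case
  proof (cases "t \<in> {0<..<T}")
    case True
    then have t: "t \<in> {0..T}" by auto
    have "(\<integral>\<^sup>+x. ennreal (indicator (cball 0 R) x * w (x, t)) \<partial>lborel) =
        (\<integral>\<^sup>+x. ennreal (indicator (cball 0 R) x * v t x) \<partial>lborel)"
      using elim True by (intro nn_integral_cong_AE) (auto elim: eventually_mono)
    also have "\<dots> = ennreal (LINT x|lborel. indicator (cball 0 R) x * v t x)"
      using v_loc[OF t] v_nonneg[OF t] by (intro nn_integral_eq_integral) (auto simp: locally_integrable_def)
    finally show ?thesis using True by simp
  qed (simp add: outside)
qed

text \<open>Tonelli over time slices, with the bound of \<open>v_ball_bounded\<close> that is
  uniform in time. This reaches down to t = 0, where local integrability on the open half space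
  gives no information.\<close>

lemma w_integrable: "integrable lborel (\<lambda>z. indicator (cball 0 R) (fst z) * w z)"
proof (rule integrableI_bounded)
  show "(\<lambda>z. indicator (cball 0 R) (fst z) * w z) \<in> borel_measurable lborel"
    unfolding measurable_lborel1 by measurable
  obtain B where B: "\<And>t. t \<in> {0..T} \<Longrightarrow> (LINT x|lborel. indicator (cball 0 R) x * v t x) \<le> B"
    using v_ball_bounded[of R] by blast
  have "(\<integral>\<^sup>+z. ennreal (norm (indicator (cball 0 R) (fst z) * w z)) \<partial>lborel) =
      (\<integral>\<^sup>+z. ennreal (indicator (cball 0 R) (fst z) * w z) \<partial>(lborel \<Otimes>\<^sub>M lborel))"
    using w_nonneg by (simp add: lborel_prod abs_mult)
  also have "\<dots> = (\<integral>\<^sup>+t. (\<integral>\<^sup>+x. ennreal (indicator (cball 0 R) x * w (x, t)) \<partial>lborel) \<partial>lborel)"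
    by (subst lborel_pair.nn_integral_snd[symmetric]) (unfold lborel_prod measurable_lborel1, measurable)
  also have "\<dots> \<le> (\<integral>\<^sup>+t. indicator {0<..<T} t * ennreal B \<partial>lborel)"
  proof (rule nn_integral_mono_AE)
    show "AE t in lborel. (\<integral>\<^sup>+x. ennreal (indicator (cball 0 R) x * w (x, t)) \<partial>lborel) \<le> indicator {0<..<T} t * ennreal B"
      using w_slice_nn[of R]
    proof eventually_elim
      case (elim t)
      have "indicator {0<..<T} t * ennreal (LINT x|lborel. indicator (cball 0 R) x * v t x) \<le> indicator {0<..<T} t * ennreal B"
        using B[of t] by (cases "t \<in> {0<..<T}") (simp_all add: ennreal_leI)
      then show ?case unfolding elim .
    qed
  qed
  also have "\<dots> < \<infinity>" using T_pos by (simp add: nn_integral_multc ennreal_mult_less_top)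
  finally show "(\<integral>\<^sup>+z. ennreal (norm (indicator (cball 0 R) (fst z) * w z)) \<partial>lborel) < \<infinity>" .
qed

lemma F_integrable: "integrable lborel (\<lambda>z. indicator (cball 0 R) (fst z) * norm (F z))"
proof (rule Bochner_Integration.integrable_bound)
  show "integrable lborel (\<lambda>z. indicator (cball 0 R \<times> {0<..<T}) z + (norm (F z))\<^sup>2)"
    using slab_finite[of R] F_L2 by (intro Bochner_Integration.integrable_add) (auto intro!: integrable_real_indicator borel_Times)
  have "s \<le> 1 + s\<^sup>2" for s :: real using zero_le_square[of "s - 1/2"] by (simp add: power2_eq_square algebra_simps)
  note sq = this
  show "AE z in lborel. norm (indicator (cball 0 R) (fst z) * norm (F z)) \<le>
      norm (indicator (cball 0 R \<times> {0<..<T}) z + (norm (F z))\<^sup>2)"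
  proof (rule AE_I2)
    fix z
    show "norm (indicator (cball 0 R) (fst z) * norm (F z)) \<le> norm (indicator (cball 0 R \<times> {0<..<T}) z + (norm (F z))\<^sup>2)"
      using F_support[of z] sq[of "norm (F z)"]
      by (cases "F z = 0"; cases "norm (fst z) \<le> R"; cases z) (auto simp: indicator_def)
  qed
qed measurable

text \<open>\<open>sgrad\<close> carries no integrability of \<open>D\<close>; the pointwise
  comparison \<open>D_bound\<close> supplies it from flux and solution.\<close>

lemma D_integrable: "integrable lborel (\<lambda>z. indicator (cball 0 R) (fst z) *\<^sub>R D z)"
proof (rule Bochner_Integration.integrable_bound)
  show "integrable lborel (\<lambda>z. (indicator (cball 0 R) (fst z) * norm (F z) + C2 * (indicator (cball 0 R) (fst z) * w z)) / c)"
    by (intro integrable_divide Bochner_Integration.integrable_add integrable_mult_right F_integrable w_integrable)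
  show "AE z in lborel. norm (indicator (cball 0 R) (fst z) *\<^sub>R D z) \<le>
     norm ((indicator (cball 0 R) (fst z) * norm (F z) + C2 * (indicator (cball 0 R) (fst z) * w z)) / c)"
    using D_bound by eventually_elim (use w_nonneg C2_ge c_pos in \<open>auto simp: indicator_def\<close>)
qed measurable

end

section \<open>Testing the mollified solution with a cutoff times the entropy slope\<close>

locale energy_setup = parabolic_flow v w D F T c C2 C3 C4 + entropy G g g' L M
  for v :: "real \<Rightarrow> 'a::euclidean_space \<Rightarrow> real" and w D F T c C2 C3 C4 G g g' L M +
  fixes \<zeta> :: "'a \<Rightarrow> real" and D\<zeta> :: "'a \<Rightarrow> 'a" and S :: real
  assumes \<zeta>_test: "test_function UNIV \<zeta> D\<zeta>" and \<zeta>_nonneg: "\<And>x. 0 \<le> \<zeta> x" and \<zeta>_le: "\<And>x. \<zeta> x \<le> 1"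
    and \<zeta>_zero: "\<And>x. S < norm x \<Longrightarrow> \<zeta> x = 0"
begin

lemma \<zeta>_cont: "continuous_on UNIV \<zeta>" and D\<zeta>_cont: "continuous_on UNIV D\<zeta>"
  by (rule test_functionE[OF \<zeta>_test]; assumption)+

lemma \<zeta>_GDERIV: "GDERIV \<zeta> x :> D\<zeta> x"
  by (rule test_functionE[OF \<zeta>_test])

lemma D\<zeta>_zero: "S < norm x \<Longrightarrow> D\<zeta> x = 0"
  using GDERIV_zero_outside[OF \<zeta>_GDERIV \<zeta>_zero] by blast

end

text \<open>The mollifier \<open>\<rho>\<close> acts in the space variable only. \<open>S\<close> is
  the radius of the cutoff and \<open>R\<close> that of the mollifier.\<close>

locale mollified_energy = energy_setup v w D F T c C2 C3 C4 G g g' L M \<zeta> D\<zeta> S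
  for v :: "real \<Rightarrow> 'a::euclidean_space \<Rightarrow> real" and w D F T c C2 C3 C4 G g g' L M \<zeta> D\<zeta> S +
  fixes \<rho> :: "'a \<Rightarrow> real" and D\<rho> :: "'a \<Rightarrow> 'a" and R :: real
  assumes \<rho>_test: "test_function UNIV \<rho> D\<rho>" and \<rho>_nonneg: "\<And>x. 0 \<le> \<rho> x" and \<rho>_even: "\<And>x. \<rho> (- x) = \<rho> x"
    and \<rho>_zero: "\<And>x. R < norm x \<Longrightarrow> \<rho> x = 0" and \<rho>_one: "integral\<^sup>L lborel \<rho> = 1"
begin

lemma \<rho>_cont: "continuous_on UNIV \<rho>" and D\<rho>_cont: "continuous_on UNIV D\<rho>"
  by (rule test_functionE[OF \<rho>_test]; assumption)+

lemma \<rho>_GDERIV: "GDERIV \<rho> x :> D\<rho> x"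
  by (rule test_functionE[OF \<rho>_test])

lemma D\<rho>_zero: "R < norm x \<Longrightarrow> D\<rho> x = 0"
  using GDERIV_zero_outside[OF \<rho>_GDERIV \<rho>_zero] by blast

lemma \<rho>_integrable: "integrable lborel \<rho>"
  by (rule continuous_compact_support_integrable[OF \<rho>_cont \<rho>_zero])

lemma \<rho>_loc: "locally_integrable \<rho>"
  by (rule continuous_locally_integrable[OF \<rho>_cont])

lemma \<rho>_borel[measurable]: "\<rho> \<in> borel_measurable borel"
  by (rule borel_measurable_continuous_onI[OF \<rho>_cont])

text \<open>\<open>W\<close> is the solution mollified in x and \<open>V\<close> its spatial
  gradient, with the derivative placed on the kernel. \<psi> is the test function \<zeta> g(W) at a
  fixed time and \<Psi> its spatial gradient, which is smooth enough because \<open>W\<close>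
  is.\<close>

definition W :: "'a \<times> real \<Rightarrow> real" where "W z = conv (v (snd z)) \<rho> (fst z)"
definition V :: "'a \<times> real \<Rightarrow> 'a" where "V z = conv (v (snd z)) D\<rho> (fst z)"
definition \<psi> :: "real \<Rightarrow> 'a \<Rightarrow> real" where "\<psi> t x = \<zeta> x * g (W (x, t))"
definition \<Psi> :: "'a \<times> real \<Rightarrow> 'a" where
  "\<Psi> z = g (W z) *\<^sub>R D\<zeta> (fst z) + (\<zeta> (fst z) * g' (W z)) *\<^sub>R V z"

lemma W_cont: "continuous_on (UNIV \<times> {0..T}) W" and V_cont: "continuous_on (UNIV \<times> {0..T}) V"
  unfolding W_def[abs_def] V_def[abs_def]
  by (rule conv_jointly_continuous[OF \<rho>_cont \<rho>_zero] conv_jointly_continuous[OF D\<rho>_cont D\<rho>_zero]; assumption)+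

lemma W_nonneg: "snd z \<in> {0..T} \<Longrightarrow> 0 \<le> W z"
  unfolding W_def conv_def using v_nonneg \<rho>_nonneg by (intro integral_nonneg_AE AE_I2) auto

lemma \<Psi>_cont: "continuous_on (UNIV \<times> {0..T}) \<Psi>"
  unfolding \<Psi>_def[abs_def]
  by (intro continuous_intros V_cont continuous_on_compose2[OF cont_g W_cont] continuous_on_compose2[OF g'_cont W_cont]
      continuous_on_compose2[OF \<zeta>_cont continuous_on_fst[OF continuous_on_id]]
      continuous_on_compose2[OF D\<zeta>_cont continuous_on_fst[OF continuous_on_id]]) (auto simp: W_nonneg)

lemma \<Psi>_zero: "S < norm (fst z) \<Longrightarrow> \<Psi> z = 0"
  using \<zeta>_zero D\<zeta>_zero by (simp add: \<Psi>_def)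

lemma \<Psi>_slice: "t \<in> {0..T} \<Longrightarrow> continuous_on UNIV (\<lambda>x. \<Psi> (x, t))"
  by (rule continuous_on_compose2[OF \<Psi>_cont]) (auto intro: continuous_intros)

lemma W_slice: "t \<in> {0..T} \<Longrightarrow> continuous_on UNIV (\<lambda>x. W (x, t))"
  by (rule continuous_on_compose2[OF W_cont]) (auto intro: continuous_intros)

lemma \<psi>_test:
  assumes t: "t \<in> {0..T}"
  shows "test_function UNIV (\<psi> t) (\<lambda>x. \<Psi> (x, t))"
  unfolding test_function_UNIV_iff
proof (intro conjI allI)
  fix x
  have W: "GDERIV (\<lambda>x. W (x, t)) x :> V (x, t)"
    using conv_GDERIV[OF v_loc[OF t] \<rho>_test, of x] by (simp add: W_def V_def)
  have "GDERIV (\<lambda>x. \<zeta> x * g (W (x, t))) x :> \<zeta> x *\<^sub>R (g' (W (x, t)) *\<^sub>R V (x, t)) + g (W (x, t)) *\<^sub>R D\<zeta> x"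
    using W_nonneg t by (intro GDERIV_mult \<zeta>_GDERIV GDERIV_DERIV_compose[OF W] g_deriv) auto
  then show "GDERIV (\<psi> t) x :> \<Psi> (x, t)" by (simp add: \<psi>_def[abs_def] \<Psi>_def add.commute)
  show "\<exists>R. \<forall>x. R < norm x \<longrightarrow> \<psi> t x = 0" using \<zeta>_zero by (auto simp: \<psi>_def)
qed (rule \<Psi>_slice[OF t])

lemma \<psi>_zero: "S < norm x \<Longrightarrow> \<psi> t x = 0"
  using \<zeta>_zero by (simp add: \<psi>_def)

lemma \<Psi>_bounded:
  obtains B where "B > 0" "\<And>z. snd z \<in> {0..T} \<Longrightarrow> norm (\<Psi> z) \<le> B"
proof -
  have "compact (\<Psi> ` (cball 0 S \<times> {0..T}))"
    by (intro compact_continuous_image continuous_on_subset[OF \<Psi>_cont] compact_Times) auto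
  then obtain B where B: "B > 0" "\<And>y. y \<in> \<Psi> ` (cball 0 S \<times> {0..T}) \<Longrightarrow> norm y \<le> B"
    using compact_imp_bounded bounded_pos by metis
  have "norm (\<Psi> z) \<le> B" if "snd z \<in> {0..T}" for z
  proof (cases "S < norm (fst z)")
    case True
    then show ?thesis using B(1) by (simp add: \<Psi>_zero)
  next
    case False
    then have "z \<in> cball 0 S \<times> {0..T}" using that by (cases z) auto
    then show ?thesis using B by blast
  qed
  with B(1) show ?thesis by (rule that)
qed

text \<open>The modulus is uniform in x because \<Psi> vanishes outside a compact cylinder. It
  measures the error of freezing the test function in time.\<close>

lemma \<Psi>_uniform:
  assumes "e > 0"
  obtains d where "d > 0" "\<And>s t x. s \<in> {0..T} \<Longrightarrow> t \<in> {0..T} \<Longrightarrow> \<bar>s - t\<bar> < d \<Longrightarrow> norm (\<Psi> (x, s) - \<Psi> (x, t)) \<le> e"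
proof -
  have "uniformly_continuous_on (cball 0 S \<times> {0..T}) \<Psi>"
    by (intro compact_uniformly_continuous continuous_on_subset[OF \<Psi>_cont] compact_Times) auto
  then obtain d where d: "d > 0" "\<And>y z. y \<in> cball 0 S \<times> {0..T} \<Longrightarrow> z \<in> cball 0 S \<times> {0..T} \<Longrightarrow> dist y z < d \<Longrightarrow> dist (\<Psi> y) (\<Psi> z) < e"
    using assms unfolding uniformly_continuous_on_def by metis
  show ?thesis
  proof (rule that[OF d(1)])
    fix s t x assume st: "s \<in> {0..T}" "t \<in> {0..T}" "\<bar>s - t\<bar> < d"
    show "norm (\<Psi> (x, s) - \<Psi> (x, t)) \<le> e"
    proof (cases "S < norm x")
      case True
      then show ?thesis using assms by (simp add: \<Psi>_zero)
    next
      case False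
      have "dist (\<Psi> (x, s)) (\<Psi> (x, t)) < e"
        using st False by (intro d(2)) (auto simp: dist_Pair_Pair dist_real_def)
      then show ?thesis by (simp add: dist_norm)
    qed
  qed
qed

text \<open>\<open>W\<close> is controlled only for times in \<open>{0..T}\<close>; extension by
  zero from this closed strip gives a Borel field on all of space-time, and thereby a Borel
  mollification \<Phi>.\<close>

definition \<Psi>T :: "'a \<times> real \<Rightarrow> 'a" where "\<Psi>T z = indicator (UNIV \<times> {0..T}) z *\<^sub>R \<Psi> z"
definition \<Phi> :: "'a \<times> real \<Rightarrow> 'a" where "\<Phi> z = (LINT y|lborel. \<rho> y *\<^sub>R \<Psi>T (z - (y, 0)))"

lemma \<Psi>T_borel[measurable]: "\<Psi>T \<in> borel_measurable borel"
  unfolding \<Psi>T_def[abs_def]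
  by (rule borel_measurable_continuous_on_indicator[OF _ \<Psi>_cont]) (auto intro!: borel_closed closed_Times)

lemma \<Phi>_borel[measurable]: "\<Phi> \<in> borel_measurable borel"
  unfolding \<Phi>_def[abs_def] by measurable

lemma \<Phi>_eq: "t \<in> {0..T} \<Longrightarrow> \<Phi> (x, t) = conv \<rho> (\<lambda>x. \<Psi> (x, t)) x"
  by (simp add: \<Phi>_def conv_def \<Psi>T_def)

lemma \<rho>_average_bound:
  fixes f :: "'a \<Rightarrow> 'a"
  assumes "\<And>x. norm (f x) \<le> e" "continuous_on UNIV f"
  shows "norm (conv \<rho> f x) \<le> e"
proof -
  have [measurable]: "f \<in> borel_measurable borel" by (rule borel_measurable_continuous_onI[OF assms(2)])
  have b: "norm (\<rho> y *\<^sub>R f (x - y)) \<le> \<rho> y * e" for y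
    using assms(1)[of "x - y"] \<rho>_nonneg[of y] by (simp add: mult_left_mono)
  have "integrable lborel (\<lambda>y. \<rho> y *\<^sub>R f (x - y))"
    by (rule Bochner_Integration.integrable_bound[OF integrable_mult_left[OF \<rho>_integrable, of e]])
       (use b order_trans[OF b abs_ge_self] in auto)
  then have "norm (conv \<rho> f x) \<le> (LINT y|lborel. \<rho> y * e)" unfolding conv_def
    using b by (intro order_trans[OF integral_norm_bound] integral_mono integrable_norm integrable_mult_left \<rho>_integrable)
  then show ?thesis using \<rho>_one by simp
qed

lemma \<rho>_average_zero:
  fixes f :: "'a \<Rightarrow> 'a"
  assumes z: "\<And>x. S < norm x \<Longrightarrow> f x = 0" and x: "S + R < norm x"
  shows "conv \<rho> f x = 0"
proof -
  have "\<rho> y *\<^sub>R f (x - y) = 0" for y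
  proof (cases "R < norm y")
    case False
    then have "S < norm (x - y)" using x norm_triangle_ineq2[of x y] by simp
    then show ?thesis using z by simp
  qed (simp add: \<rho>_zero)
  then have "(\<lambda>y. \<rho> y *\<^sub>R f (x - y)) = (\<lambda>y. 0)" by (rule ext)
  then show ?thesis by (simp only: conv_def) simp
qed

text \<open>The dissipation with the mollifier sitting on the test gradient, which is the form that
  the equation delivers. \<open>Ken_eq\<close> moves the mollifier to the flux.\<close>

definition Ken :: "'a \<times> real \<Rightarrow> real" where "Ken z = F z \<bullet> \<Phi> z"

lemma Ken_borel[measurable]: "Ken \<in> borel_measurable borel"
  unfolding Ken_def[abs_def] by measurable

lemma Ken_integrable: "integrable lborel Ken"
proof -
  obtain B where B: "B > 0" "\<And>z. snd z \<in> {0..T} \<Longrightarrow> norm (\<Psi> z) \<le> B" using \<Psi>_bounded by blast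
  show ?thesis
  proof (rule Bochner_Integration.integrable_bound[OF integrable_mult_left[OF F_integrable[of "S + R"], of B]])
    show "AE z in lborel. norm (Ken z) \<le> norm (indicator (cball 0 (S + R)) (fst z) * norm (F z) * B)"
    proof (rule AE_I2)
      fix z :: "'a \<times> real"
      obtain x t where z: "z = (x, t)" by (cases z)
      show "norm (Ken z) \<le> norm (indicator (cball 0 (S + R)) (fst z) * norm (F z) * B)"
      proof (cases "t \<in> {0<..<T}")
        case False
        then show ?thesis using outside[of z] by (simp add: z Ken_def)
      next
        case True
        then have t: "t \<in> {0..T}" by auto
        show ?thesis
        proof (cases "norm x \<le> S + R")
          case True
          have "norm (\<Phi> (x, t)) \<le> B" unfolding \<Phi>_eq[OF t]
            by (rule \<rho>_average_bound) (use B t \<Psi>_slice[OF t] in auto)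
          then have "norm (Ken z) \<le> norm (F z) * B" unfolding Ken_def z
            by (metis Cauchy_Schwarz_ineq2 mult_left_mono norm_ge_zero order_trans real_norm_def)
          then show ?thesis using True B(1) by (simp add: z)
        next
          case False
          then have "\<Phi> (x, t) = 0" unfolding \<Phi>_eq[OF t] by (intro \<rho>_average_zero) (auto simp: \<Psi>_zero)
          then show ?thesis by (simp add: Ken_def z)
        qed
      qed
    qed
  qed measurable
qed

definition En :: "real \<Rightarrow> real" where "En t = (LINT x|lborel. \<zeta> x * G (W (x, t)))"

lemma En_integrable: "t \<in> {0..T} \<Longrightarrow> integrable lborel (\<lambda>x. \<zeta> x * G (W (x, t)))"
  by (rule continuous_compact_support_integrable[of _ S])
     (auto simp: \<zeta>_zero W_nonneg intro!: continuous_intros \<zeta>_cont continuous_on_compose2[OF cont_G W_slice])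

lemma \<psi>W_integrable: "t \<in> {0..T} \<Longrightarrow> s \<in> {0..T} \<Longrightarrow> integrable lborel (\<lambda>x. W (x, s) * \<psi> t x)"
  by (rule continuous_compact_support_integrable[of _ S])
     (auto simp: \<zeta>_zero \<psi>_def[abs_def] W_nonneg intro!: continuous_intros \<zeta>_cont W_slice continuous_on_compose2[OF cont_g W_slice])

text \<open>The tangent inequality at the later time leaves the increment of \<open>W\<close> paired
  with \<open>\<psi> t\<close>, which does not depend on the running time. After the mollifier is
  swapped onto \<open>\<psi> t\<close>, the integrated equation applies exactly.\<close>

lemma En_increment:
  assumes "0 \<le> s" "s \<le> t" "t \<le> T"
  shows "En t - En s \<le> - (LINT z|lborel. indicator {s<..t} (snd z) * (F z \<bullet> conv \<rho> (\<lambda>x. \<Psi> (x, t)) (fst z)))"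
proof -
  have t: "t \<in> {0..T}" and s: "s \<in> {0..T}" using assms by auto
  have pc: "continuous_on UNIV (\<psi> t)" by (rule test_functionE[OF \<psi>_test[OF t]])
  have sw: "(LINT x|lborel. W (x, r) * \<psi> t x) = (LINT y|lborel. v r y * conv \<rho> (\<psi> t) y)" if "r \<in> {0..T}" for r
    using conv_swap[OF v_loc[OF that] \<rho>_cont \<rho>_zero \<rho>_even pc \<psi>_zero] by (simp add: W_def)
  have "En t - En s = (LINT x|lborel. \<zeta> x * G (W (x, t)) - \<zeta> x * G (W (x, s)))"
    unfolding En_def by (rule Bochner_Integration.integral_diff[symmetric]) (rule En_integrable t s)+
  also have "\<dots> \<le> (LINT x|lborel. W (x, t) * \<psi> t x - W (x, s) * \<psi> t x)"
  proof (rule integral_mono)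
    fix x
    have "\<zeta> x * (G (W (x, t)) - G (W (x, s))) \<le> \<zeta> x * (g (W (x, t)) * (W (x, t) - W (x, s)))"
      using t s by (intro mult_left_mono G_tangent W_nonneg \<zeta>_nonneg) auto
    then show "\<zeta> x * G (W (x, t)) - \<zeta> x * G (W (x, s)) \<le> W (x, t) * \<psi> t x - W (x, s) * \<psi> t x"
      by (simp add: \<psi>_def algebra_simps)
  qed (intro Bochner_Integration.integrable_diff En_integrable \<psi>W_integrable t s)+
  also have "\<dots> = (LINT x|lborel. W (x, t) * \<psi> t x) - (LINT x|lborel. W (x, s) * \<psi> t x)"
    by (rule Bochner_Integration.integral_diff) (rule \<psi>W_integrable t s)+
  also have "\<dots> = (LINT y|lborel. v t y * conv \<rho> (\<psi> t) y) - (LINT y|lborel. v s y * conv \<rho> (\<psi> t) y)"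
    by (simp only: sw[OF t] sw[OF s])
  also have "\<dots> = - (LINT z|lborel. indicator {s<..t} (snd z) * (F z \<bullet> conv \<rho> (\<lambda>x. \<Psi> (x, t)) (fst z)))"
    by (rule flux[OF conv_test_function[OF \<rho>_loc \<psi>_test[OF t] \<rho>_zero] assms])
  finally show ?thesis .
qed

lemma Ken_le_En: "integral\<^sup>L lborel Ken \<le> En 0"
proof -
  define f where "f = (\<lambda>z. indicator (cball 0 (S + R)) (fst z) * norm (F z))"
  have f: "integrable lborel f" unfolding f_def by (rule F_integrable)
  have ind: "integrable lborel (\<lambda>z. indicator I (snd z) * h z)"
    if "integrable lborel h" "I \<in> sets borel" for h :: "'a \<times> real \<Rightarrow> real" and I :: "real set"
  proof (rule Bochner_Integration.integrable_bound[OF that(1)])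
    have "h \<in> borel_measurable borel" using that(1) by auto
    then show "(\<lambda>z. indicator I (snd z) * h z) \<in> borel_measurable lborel"
      unfolding measurable_lborel1 using that(2) by measurable
  qed (auto simp: indicator_def)
  have split: "(LINT z|lborel. indicator {0<..t} (snd z) * h z) - (LINT z|lborel. indicator {0<..s} (snd z) * h z) =
     (LINT z|lborel. indicator {s<..t} (snd z) * h z)" if "0 \<le> s" "s \<le> t" "integrable lborel h" for s t and h :: "'a \<times> real \<Rightarrow> real"
  proof -
    have "(LINT z|lborel. indicator {0<..t} (snd z) * h z) - (LINT z|lborel. indicator {0<..s} (snd z) * h z) =
       (LINT z|lborel. indicator {0<..t} (snd z) * h z - indicator {0<..s} (snd z) * h z)"
      by (rule Bochner_Integration.integral_diff[symmetric]) (intro ind that; simp)+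
    also have "\<dots> = (LINT z|lborel. indicator {s<..t} (snd z) * h z)"
      using that by (intro Bochner_Integration.integral_cong) (auto simp: indicator_def)
    finally show ?thesis .
  qed
  \<comment> \<open>Entropy plus the dissipation accumulated so far; it has to be nonincreasing up
    to the error measured by the accumulated flux \<open>\<mu>\<close>.\<close>
  define H where "H = (\<lambda>t. En t + (LINT z|lborel. indicator {0<..t} (snd z) * Ken z))"
  define \<mu> where "\<mu> = (\<lambda>t. (LINT z|lborel. indicator {0<..t} (snd z) * f z))"
  have "H T \<le> H 0"
  proof (rule increments_nonpos[OF T_pos, where \<mu> = \<mu>])
    fix e :: real assume "e > 0"
    then obtain d where d: "d > 0" "\<And>s t x. s \<in> {0..T} \<Longrightarrow> t \<in> {0..T} \<Longrightarrow> \<bar>s - t\<bar> < d \<Longrightarrow> norm (\<Psi> (x, s) - \<Psi> (x, t)) \<le> e"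
      using \<Psi>_uniform by blast
    have "H t - H s \<le> e * (\<mu> t - \<mu> s)" if st: "0 \<le> s" "s \<le> t" "t \<le> T" "t - s < d" for s t
    proof -
      have t: "t \<in> {0..T}" using st by auto
      define P where "P = (\<lambda>z. F z \<bullet> conv \<rho> (\<lambda>x. \<Psi> (x, t)) (fst z))"
      have key: "\<bar>indicator {s<..t} (snd z) * (Ken z - P z)\<bar> \<le> e * (indicator {s<..t} (snd z) * f z)" for z
      proof (cases "snd z \<in> {s<..t}")
        case True
        obtain x r where z: "z = (x, r)" by (cases z)
        have r: "r \<in> {0..T}" "\<bar>r - t\<bar> < d" using True st z by auto
        have df: "\<Phi> z - conv \<rho> (\<lambda>x. \<Psi> (x, t)) x = conv \<rho> (\<lambda>x. \<Psi> (x, r) - \<Psi> (x, t)) x"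
        proof -
          have i: "integrable lborel (\<lambda>y. \<rho> y *\<^sub>R \<Psi> (x - y, q))" if q: "q \<in> {0..T}" for q
          proof -
            obtain B where B: "B > 0" "\<And>z. snd z \<in> {0..T} \<Longrightarrow> norm (\<Psi> z) \<le> B" using \<Psi>_bounded by blast
            show ?thesis by (rule conv_integrable[OF \<rho>_loc \<Psi>_slice[OF q], of S B x]) (use B q in \<open>auto simp: \<Psi>_zero\<close>)
          qed
          show ?thesis unfolding z \<Phi>_eq[OF r(1)] conv_def scaleR_diff_right
            by (rule Bochner_Integration.integral_diff[symmetric]) (rule i r t)+
        qed
        have "norm (F z) * norm (\<Phi> z - conv \<rho> (\<lambda>x. \<Psi> (x, t)) x) \<le> e * f z"
        proof (cases "norm x \<le> S + R")
          case True
          have le: "norm (\<Phi> z - conv \<rho> (\<lambda>x. \<Psi> (x, t)) x) \<le> e" unfolding df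
            by (rule \<rho>_average_bound) (auto intro!: d continuous_intros \<Psi>_slice r t)
          show ?thesis using True mult_left_mono[OF le norm_ge_zero[of "F z"]] by (simp add: f_def z mult.commute)
        next
          case False
          then have "conv \<rho> (\<lambda>x. \<Psi> (x, r) - \<Psi> (x, t)) x = 0" by (intro \<rho>_average_zero) (auto simp: \<Psi>_zero)
          then show ?thesis using \<open>e > 0\<close> by (simp only: df) (simp add: f_def)
        qed
        moreover have "\<bar>Ken z - P z\<bar> \<le> norm (F z) * norm (\<Phi> z - conv \<rho> (\<lambda>x. \<Psi> (x, t)) x)"
          unfolding Ken_def P_def z fst_conv inner_diff_right[symmetric] by (rule Cauchy_Schwarz_ineq2)
        ultimately show ?thesis using True by simp
      qed simp
      have Pm: "P \<in> borel_measurable borel"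
      proof -
        obtain B where B: "B > 0" "\<And>z. snd z \<in> {0..T} \<Longrightarrow> norm (\<Psi> z) \<le> B" using \<Psi>_bounded by blast
        have "continuous_on UNIV (conv \<rho> (\<lambda>x. \<Psi> (x, t)))"
          by (rule conv_continuous[OF \<rho>_loc \<Psi>_slice[OF t], of S]) (auto simp: \<Psi>_zero)
        then have [measurable]: "conv \<rho> (\<lambda>x. \<Psi> (x, t)) \<in> borel_measurable borel" by (rule borel_measurable_continuous_onI)
        show ?thesis unfolding P_def by measurable
      qed
      note [measurable] = Pm
      have Ki: "integrable lborel (\<lambda>z. indicator {s<..t} (snd z) * Ken z)" by (rule ind[OF Ken_integrable]) simp
      have fi: "integrable lborel (\<lambda>z. e * (indicator {s<..t} (snd z) * f z))" by (intro integrable_mult_right ind[OF f]) simp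
      have di: "integrable lborel (\<lambda>z. indicator {s<..t} (snd z) * (Ken z - P z))"
        by (rule Bochner_Integration.integrable_bound[OF fi]) (use key order_trans[OF key abs_ge_self] in auto)
      have Pi: "integrable lborel (\<lambda>z. indicator {s<..t} (snd z) * P z)"
        using Bochner_Integration.integrable_diff[OF Ki di] by (simp add: algebra_simps)
      have "H t - H s = En t - En s + (LINT z|lborel. indicator {s<..t} (snd z) * Ken z)"
        using split[OF st(1,2) Ken_integrable] by (simp add: H_def)
      also have "\<dots> \<le> - (LINT z|lborel. indicator {s<..t} (snd z) * P z) + (LINT z|lborel. indicator {s<..t} (snd z) * Ken z)"
        using En_increment[OF st(1-3)] by (simp add: P_def)
      also have "\<dots> = (LINT z|lborel. indicator {s<..t} (snd z) * (Ken z - P z))"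
        using Ki Pi by (simp add: right_diff_distrib)
      also have "\<dots> \<le> (LINT z|lborel. e * (indicator {s<..t} (snd z) * f z))"
        using key abs_le_D1 by (intro integral_mono di fi) blast
      also have "\<dots> = e * (\<mu> t - \<mu> s)" using split[OF st(1,2) f] by (simp add: \<mu>_def)
      finally show ?thesis .
    qed
    then show "\<exists>d>0. \<forall>s t. 0 \<le> s \<and> s \<le> t \<and> t \<le> T \<and> t - s < d \<longrightarrow> H t - H s \<le> e * (\<mu> t - \<mu> s)"
      using d(1) by blast
  qed
  moreover have "H 0 = En 0" by (simp add: H_def)
  moreover have "H T = En T + integral\<^sup>L lborel Ken"
  proof -
    have "(LINT z|lborel. indicator {0<..T} (snd z) * Ken z) = integral\<^sup>L lborel Ken"
    proof (rule Bochner_Integration.integral_cong[OF refl])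
      fix z
      show "indicator {0<..T} (snd z) * Ken z = Ken z"
        by (cases "F z = 0") (use F_support[of z] in \<open>auto simp: Ken_def indicator_def\<close>)
    qed
    then show ?thesis by (simp add: H_def)
  qed
  moreover have "0 \<le> En T"
    unfolding En_def using T_pos \<zeta>_nonneg G_nonneg W_nonneg by (intro integral_nonneg_AE AE_I2) auto
  ultimately show ?thesis by simp
qed

text \<open>The entropy is at most \<open>M\<close> times the mass; with the mollifier moved onto
  \<zeta>, an average of values at most 1 remains at most 1.\<close>

lemma En_0_le:
  assumes v0: "integrable lborel (v 0)"
  shows "En 0 \<le> M * integral\<^sup>L lborel (v 0)"
proof -
  have t: "0 \<in> {0..T}" using T_pos by auto
  have i: "integrable lborel (\<lambda>x. W (x, 0) * \<zeta> x)"
    by (rule continuous_compact_support_integrable[of _ S])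
       (auto simp: \<zeta>_zero intro!: continuous_intros \<zeta>_cont W_slice[OF t])
  have "En 0 \<le> (LINT x|lborel. M * (W (x, 0) * \<zeta> x))"
    unfolding En_def
  proof (rule integral_mono[OF En_integrable[OF t] integrable_mult_right[OF i]])
    fix x
    have "\<zeta> x * G (W (x, 0)) \<le> \<zeta> x * (M * W (x, 0))"
      using t by (intro mult_left_mono G_le W_nonneg \<zeta>_nonneg) auto
    then show "\<zeta> x * G (W (x, 0)) \<le> M * (W (x, 0) * \<zeta> x)" by (simp add: mult_ac)
  qed
  also have "\<dots> = M * (LINT x|lborel. W (x, 0) * \<zeta> x)" by simp
  also have "(LINT x|lborel. W (x, 0) * \<zeta> x) = (LINT y|lborel. v 0 y * conv \<rho> \<zeta> y)"
    using conv_swap[OF v_loc[OF t] \<rho>_cont \<rho>_zero \<rho>_even \<zeta>_cont \<zeta>_zero] by (simp add: W_def)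
  also have "M * \<dots> \<le> M * integral\<^sup>L lborel (v 0)"
  proof (intro mult_left_mono M_nonneg integral_mono')
    fix y
    have "conv \<rho> \<zeta> y \<le> (LINT z|lborel. \<rho> z)" unfolding conv_def
    proof (rule integral_mono)
      show "integrable lborel (\<lambda>z. \<rho> z *\<^sub>R \<zeta> (y - z))"
        by (rule conv_integrable[OF \<rho>_loc \<zeta>_cont, of S 1]) (simp_all add: \<zeta>_zero \<zeta>_nonneg \<zeta>_le)
      show "\<rho> z *\<^sub>R \<zeta> (y - z) \<le> \<rho> z" for z
        using mult_left_mono[OF \<zeta>_le[of "y - z"] \<rho>_nonneg[of z]] by simp
    qed (rule \<rho>_integrable)
    then show "v 0 y * conv \<rho> \<zeta> y \<le> v 0 y"
      using mult_left_mono[of "conv \<rho> \<zeta> y" 1 "v 0 y"] v_nonneg[OF t] \<rho>_one by simp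
    show "0 \<le> v 0 y" by (rule v_nonneg[OF t])
  qed (rule v0)
  finally show ?thesis .
qed

definition FA :: "'a \<times> real \<Rightarrow> 'a" where "FA z = (LINT y|lborel. \<rho> y *\<^sub>R F (z - (y, 0)))"

text \<open>Fubini and two changes of variable: translation in z by \<open>(y, 0)\<close> moves the
  shift from the test gradient to the flux, and y -> -y restores its sign because
  \<open>\<rho>\<close> is even.\<close>

lemma Ken_eq: "integral\<^sup>L lborel Ken = (LINT z|lborel. FA z \<bullet> \<Psi>T z)"
proof -
  obtain B where B: "B > 0" "\<And>z. snd z \<in> {0..T} \<Longrightarrow> norm (\<Psi> z) \<le> B" using \<Psi>_bounded by blast
  have \<Psi>T: "norm (\<Psi>T z) \<le> B * indicator (cball 0 S) (fst z)" for z
    using B \<Psi>_zero[of z] by (cases z) (auto simp: \<Psi>T_def indicator_def)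
  define f where "f = (\<lambda>z. indicator (cball 0 (S + R)) (fst z) * norm (F z))"
  have f: "integrable lborel f" unfolding f_def by (rule F_integrable)
  have fm[measurable]: "f \<in> borel_measurable borel" using f by auto
  have b1: "norm (F z \<bullet> (\<rho> y *\<^sub>R \<Psi>T (z - (y, 0)))) \<le> B * (\<rho> y * f z)" for y z
  proof (cases "R < norm y \<or> S + R < norm (fst z)")
    case True
    have "\<rho> y *\<^sub>R \<Psi>T (z - (y, 0)) = 0"
    proof (cases "R < norm y")
      case False
      then have "S < norm (fst z - y)" using True norm_triangle_ineq2[of "fst z" y] by auto
      then show ?thesis using \<Psi>_zero[of "z - (y, 0)"] by (simp add: \<Psi>T_def)
    qed (simp add: \<rho>_zero)
    then have "norm (F z \<bullet> (\<rho> y *\<^sub>R \<Psi>T (z - (y, 0)))) = 0" by (simp only: inner_zero_right norm_zero)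
    moreover have "0 \<le> B * (\<rho> y * f z)" using B(1) \<rho>_nonneg[of y] by (simp add: f_def)
    ultimately show ?thesis by (simp only:)
  next
    case False
    have "norm (F z \<bullet> (\<rho> y *\<^sub>R \<Psi>T (z - (y, 0)))) \<le> norm (F z) * norm (\<rho> y *\<^sub>R \<Psi>T (z - (y, 0)))"
      unfolding real_norm_def by (rule Cauchy_Schwarz_ineq2)
    also have "\<dots> \<le> norm (F z) * (\<rho> y * B)"
    proof -
      have "norm (\<Psi>T (z - (y, 0))) \<le> B * 1"
        using B(1) by (intro order_trans[OF \<Psi>T] mult_left_mono) (auto simp: indicator_def)
      then show ?thesis using \<rho>_nonneg[of y] by (auto intro!: mult_left_mono)
    qed
    finally show ?thesis using False by (simp add: f_def mult_ac)
  qed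
  have ti: "integrable (lborel \<Otimes>\<^sub>M lborel) (\<lambda>(y, z). \<rho> y * f z)" by (rule integrable_tensor[OF \<rho>_integrable f])
  have int1: "integrable (lborel \<Otimes>\<^sub>M lborel) (\<lambda>(y, z). F z \<bullet> (\<rho> y *\<^sub>R \<Psi>T (z - (y, 0))))"
  proof (rule Bochner_Integration.integrable_bound[OF integrable_mult_right[OF ti, of B]])
    show "AE p in lborel \<Otimes>\<^sub>M lborel. norm (case p of (y, z) \<Rightarrow> F z \<bullet> (\<rho> y *\<^sub>R \<Psi>T (z - (y, 0)))) \<le>
       norm (B * (case p of (y, z) \<Rightarrow> \<rho> y * f z))"
    proof (rule AE_I2)
      fix p :: "'a \<times> 'a \<times> real"
      obtain y z where p: "p = (y, z)" by (cases p)
      show "norm (case p of (y, z) \<Rightarrow> F z \<bullet> (\<rho> y *\<^sub>R \<Psi>T (z - (y, 0)))) \<le> norm (B * (case p of (y, z) \<Rightarrow> \<rho> y * f z))"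
        unfolding p prod.case by (rule order_trans[OF b1[of z y]]) simp
    qed
  qed measurable
  have "integral\<^sup>L lborel Ken = (LINT z|lborel. (LINT y|lborel. F z \<bullet> (\<rho> y *\<^sub>R \<Psi>T (z - (y, 0)))))"
  proof (rule Bochner_Integration.integral_cong[OF refl])
    fix z :: "'a \<times> real"
    show "Ken z = (LINT y|lborel. F z \<bullet> (\<rho> y *\<^sub>R \<Psi>T (z - (y, 0))))"
    proof (cases "snd z \<in> {0..T}")
      case True
      obtain x t where z: "z = (x, t)" by (cases z)
      have t: "t \<in> {0..T}" using True z by simp
      have "integrable lborel (\<lambda>y. \<rho> y *\<^sub>R \<Psi> (x - y, t))"
        by (rule conv_integrable[OF \<rho>_loc \<Psi>_slice[OF t], of S B x]) (use B t in \<open>auto simp: \<Psi>_zero\<close>)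
      then have "integrable lborel (\<lambda>y. \<rho> y *\<^sub>R \<Psi>T (z - (y, 0)))" using t by (simp add: z \<Psi>T_def)
      then show ?thesis unfolding Ken_def \<Phi>_def by (rule integral_inner_right[symmetric])
    next
      case False
      then have "F z = 0" using outside[of z] by auto
      then show ?thesis by (simp add: Ken_def)
    qed
  qed
  also have "\<dots> = (LINT y|lborel. (LINT z|lborel. F z \<bullet> (\<rho> y *\<^sub>R \<Psi>T (z - (y, 0)))))"
    using lborel_pair.Fubini_integral[OF int1] by simp
  also have "\<dots> = (LINT y|lborel. (LINT z|lborel. F (z - (y, 0)) \<bullet> (\<rho> y *\<^sub>R \<Psi>T z)))"
  proof -
    have shift: "(LINT z|lborel. F z \<bullet> (\<rho> y *\<^sub>R \<Psi>T (z - (y, 0)))) =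
       (LINT z|lborel. F (z + (y, 0)) \<bullet> (\<rho> y *\<^sub>R \<Psi>T z))" for y
    proof -
      have "(LINT z|lborel. F z \<bullet> (\<rho> y *\<^sub>R \<Psi>T (z - (y, 0)))) =
         (LINT z|lborel. (\<lambda>z. F z \<bullet> (\<rho> y *\<^sub>R \<Psi>T (z - (y, 0)))) (z + (y, 0)))"
        by (rule lborel_integral_translate[symmetric]) measurable
      then show ?thesis by (simp only: add_diff_cancel)
    qed
    have "(LINT y|lborel. (LINT z|lborel. F z \<bullet> (\<rho> y *\<^sub>R \<Psi>T (z - (y, 0))))) =
      (LINT y|lborel. (LINT z|lborel. F (z + (y, 0)) \<bullet> (\<rho> y *\<^sub>R \<Psi>T z)))" unfolding shift ..
    \<comment> \<open>Reflection in y produces the shift \<open>z - (y, 0)\<close> that occurs in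
      \<open>FA\<close>.\<close>
    also have "\<dots> = (LINT y|lborel. (\<lambda>y. (LINT z|lborel. F (z + (y, 0)) \<bullet> (\<rho> y *\<^sub>R \<Psi>T z))) (0 - y))"
      by (rule lborel_integral_reflect[symmetric]) measurable
    also have "\<dots> = (LINT y|lborel. (LINT z|lborel. F (z - (y, 0)) \<bullet> (\<rho> y *\<^sub>R \<Psi>T z)))"
    proof (rule Bochner_Integration.integral_cong[OF refl])
      fix y :: 'a
      have zeq: "z + (- y, 0) = z - (y, 0)" for z :: "'a \<times> real" by (cases z) simp
      show "(\<lambda>y. (LINT z|lborel. F (z + (y, 0)) \<bullet> (\<rho> y *\<^sub>R \<Psi>T z))) (0 - y) =
         (LINT z|lborel. F (z - (y, 0)) \<bullet> (\<rho> y *\<^sub>R \<Psi>T z))" by (simp only: zeq diff_0 \<rho>_even)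
    qed
    finally show ?thesis .
  qed
  also have "\<dots> = (LINT z|lborel. (LINT y|lborel. F (z - (y, 0)) \<bullet> (\<rho> y *\<^sub>R \<Psi>T z)))"
  proof (rule lborel_pair.Fubini_integral[symmetric])
    show "integrable (lborel \<Otimes>\<^sub>M lborel) (\<lambda>(y, z). F (z - (y, 0)) \<bullet> (\<rho> y *\<^sub>R \<Psi>T z))"
      proof (rule lborel_pair.Fubini_integrable)
        have fs: "integrable lborel (\<lambda>z. f (z - (y, 0)))" "(LINT z|lborel. f (z - (y, 0))) = integral\<^sup>L lborel f" for y
          using lborel_integrable_translate[OF fm, of "- (y, 0)"] lborel_integral_translate[OF fm, of "- (y, 0)"] f
          unfolding add_uminus_conv_diff by blast+
        \<comment> \<open>This is \<open>b1\<close> at the translated point with \<open>- y\<close>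
          in place of \<open>y\<close>.\<close>
        have b2: "norm (F (z - (y, 0)) \<bullet> (\<rho> y *\<^sub>R \<Psi>T z)) \<le> B * (\<rho> y * f (z - (y, 0)))" for y z
        proof -
          have zeq: "z - (y, 0) - (- y, 0) = z" by (cases z) simp
          show ?thesis using b1[of "z - (y, 0)" "- y"] by (simp only: zeq \<rho>_even)
        qed
        have m: "integrable lborel (\<lambda>z. F (z - (y, 0)) \<bullet> (\<rho> y *\<^sub>R \<Psi>T z))" for y
          by (rule Bochner_Integration.integrable_bound[OF integrable_mult_right[OF integrable_mult_right[OF fs(1)[of y], of "\<rho> y"], of B]])
             (measurable, rule AE_I2, rule order_trans[OF b2], simp)
        then show "AE y in lborel. integrable lborel (\<lambda>z. case (y, z) of (y, z) \<Rightarrow> F (z - (y, 0)) \<bullet> (\<rho> y *\<^sub>R \<Psi>T z))"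
          by simp
        show "integrable lborel (\<lambda>y. LINT z|lborel. norm (case (y, z) of (y, z) \<Rightarrow> F (z - (y, 0)) \<bullet> (\<rho> y *\<^sub>R \<Psi>T z)))"
        proof (rule Bochner_Integration.integrable_bound[OF integrable_mult_left[OF \<rho>_integrable, of "B * integral\<^sup>L lborel f"]])
          show "AE y in lborel. norm (LINT z|lborel. norm (case (y, z) of (y, z) \<Rightarrow> F (z - (y, 0)) \<bullet> (\<rho> y *\<^sub>R \<Psi>T z)))
             \<le> norm (\<rho> y * (B * integral\<^sup>L lborel f))"
          proof (rule AE_I2)
            fix y
            have "(LINT z|lborel. norm (F (z - (y, 0)) \<bullet> (\<rho> y *\<^sub>R \<Psi>T z))) \<le> (LINT z|lborel. B * (\<rho> y * f (z - (y, 0))))"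
              using b2 fs(1) m by (intro integral_mono integrable_norm) auto
            also have "\<dots> = \<rho> y * (B * integral\<^sup>L lborel f)" using fs(2) by simp
            finally show "norm (LINT z|lborel. norm (case (y, z) of (y, z) \<Rightarrow> F (z - (y, 0)) \<bullet> (\<rho> y *\<^sub>R \<Psi>T z)))
             \<le> norm (\<rho> y * (B * integral\<^sup>L lborel f))" by simp
          qed
        qed measurable
      qed measurable
  qed
  also have "\<dots> = (LINT z|lborel. FA z \<bullet> \<Psi>T z)"
  proof (rule integral_cong_AE)
    show "AE z in lborel. (LINT y|lborel. F (z - (y, 0)) \<bullet> (\<rho> y *\<^sub>R \<Psi>T z)) = FA z \<bullet> \<Psi>T z"
    proof -
      \<comment> \<open>Truncation makes the flux globally integrable, as the averaging lemma
        requires. For |x| <= S and |y| <= R the truncation at radius S + R is invisible.\<close>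
      have "integrable lborel (\<lambda>z. indicator (cball 0 (S + R)) (fst z) *\<^sub>R F z)"
        by (rule Bochner_Integration.integrable_bound[OF F_integrable[of "S + R"]]) auto
      then have "AE z in lborel. integrable lborel (\<lambda>y. \<rho> y *\<^sub>R (\<lambda>z. indicator (cball 0 (S + R)) (fst z) *\<^sub>R F z) (z - (\<lambda>y. (y, 0)) y))"
        by (rule L1_averaging_AE)
           (auto simp: \<rho>_nonneg \<rho>_integrable intro!: bounded_linear_Pair bounded_linear_ident bounded_linear_zero)
      then show ?thesis
      proof eventually_elim
        case (elim z)
        show ?case
        proof (cases "S < norm (fst z)")
          case True
          then have "\<Psi>T z = 0" by (simp add: \<Psi>T_def \<Psi>_zero)
          then show ?thesis by simp
        next
          case False
          have "(\<lambda>y. \<rho> y *\<^sub>R (indicator (cball 0 (S + R)) (fst (z - (y, 0))) *\<^sub>R F (z - (y, 0)))) =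
                (\<lambda>y. \<rho> y *\<^sub>R F (z - (y, 0)))"
          proof
            fix y
            show "\<rho> y *\<^sub>R (indicator (cball 0 (S + R)) (fst (z - (y, 0))) *\<^sub>R F (z - (y, 0))) = \<rho> y *\<^sub>R F (z - (y, 0))"
            proof (cases "R < norm y")
              case False2: False
              have "norm (fst z - y) \<le> S + R" using False False2 norm_triangle_ineq4[of "fst z" y] by simp
              then show ?thesis by simp
            qed (simp add: \<rho>_zero)
          qed
          then have i: "integrable lborel (\<lambda>y. \<rho> y *\<^sub>R F (z - (y, 0)))" using elim by simp
          have "(LINT y|lborel. F (z - (y, 0)) \<bullet> (\<rho> y *\<^sub>R \<Psi>T z)) = (LINT y|lborel. (\<rho> y *\<^sub>R F (z - (y, 0))) \<bullet> \<Psi>T z)"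
            by simp
          also have "\<dots> = FA z \<bullet> \<Psi>T z" unfolding FA_def by (rule integral_inner_left) (rule i)
          finally show ?thesis .
        qed
      qed
    qed
  qed (unfold FA_def, measurable)
  finally show ?thesis .
qed

lemma energy_mollified:
  assumes "integrable lborel (v 0)"
  shows "(LINT z|lborel. FA z \<bullet> \<Psi>T z) \<le> M * integral\<^sup>L lborel (v 0)"
  using Ken_le_En En_0_le[OF assms] Ken_eq by simp

end

section \<open>The energy inequality in the limit\<close>

text \<open>\<open>P\<close> may fail to be measurable, so Fubini is applied to the complement of a
  Borel null set that contains all failures.\<close>

lemma AE_lborel_slice:
  fixes P :: "'a::euclidean_space \<times> real \<Rightarrow> bool"
  assumes "AE z in lborel. P z"
  shows "AE t in lborel. AE x in lborel. P (x, t)"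
proof -
  obtain N where N: "N \<in> null_sets lborel" and NP: "\<And>z. z \<in> space lborel - N \<Longrightarrow> P z"
    by (rule AE_E3[OF assms], rule that)
  have [measurable]: "N \<in> sets borel" using N by auto
  have "AE z in lborel \<Otimes>\<^sub>M lborel. z \<notin> N" unfolding lborel_prod by (rule AE_not_in[OF N])
  then have "AE x in lborel. AE t in lborel. (x, t) \<notin> N" by (rule lborel_pair.AE_pair)
  moreover have "{z \<in> space (lborel \<Otimes>\<^sub>M lborel). (fst z, snd z) \<notin> N} \<in> sets (lborel \<Otimes>\<^sub>M lborel)"
    unfolding lborel_prod by measurable
  ultimately have "AE t in lborel. AE x in lborel. (x, t) \<notin> N"
    using lborel_pair.AE_commute[of "\<lambda>x t. (x, t) \<notin> N"] by simp
  then show ?thesis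
  proof eventually_elim
    case (elim t)
    then show ?case by eventually_elim (simp add: NP)
  qed
qed

lemma AE_lborel_snd:
  assumes "AE t in lborel. Q (t::real)"
  shows "AE z in (lborel :: ('a::euclidean_space \<times> real) measure). Q (snd z)"
proof -
  obtain N where N: "N \<in> null_sets lborel" and NP: "\<And>t. t \<in> space lborel - N \<Longrightarrow> Q t"
    by (rule AE_E3[OF assms], rule that)
  have [measurable]: "N \<in> sets borel" using N by auto
  have "AE z in (lborel :: 'a measure) \<Otimes>\<^sub>M (lborel :: real measure). snd z \<notin> N"
  proof (rule lborel_pair.AE_pair_measure)
    show "{z \<in> space ((lborel :: 'a measure) \<Otimes>\<^sub>M (lborel :: real measure)). snd z \<notin> N} \<in> sets (lborel \<Otimes>\<^sub>M lborel)" by measurable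
    show "AE x in (lborel :: 'a measure). AE t in lborel. snd (x, t) \<notin> N" using AE_not_in[OF N] by simp
  qed
  then show ?thesis unfolding lborel_prod
    by eventually_elim (simp add: NP)
qed

lemma AE_lborel_reflect:
  fixes P :: "'a::euclidean_space \<Rightarrow> bool"
  assumes "AE y in lborel. P y"
  shows "AE y in lborel. P (a - y)"
proof (rule AE_distrD[of "\<lambda>y. a - y" lborel borel])
  show "AE x in distr lborel borel ((-) a). P x" by (subst lborel_distr_diff) (rule assms)
qed measurable

lemma integrable_Pair:
  fixes f :: "'a \<Rightarrow> 'b::euclidean_space" and g :: "'a \<Rightarrow> 'c::euclidean_space"
  assumes f: "integrable N f" and g: "integrable N g"
  shows "integrable N (\<lambda>x. (f x, g x))"
proof (rule Bochner_Integration.integrable_bound)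
  show "integrable N (\<lambda>x. norm (f x) + norm (g x))" using f g by auto
  show "(\<lambda>x. (f x, g x)) \<in> borel_measurable N" using f g by (intro borel_measurable_Pair) auto
  show "AE x in N. norm (f x, g x) \<le> norm (norm (f x) + norm (g x))"
    by (intro AE_I2) (simp add: norm_Pair_le)
qed

text \<open>The mollification of \<open>d\<close> at \<open>t\<close> is the pairing of
  \<open>d\<close> with a mollifier centred at \<open>t\<close>, which is an admissible test
  function once its radius is below the distance of \<open>t\<close> to the ends. The mollifications
  therefore vanish eventually at each interior point, while a subsequence converges to
  \<open>d\<close> almost everywhere.\<close>

lemma fundamental_lemma_interval:
  fixes d :: "real \<Rightarrow> 'a::euclidean_space"
  assumes d: "integrable lborel d" and out: "\<And>t. t \<notin> {0<..<T} \<Longrightarrow> d t = 0"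
    and test: "\<And>\<theta> D\<theta>. test_function {0<..<T} \<theta> D\<theta> \<Longrightarrow> (LINT t|lborel. \<theta> t *\<^sub>R d t) = 0"
  shows "AE t in lborel. d t = 0"
proof -
  define \<delta> :: "nat \<Rightarrow> real" where "\<delta> = (\<lambda>j. 1 / real (Suc j))"
  have \<delta>0: "\<delta> j > 0" for j by (simp add: \<delta>_def)
  have \<delta>lim: "\<delta> \<longlonglongrightarrow> 0" unfolding \<delta>_def by (rule LIMSEQ_Suc) (rule lim_1_over_n)
  define a where "a = (\<lambda>j z. LINT y|lborel. mollifier (\<delta> j) y *\<^sub>R d (z - y))"
  have ai: "integrable lborel (a j)" for j
    unfolding a_def by (rule L1_averaging_integrable[OF d bounded_linear_ident]) (auto simp: mollifier_integrable \<delta>0 mollifier_nonneg)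
  have supp: "norm y \<le> \<delta> j" if "mollifier (\<delta> j) y \<noteq> 0" for j and y :: real
    using mollifier_zero[OF \<delta>0[of j], of y] that by linarith
  have al: "(\<lambda>j. LINT z|lborel. norm (a j z - d z)) \<longlonglongrightarrow> 0"
    unfolding a_def
    by (rule L1_averaging_converges[OF d bounded_linear_ident, of "\<lambda>j. mollifier (\<delta> j)" \<delta>])
       (auto simp: mollifier_integrable \<delta>0 mollifier_nonneg mollifier_integral \<delta>lim intro: supp[unfolded real_norm_def])
  obtain r h where r: "strict_mono (r::nat \<Rightarrow> nat)" and lim: "AE x in lborel. (\<lambda>n. a (r n) x) \<longlonglongrightarrow> d x"
    by (rule L1_convergent_dominated_subseq[OF ai d al], rule that)
  have [measurable]: "d \<in> borel_measurable borel" using d by auto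
  have zero: "\<forall>\<^sub>F j in sequentially. a j t = 0" if t: "t \<in> {0<..<T}" for t
  proof -
    have "\<forall>\<^sub>F j in sequentially. \<delta> j < min t (T - t)" using \<delta>lim t by (intro order_tendstoD) auto
    then show ?thesis
    proof eventually_elim
      case (elim j)
      obtain D where D: "test_function UNIV (mollifier (\<delta> j) :: real \<Rightarrow> real) D"
        using mollifier_test_function[OF \<delta>0[of j]] by blast
      have [measurable]: "mollifier (\<delta> j) \<in> borel_measurable (borel :: real measure)"
        using mollifier_integrable[OF \<delta>0[of j]] by auto
      have tf: "test_function {0<..<T} (\<lambda>s. mollifier (\<delta> j) (s - t)) (\<lambda>s. D (s - t))"
        unfolding test_function_def
      proof (intro conjI allI)
        have D': "\<And>x. DERIV (mollifier (\<delta> j)) x :> D x" "continuous_on UNIV D"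
          using D by (auto simp: test_function_UNIV_iff)
        show "GDERIV (\<lambda>s. mollifier (\<delta> j) (s - t)) x :> D (x - t)" for x
        proof -
          have "((\<lambda>s. mollifier (\<delta> j) (s - t)) has_real_derivative D (x - t) * 1) (at x)"
            by (rule DERIV_chain2[OF D'(1)]) (auto intro!: derivative_eq_intros)
          then show ?thesis by simp
        qed
        show "continuous_on UNIV (\<lambda>s. D (s - t))"
          by (rule continuous_on_compose2[OF D'(2)]) (auto intro!: continuous_intros)
        have sub: "{s. mollifier (\<delta> j) (s - t) \<noteq> 0} \<subseteq> cball t (\<delta> j)"
          using supp[of j] by (auto simp: dist_real_def abs_minus_commute)
        then have cl: "closure {s. mollifier (\<delta> j) (s - t) \<noteq> 0} \<subseteq> cball t (\<delta> j)"
          by (rule closure_minimal) auto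
        show "compact (closure {s. mollifier (\<delta> j) (s - t) \<noteq> 0})"
          using bounded_subset[OF bounded_cball sub] by (simp add: compact_closure)
        have "cball t (\<delta> j) \<subseteq> {0<..<T}" using elim by (auto simp: dist_real_def)
        with cl show "closure {s. mollifier (\<delta> j) (s - t) \<noteq> 0} \<subseteq> interior {0<..<T}" by simp
      qed
      have "a j t = (LINT y|lborel. (\<lambda>s. mollifier (\<delta> j) (s - t) *\<^sub>R d s) (t - y))"
        unfolding a_def by (simp add: mollifier_even[OF \<delta>0])
      also have "\<dots> = (LINT s|lborel. mollifier (\<delta> j) (s - t) *\<^sub>R d s)"
        by (rule lborel_integral_reflect) measurable
      also have "\<dots> = 0" by (rule test[OF tf])
      finally show "a j t = 0" .
    qed
  qed
  show ?thesis
    using lim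
  proof eventually_elim
    case (elim t)
    show "d t = 0"
    proof (cases "t \<in> {0<..<T}")
      case True
      have "(\<lambda>n. a (r n) t) \<longlonglongrightarrow> 0"
        using eventually_subseq[OF r zero[OF True]] by (rule tendsto_eventually)
      with elim show ?thesis by (rule LIMSEQ_unique)
    qed (rule out)
  qed
qed

section \<open>The gradient of the mollified solution as the mollified weak gradient\<close>

context parabolic_flow
begin

lemma flow_integrable_times:
  fixes k :: "'a \<Rightarrow> 'b::euclidean_space"
  assumes k: "continuous_on UNIV k" "\<And>x. R < norm x \<Longrightarrow> k x = 0"
  shows "integrable lborel (\<lambda>z. w z *\<^sub>R k (fst z))"
proof -
  obtain B where B: "B > 0" "\<And>x. norm (k x) \<le> B" using continuous_compact_support_bounded[OF k] by blast
  have [measurable]: "k \<in> borel_measurable borel" using k(1) by (rule borel_measurable_continuous_onI)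
  show ?thesis
  proof (rule Bochner_Integration.integrable_bound[OF integrable_mult_left[OF w_integrable[of R], of B]])
    show "AE z in lborel. norm (w z *\<^sub>R k (fst z)) \<le> norm (indicator (cball 0 R) (fst z) * w z * B)"
    proof (rule AE_I2)
      fix z
      show "norm (w z *\<^sub>R k (fst z)) \<le> norm (indicator (cball 0 R) (fst z) * w z * B)"
        using k(2)[of "fst z"] B w_nonneg[of z] by (auto simp: indicator_def intro!: mult_left_mono)
    qed
    show "(\<lambda>z. w z *\<^sub>R k (fst z)) \<in> borel_measurable lborel" unfolding measurable_lborel1 by measurable
  qed
qed

lemma flow_D_integrable_times:
  fixes k :: "'a \<Rightarrow> real"
  assumes k: "continuous_on UNIV k" "\<And>x. R < norm x \<Longrightarrow> k x = 0"
  shows "integrable lborel (\<lambda>z. k (fst z) *\<^sub>R D z)"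
proof -
  obtain B where B: "B > 0" "\<And>x. norm (k x) \<le> B" using continuous_compact_support_bounded[OF k] by blast
  have [measurable]: "k \<in> borel_measurable borel" using k(1) by (rule borel_measurable_continuous_onI)
  show ?thesis
  proof (rule Bochner_Integration.integrable_bound[OF integrable_scaleR_right[OF D_integrable[of R], of B]])
    show "AE z in lborel. norm (k (fst z) *\<^sub>R D z) \<le> norm (B *\<^sub>R (indicator (cball 0 R) (fst z) *\<^sub>R D z))"
    proof (rule AE_I2)
      fix z
      show "norm (k (fst z) *\<^sub>R D z) \<le> norm (B *\<^sub>R (indicator (cball 0 R) (fst z) *\<^sub>R D z))"
        using k(2)[of "fst z"] B(1) B(2)[of "fst z"] by (auto simp: indicator_def intro!: mult_right_mono)
    qed
    show "(\<lambda>z. k (fst z) *\<^sub>R D z) \<in> borel_measurable lborel" unfolding measurable_lborel1 by measurable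
  qed
qed

lemma w_conv_slice:
  fixes k :: "'a \<Rightarrow> 'b::euclidean_space"
  assumes k: "continuous_on UNIV k" "\<And>x. R < norm x \<Longrightarrow> k x = 0"
  shows "AE t in lborel. t \<in> {0<..<T} \<longrightarrow> (\<forall>x. conv (v t) k x = (LINT y|lborel. w (y, t) *\<^sub>R k (x - y)))"
  using w_slice
proof eventually_elim
  case (elim t)
  show ?case
  proof (intro impI allI)
    fix x assume t: "t \<in> {0<..<T}"
    have [measurable]: "k \<in> borel_measurable borel" using k(1) by (rule borel_measurable_continuous_onI)
    have [measurable]: "v t \<in> borel_measurable borel" using t by (intro locally_integrable_borel v_loc) auto
    show "conv (v t) k x = (LINT y|lborel. w (y, t) *\<^sub>R k (x - y))"
      unfolding conv_def
      by (rule integral_cong_AE) (use elim t in \<open>auto elim: eventually_mono\<close>)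
  qed
qed

text \<open>For fixed x both sides are functions of t alone. Testing the weak gradient with
  \<theta>(t) \<phi>(x - y), whose gradient in y is -\<theta>(t) D\<phi>(x - y), shows that their
  difference integrates to 0 against every \<theta>.\<close>

lemma sgrad_slice:
  assumes \<phi>: "test_function UNIV \<phi> D\<phi>"
  shows "AE z in lborel. snd z \<in> {0<..<T} \<longrightarrow> conv (v (snd z)) D\<phi> (fst z) = (LINT y|lborel. \<phi> y *\<^sub>R D (z - (y, 0)))"
proof -
  obtain R where z: "\<And>x. R < norm x \<Longrightarrow> \<phi> x = 0" "\<And>x. R < norm x \<Longrightarrow> D\<phi> x = 0"
    and c: "continuous_on UNIV \<phi>" "continuous_on UNIV D\<phi>" and g: "\<And>x. GDERIV \<phi> x :> D\<phi> x"
    by (rule test_functionE[OF \<phi>], rule that)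
  note [measurable] = borel_measurable_continuous_onI[OF c(1)] borel_measurable_continuous_onI[OF c(2)]
  have slice: "AE t in lborel. t \<in> {0<..<T} \<longrightarrow> conv (v t) D\<phi> x = (LINT y|lborel. \<phi> y *\<^sub>R D (x - y, t))" for x
  proof -
    have zx: "\<And>y. norm x + R < norm y \<Longrightarrow> \<phi> (x - y) = 0" "\<And>y. norm x + R < norm y \<Longrightarrow> D\<phi> (x - y) = 0"
      using z norm_diff_gt by blast+
    have cx: "continuous_on UNIV (\<lambda>y. \<phi> (x - y))" "continuous_on UNIV (\<lambda>y. D\<phi> (x - y))"
      by (intro continuous_on_compose2[OF c(1)] continuous_on_compose2[OF c(2)] continuous_intros; simp)+
    have tf: "test_function UNIV (\<lambda>y. \<phi> (x - y)) (\<lambda>y. - D\<phi> (x - y))"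
      unfolding test_function_UNIV_iff
    proof (intro conjI allI)
      fix y
      have "((\<lambda>y. \<phi> (x - y)) has_derivative (\<lambda>h. (- h) \<bullet> D\<phi> (x - y))) (at y)"
        using g[of "x - y"] unfolding gderiv_def
        by (rule has_derivative_compose[rotated, of \<phi> "\<lambda>h. h \<bullet> D\<phi> (x - y)" "\<lambda>y. x - y"]) (auto intro!: derivative_eq_intros)
      then show "GDERIV (\<lambda>y. \<phi> (x - y)) y :> - D\<phi> (x - y)" by (simp add: gderiv_def)
      show "\<exists>R. \<forall>y. R < norm y \<longrightarrow> \<phi> (x - y) = 0" using zx(1) by blast
    qed (intro continuous_intros cx)
    have i1: "integrable (lborel \<Otimes>\<^sub>M lborel) (\<lambda>(y, t). w (y, t) *\<^sub>R D\<phi> (x - y))"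
      using flow_integrable_times[OF cx(2) zx(2)] by (simp add: lborel_prod case_prod_unfold)
    have i2: "integrable (lborel \<Otimes>\<^sub>M lborel) (\<lambda>(y, t). \<phi> (x - y) *\<^sub>R D (y, t))"
      using flow_D_integrable_times[OF cx(1) zx(1)] by (simp add: lborel_prod case_prod_unfold)
    define d where "d = (\<lambda>t. (LINT y|lborel. w (y, t) *\<^sub>R D\<phi> (x - y)) - (LINT y|lborel. \<phi> (x - y) *\<^sub>R D (y, t)))"
    have "AE t in lborel. d t = 0"
    proof (rule fundamental_lemma_interval[of _ T])
      show "integrable lborel d" unfolding d_def
        by (intro Bochner_Integration.integrable_diff lborel_pair.integrable_snd[OF i1] lborel_pair.integrable_snd[OF i2])
      show "d t = 0" if "t \<notin> {0<..<T}" for t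
        using outside that by (simp add: d_def)
      fix \<theta> D\<theta> assume \<theta>: "test_function {0<..<T} \<theta> D\<theta>"
      then have \<theta>U: "test_function UNIV \<theta> D\<theta>" by (auto simp: test_function_def)
      obtain B where \<theta>c: "continuous_on UNIV \<theta>" and B: "\<And>x. norm (\<theta> x) \<le> B" "B > 0"
        by (rule test_functionE[OF \<theta>U], rule that)
      have [measurable]: "\<theta> \<in> borel_measurable borel" using \<theta>c by (rule borel_measurable_continuous_onI)
      have mult: "integrable (lborel \<Otimes>\<^sub>M lborel) (\<lambda>(y, t). \<theta> t *\<^sub>R k (y, t))"
        if k: "integrable (lborel \<Otimes>\<^sub>M lborel) k" for k :: "'a \<times> real \<Rightarrow> 'a"
      proof (rule Bochner_Integration.integrable_bound[OF integrable_scaleR_right[OF k, of B]])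
        show "AE z in lborel \<Otimes>\<^sub>M lborel. norm (case z of (y, t) \<Rightarrow> \<theta> t *\<^sub>R k (y, t)) \<le> norm (B *\<^sub>R k z)"
        proof (rule AE_I2)
          fix z :: "'a \<times> real"
          show "norm (case z of (y, t) \<Rightarrow> \<theta> t *\<^sub>R k (y, t)) \<le> norm (B *\<^sub>R k z)"
            using B(1)[of "snd z"] B(2) by (cases z) (auto intro!: mult_right_mono)
        qed
        have [measurable]: "k \<in> borel_measurable (lborel \<Otimes>\<^sub>M lborel)" using k by auto
        show "(\<lambda>(y, t). \<theta> t *\<^sub>R k (y, t)) \<in> borel_measurable (lborel \<Otimes>\<^sub>M lborel)" by measurable
      qed
      have j1: "integrable (lborel \<Otimes>\<^sub>M lborel) (\<lambda>(y, t). \<theta> t *\<^sub>R (w (y, t) *\<^sub>R D\<phi> (x - y)))" using mult[OF i1] by simp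
      have j2: "integrable (lborel \<Otimes>\<^sub>M lborel) (\<lambda>(y, t). \<theta> t *\<^sub>R (\<phi> (x - y) *\<^sub>R D (y, t)))" using mult[OF i2] by simp
      have "(LINT t|lborel. \<theta> t *\<^sub>R d t) = (LINT t|lborel. (LINT y|lborel. \<theta> t *\<^sub>R (w (y, t) *\<^sub>R D\<phi> (x - y)))
          - (LINT y|lborel. \<theta> t *\<^sub>R (\<phi> (x - y) *\<^sub>R D (y, t))))"
        by (simp add: d_def scaleR_diff_right del: scaleR_scaleR)
      also have "\<dots> = (LINT t|lborel. (LINT y|lborel. \<theta> t *\<^sub>R (w (y, t) *\<^sub>R D\<phi> (x - y))))
          - (LINT t|lborel. (LINT y|lborel. \<theta> t *\<^sub>R (\<phi> (x - y) *\<^sub>R D (y, t))))"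
        by (rule Bochner_Integration.integral_diff[OF lborel_pair.integrable_snd[OF j1] lborel_pair.integrable_snd[OF j2]])
      also have "(LINT t|lborel. (LINT y|lborel. \<theta> t *\<^sub>R (w (y, t) *\<^sub>R D\<phi> (x - y)))) =
          (LINT z|lborel. \<theta> (snd z) *\<^sub>R (w z *\<^sub>R D\<phi> (x - fst z)))"
        using lborel_pair.integral_snd[OF j1] by (simp add: lborel_prod case_prod_unfold)
      also have "(LINT t|lborel. (LINT y|lborel. \<theta> t *\<^sub>R (\<phi> (x - y) *\<^sub>R D (y, t)))) =
          (LINT z|lborel. \<theta> (snd z) *\<^sub>R (\<phi> (x - fst z) *\<^sub>R D z))"
        using lborel_pair.integral_snd[OF j2] by (simp add: lborel_prod case_prod_unfold)
      also have "(LINT z|lborel. \<theta> (snd z) *\<^sub>R (w z *\<^sub>R D\<phi> (x - fst z))) -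
          (LINT z|lborel. \<theta> (snd z) *\<^sub>R (\<phi> (x - fst z) *\<^sub>R D z)) = 0"
        using sgrad[OF tf \<theta>] by (simp add: mult.commute)
      finally show "(LINT t|lborel. \<theta> t *\<^sub>R d t) = 0" .
    qed
    moreover have "AE t in lborel. t \<in> {0<..<T} \<longrightarrow> (\<forall>x. conv (v t) D\<phi> x = (LINT y|lborel. w (y, t) *\<^sub>R D\<phi> (x - y)))"
      by (rule w_conv_slice[OF c(2) z(2)])
    ultimately show ?thesis
    proof eventually_elim
      case (elim t)
      have "(LINT y|lborel. \<phi> y *\<^sub>R D (x - y, t)) = (LINT y|lborel. (\<lambda>y. \<phi> (x - y) *\<^sub>R D (y, t)) (x - y))" by simp
      also have "\<dots> = (LINT y|lborel. \<phi> (x - y) *\<^sub>R D (y, t))" by (rule lborel_integral_reflect) measurable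
      finally show ?case using elim by (simp add: d_def)
    qed
  qed
  \<comment> \<open>Passing from "every x, almost every t" to almost every point needs a measurable
    exceptional set. Joint continuity on the closed strip makes this version of the left side
    Borel.\<close>
  define a where "a = (\<lambda>z. indicator (UNIV \<times> {0..T}) z *\<^sub>R conv (v (snd z)) D\<phi> (fst z))"
  have am[measurable]: "a \<in> borel_measurable borel" unfolding a_def
    by (rule borel_measurable_continuous_on_indicator[OF _ conv_jointly_continuous[OF c(2) z(2)]])
       (auto intro!: borel_closed closed_Times)
  have "AE z in lborel \<Otimes>\<^sub>M lborel. snd z \<in> {0<..<T} \<longrightarrow> a z = (LINT y|lborel. \<phi> y *\<^sub>R D (z - (y, 0)))"
  proof (rule lborel_pair.AE_pair_measure)
    show "{z \<in> space (lborel \<Otimes>\<^sub>M lborel). snd z \<in> {0<..<T} \<longrightarrow> a z = (LINT y|lborel. \<phi> y *\<^sub>R D (z - (y, 0)))}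
      \<in> sets (lborel \<Otimes>\<^sub>M lborel)"
      unfolding lborel_prod sets_lborel space_lborel by measurable
    show "AE x in lborel. AE t in lborel. snd (x, t) \<in> {0<..<T} \<longrightarrow> a (x, t) = (LINT y|lborel. \<phi> y *\<^sub>R D ((x, t) - (y, 0)))"
    proof (rule AE_I2)
      fix x
      show "AE t in lborel. snd (x, t) \<in> {0<..<T} \<longrightarrow> a (x, t) = (LINT y|lborel. \<phi> y *\<^sub>R D ((x, t) - (y, 0)))"
        using slice[of x] by eventually_elim (auto simp: a_def)
    qed
  qed
  then show ?thesis unfolding lborel_prod
    by eventually_elim (auto simp: a_def indicator_def mem_Times_iff)
qed

end

section \<open>Removal of the mollification\<close>

lemma integral_Pair:
  fixes f :: "'a \<Rightarrow> 'b::euclidean_space" and g :: "'a \<Rightarrow> 'c::euclidean_space"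
  assumes i: "integrable N (\<lambda>x. (f x, g x))"
  shows "integrable N f" "integrable N g" "integral\<^sup>L N (\<lambda>x. (f x, g x)) = (integral\<^sup>L N f, integral\<^sup>L N g)"
proof -
  show "integrable N f" using integrable_bounded_linear[OF bounded_linear_fst i] by simp
  show "integrable N g" using integrable_bounded_linear[OF bounded_linear_snd i] by simp
  show "integral\<^sup>L N (\<lambda>x. (f x, g x)) = (integral\<^sup>L N f, integral\<^sup>L N g)"
    using integral_bounded_linear[OF bounded_linear_fst i] integral_bounded_linear[OF bounded_linear_snd i]
    by (simp add: prod_eq_iff)
qed

text \<open>The variance of \<open>f\<close> under the probability density \<open>\<rho>\<close> is
  nonnegative.\<close>

lemma average_square_le:
  fixes f \<rho> :: "'a \<Rightarrow> real"
  assumes r: "integrable N \<rho>" "\<And>x. 0 \<le> \<rho> x" "integral\<^sup>L N \<rho> = 1"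
    and f: "integrable N (\<lambda>x. \<rho> x * f x)" "integrable N (\<lambda>x. \<rho> x * (f x)\<^sup>2)"
  shows "(integral\<^sup>L N (\<lambda>x. \<rho> x * f x))\<^sup>2 \<le> integral\<^sup>L N (\<lambda>x. \<rho> x * (f x)\<^sup>2)"
proof -
  define m where "m = integral\<^sup>L N (\<lambda>x. \<rho> x * f x)"
  have "0 \<le> integral\<^sup>L N (\<lambda>x. \<rho> x * (f x - m)\<^sup>2)" using r(2) by (intro integral_nonneg_AE AE_I2) auto
  also have "\<dots> = integral\<^sup>L N (\<lambda>x. \<rho> x * (f x)\<^sup>2 - 2 * m * (\<rho> x * f x) + m\<^sup>2 * \<rho> x)"
    by (rule Bochner_Integration.integral_cong) (auto simp: power2_eq_square algebra_simps)
  also have "\<dots> = integral\<^sup>L N (\<lambda>x. \<rho> x * (f x)\<^sup>2) - 2 * m * m + m\<^sup>2"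
    using r f by (simp add: m_def[symmetric])
  finally show ?thesis by (simp add: m_def[symmetric] power2_eq_square)
qed

lemma linear_le_quadratic: "(s::real) \<le> 1 + s\<^sup>2"
  using zero_le_square[of "s - 1/2"] by (simp add: power2_eq_square algebra_simps)

context energy_setup
begin

text \<open>Formally the flux times the gradient of \<zeta> g(w). The chain rule is written out
  because \<open>w\<close> has only a weak gradient; the expression arises as a limit of mollified
  ones.\<close>

definition energy_density :: "'a \<times> real \<Rightarrow> real" where
  "energy_density z = F z \<bullet> (g (w z) *\<^sub>R D\<zeta> (fst z) + (\<zeta> (fst z) * g' (w z)) *\<^sub>R D z)"

text \<open>The difficulty is a majorant for the terms with g'(W) V. By \<open>D_bound\<close>, |V|
  <= (n + C2 W) / c with n the average of |F|, so the two bounds on g' estimate the integrand by a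
  quadratic polynomial in n, and n^2 is at most the average of |F|^2. That average converges in L1,
  hence is dominated along a subsequence.\<close>

lemma energy:
  assumes v0: "integrable lborel (v 0)"
  shows "integrable lborel energy_density" "integral\<^sup>L lborel energy_density \<le> M * integral\<^sup>L lborel (v 0)"
proof -
  define \<delta> :: "nat \<Rightarrow> real" where "\<delta> = (\<lambda>j. 1 / real (Suc j))"
  have \<delta>0: "\<delta> j > 0" and \<delta>1: "\<delta> j \<le> 1" for j by (simp_all add: \<delta>_def)
  have \<delta>lim: "\<delta> \<longlonglongrightarrow> 0" unfolding \<delta>_def by (rule LIMSEQ_Suc) (rule lim_1_over_n)
  define \<rho> :: "nat \<Rightarrow> 'a \<Rightarrow> real" where "\<rho> = (\<lambda>j. mollifier (\<delta> j))"
  have "\<forall>j. \<exists>D. test_function UNIV (\<rho> j) D" unfolding \<rho>_def using mollifier_test_function[OF \<delta>0] by blast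
  then obtain D\<rho> where D\<rho>: "\<And>j. test_function UNIV (\<rho> j) (D\<rho> j)" by metis
  have rn: "0 \<le> \<rho> j y" and ri: "integrable lborel (\<rho> j)" and r1: "integral\<^sup>L lborel (\<rho> j) = 1"
    and re: "\<rho> j (- y) = \<rho> j y" and rz: "\<delta> j < norm y \<Longrightarrow> \<rho> j y = 0" for j y
    unfolding \<rho>_def using mollifier_nonneg[OF \<delta>0[of j], of y] mollifier_integrable[OF \<delta>0[of j]]
      mollifier_integral[OF \<delta>0[of j]] mollifier_even[OF \<delta>0[of j], of y] mollifier_zero[OF \<delta>0[of j], of y] by auto
  interpret me: mollified_energy v w D F T c C2 C3 C4 G g g' L M \<zeta> D\<zeta> S "\<rho> j" "D\<rho> j" "\<delta> j" for j
    by unfold_locales (simp_all add: D\<rho> rn re rz r1)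
  note [measurable] = me.\<rho>_borel
  define N where "N = (\<lambda>z. norm (F z))"
  \<comment> \<open>All quantities are bundled into one vector, so that a single subsequence and a
    single majorant serve for solution, gradient, flux and the first two powers of its norm.\<close>
  define f0 where "f0 = (\<lambda>z. (w z, D z, F z, (N z)\<^sup>2, N z))"
  define f where "f = (\<lambda>z. indicator (cball 0 (S + 1)) (fst z) *\<^sub>R f0 z)"
  have fi: "integrable lborel f"
  proof -
    have "integrable lborel (\<lambda>z. indicator (cball 0 (S + 1)) (fst z) *\<^sub>R F z)"
    proof (rule Bochner_Integration.integrable_bound[OF F_integrable[of "S + 1"]])
      show "(\<lambda>z. indicator (cball 0 (S + 1)) (fst z) *\<^sub>R F z) \<in> borel_measurable lborel"
        unfolding measurable_lborel1 by measurable
    qed (auto simp: indicator_def)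
    moreover have "integrable lborel (\<lambda>z. indicator (cball 0 (S + 1)) (fst z) * (N z)\<^sup>2)"
    proof (rule Bochner_Integration.integrable_bound[OF F_L2])
      show "(\<lambda>z. indicator (cball 0 (S + 1)) (fst z) * (N z)\<^sup>2) \<in> borel_measurable lborel"
        unfolding N_def measurable_lborel1 by measurable
    qed (auto simp: indicator_def N_def)
    ultimately have "integrable lborel (\<lambda>z. (indicator (cball 0 (S + 1)) (fst z) * w z, indicator (cball 0 (S + 1)) (fst z) *\<^sub>R D z,
       indicator (cball 0 (S + 1)) (fst z) *\<^sub>R F z, indicator (cball 0 (S + 1)) (fst z) * (N z)\<^sup>2, indicator (cball 0 (S + 1)) (fst z) * N z))"
      by (intro integrable_Pair w_integrable D_integrable) (use F_integrable in \<open>auto simp: N_def\<close>)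
    then show ?thesis by (simp add: f_def f0_def)
  qed
  have bl: "bounded_linear (\<lambda>y::'a. (y, 0::real))"
    by (intro bounded_linear_Pair bounded_linear_ident bounded_linear_zero)
  define a where "a = (\<lambda>j z. LINT y|lborel. \<rho> j y *\<^sub>R f (z - (y, 0)))"
  have ai: "integrable lborel (a j)" for j
    unfolding a_def by (rule L1_averaging_integrable[OF fi bl ri rn])
  have al: "(\<lambda>j. LINT z|lborel. norm (a j z - f z)) \<longlonglongrightarrow> 0"
    unfolding a_def
    by (rule L1_averaging_converges[OF fi bl ri rn r1 _ \<delta>lim]) (use rz in \<open>auto simp: not_le[symmetric]\<close>)
  obtain r h where r: "strict_mono (r::nat \<Rightarrow> nat)" and hi: "integrable lborel (h :: 'a \<times> real \<Rightarrow> real)"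
    and lim: "AE z in lborel. (\<lambda>n. a (r n) z) \<longlonglongrightarrow> f z" and dom: "AE z in lborel. \<forall>n. norm (a (r n) z) \<le> h z"
    by (rule L1_convergent_dominated_subseq[OF ai fi al], rule that)
  define A where "A = (\<lambda>j (h :: 'a \<times> real \<Rightarrow> real) z. LINT y|lborel. \<rho> j y * h (z - (y, 0)))"
  \<comment> \<open>The vector average is read off componentwise. For |x| <= S the truncation at
    radius S + 1 is not seen, since the mollification radius is at most 1.\<close>
  have aeq: "AE z in lborel. norm (fst z) \<le> S \<longrightarrow> (\<forall>j. integrable lborel (\<lambda>y. \<rho> j y * w (z - (y, 0))) \<and>
      integrable lborel (\<lambda>y. \<rho> j y *\<^sub>R D (z - (y, 0))) \<and>
      integrable lborel (\<lambda>y. \<rho> j y *\<^sub>R F (z - (y, 0))) \<and>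
      integrable lborel (\<lambda>y. \<rho> j y * (N (z - (y, 0)))\<^sup>2) \<and>
      integrable lborel (\<lambda>y. \<rho> j y * N (z - (y, 0))) \<and>
      a j z = (A j w z, (LINT y|lborel. \<rho> j y *\<^sub>R D (z - (y, 0))), me.FA j z, A j (\<lambda>z. (N z)\<^sup>2) z, A j N z))"
  proof -
    have "AE z in lborel. \<forall>j. integrable lborel (\<lambda>y. \<rho> j y *\<^sub>R f (z - (y, 0)))"
      unfolding AE_all_countable using L1_averaging_AE[OF fi bl ri rn] by blast
    then show ?thesis
    proof eventually_elim
      case (elim z)
      show ?case
      proof (intro impI allI)
        fix j assume x: "norm (fst z) \<le> S"
        have eq: "(\<lambda>y. \<rho> j y *\<^sub>R f (z - (y, 0))) = (\<lambda>y. (\<rho> j y * w (z - (y, 0)), \<rho> j y *\<^sub>R D (z - (y, 0)),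
           \<rho> j y *\<^sub>R F (z - (y, 0)), \<rho> j y * (N (z - (y, 0)))\<^sup>2, \<rho> j y * N (z - (y, 0))))"
        proof
          fix y
          show "\<rho> j y *\<^sub>R f (z - (y, 0)) = (\<rho> j y * w (z - (y, 0)), \<rho> j y *\<^sub>R D (z - (y, 0)),
             \<rho> j y *\<^sub>R F (z - (y, 0)), \<rho> j y * (N (z - (y, 0)))\<^sup>2, \<rho> j y * N (z - (y, 0)))"
          proof (cases "\<delta> j < norm y")
            case True
            then show ?thesis by (simp add: rz zero_prod_def)
          next
            case False
            then have "norm (fst z - y) \<le> S + 1" using x \<delta>1[of j] norm_triangle_ineq4[of "fst z" y] by linarith
            then show ?thesis by (simp add: f_def f0_def)
          qed
        qed
        have i0: "integrable lborel (\<lambda>y. (\<rho> j y * w (z - (y, 0)), \<rho> j y *\<^sub>R D (z - (y, 0)),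
           \<rho> j y *\<^sub>R F (z - (y, 0)), \<rho> j y * (N (z - (y, 0)))\<^sup>2, \<rho> j y * N (z - (y, 0))))"
          using elim[rule_format, of j] unfolding eq .
        note p1 = integral_Pair[OF i0]
        note p2 = integral_Pair[OF p1(2)]
        note p3 = integral_Pair[OF p2(2)]
        note p4 = integral_Pair[OF p3(2)]
        have "a j z = (A j w z, (LINT y|lborel. \<rho> j y *\<^sub>R D (z - (y, 0))), me.FA j z, A j (\<lambda>z. (N z)\<^sup>2) z, A j N z)"
          unfolding a_def eq p1(3) p2(3) p3(3) p4(3) by (simp add: A_def me.FA_def)
        with p1 p2 p3 p4 show "integrable lborel (\<lambda>y. \<rho> j y * w (z - (y, 0))) \<and>
          integrable lborel (\<lambda>y. \<rho> j y *\<^sub>R D (z - (y, 0))) \<and>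
          integrable lborel (\<lambda>y. \<rho> j y *\<^sub>R F (z - (y, 0))) \<and>
          integrable lborel (\<lambda>y. \<rho> j y * (N (z - (y, 0)))\<^sup>2) \<and>
          integrable lborel (\<lambda>y. \<rho> j y * N (z - (y, 0))) \<and>
          a j z = (A j w z, (LINT y|lborel. \<rho> j y *\<^sub>R D (z - (y, 0))), me.FA j z, A j (\<lambda>z. (N z)\<^sup>2) z, A j N z)"
          by blast
      qed
    qed
  qed
  have Weq: "AE z in lborel. \<forall>j. snd z \<in> {0<..<T} \<longrightarrow> me.W j z = A j w z"
    unfolding AE_all_countable
  proof
    fix j
    have "AE t in lborel. t \<in> {0<..<T} \<longrightarrow> (\<forall>x. conv (v t) (\<rho> j) x = (LINT y|lborel. w (y, t) *\<^sub>R \<rho> j (x - y)))"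
      by (rule w_conv_slice[OF me.\<rho>_cont me.\<rho>_zero])
    from AE_lborel_snd[OF this, where 'a = 'a]
    show "AE z in lborel. snd z \<in> {0<..<T} \<longrightarrow> me.W j z = A j w z"
    proof eventually_elim
      case (elim z)
      show ?case
      proof
        assume "snd z \<in> {0<..<T}"
        then have "me.W j z = (LINT y|lborel. w (y, snd z) *\<^sub>R \<rho> j (fst z - y))" using elim by (simp add: me.W_def)
        also have "\<dots> = (LINT y|lborel. (\<lambda>y. w (y, snd z) *\<^sub>R \<rho> j (fst z - y)) (fst z - y))"
          by (rule lborel_integral_reflect[symmetric]) measurable
        also have "\<dots> = A j w z"
          unfolding A_def by (rule Bochner_Integration.integral_cong) (cases z; auto)+
        finally show "me.W j z = A j w z" .
      qed
    qed
  qed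
  have Veq: "AE z in lborel. \<forall>j. snd z \<in> {0<..<T} \<longrightarrow> me.V j z = (LINT y|lborel. \<rho> j y *\<^sub>R D (z - (y, 0)))"
    unfolding AE_all_countable me.V_def using sgrad_slice[OF D\<rho>] by blast
  \<comment> \<open>The bound on the gradient is needed along the whole averaging fibre through
    almost every \<open>z\<close>, hence the slicing in time followed by a reflection in
    space.\<close>
  have Dle: "AE z in lborel. AE y in lborel. norm (D (z - (y, 0))) \<le> (N (z - (y, 0)) + C2 * w (z - (y, 0))) / c"
  proof -
    have "AE z in (lborel :: ('a \<times> real) measure). (AE x in lborel. norm (D (x, snd z)) \<le> (N (x, snd z) + C2 * w (x, snd z)) / c)"
      by (rule AE_lborel_snd[OF AE_lborel_slice]) (use D_bound in \<open>simp add: N_def\<close>)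
    then show ?thesis
    proof eventually_elim
      case (elim z)
      from AE_lborel_reflect[OF this, of "fst z"] show ?case by eventually_elim (cases z; simp)
    qed
  qed
  \<comment> \<open>\<open>\<Psi>T\<close> lives on the closed time interval and
    \<open>energy_density\<close> on the open one; the two end slices are null.\<close>
  have endpoints: "AE z in (lborel :: ('a \<times> real) measure). snd z \<noteq> 0 \<and> snd z \<noteq> T"
    by (rule AE_lborel_snd) (intro AE_conjI AE_lborel_singleton)
  obtain B where B: "B > 0" "\<And>x. norm (D\<zeta> x) \<le> B"
    using continuous_compact_support_bounded[OF D\<zeta>_cont D\<zeta>_zero] by blast
  \<comment> \<open>These are the coefficients of n and n^2 in the bound below; n <= 1 + n^2 brings
    all of them to the form 1 + n^2.\<close>
  define K where "K = M * B + C2 / c + L / c"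
  have L0: "0 \<le> L" using g'_nonneg[of 0] g'_le[of 0] by simp
  have K0: "0 \<le> K" using M_nonneg B(1) C2_ge c_pos L0 by (simp add: K_def)
  have bound: "AE z in lborel. norm (fst z) \<le> S \<longrightarrow> snd z \<in> {0<..<T} \<longrightarrow>
     (\<forall>j. norm (me.FA j z \<bullet> me.\<Psi>T j z) \<le> K * (1 + norm (a j z)))"
    using aeq Weq Veq Dle
  proof eventually_elim
    case (elim z)
    show ?case
    proof (intro impI allI)
      fix j assume x: "norm (fst z) \<le> S" and t: "snd z \<in> {0<..<T}"
      have t': "snd z \<in> {0..T}" using t by auto
      from elim(1) x have iw: "integrable lborel (\<lambda>y. \<rho> j y * w (z - (y, 0)))"
        and iD: "integrable lborel (\<lambda>y. \<rho> j y *\<^sub>R D (z - (y, 0)))"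
        and iN2: "integrable lborel (\<lambda>y. \<rho> j y * (N (z - (y, 0)))\<^sup>2)"
        and iN: "integrable lborel (\<lambda>y. \<rho> j y * N (z - (y, 0)))"
        and aj: "a j z = (A j w z, (LINT y|lborel. \<rho> j y *\<^sub>R D (z - (y, 0))), me.FA j z, A j (\<lambda>z. (N z)\<^sup>2) z, A j N z)"
        by blast+
      define n where "n = A j N z"
      have n0: "0 \<le> n" unfolding n_def A_def N_def using rn by (intro integral_nonneg_AE AE_I2) auto
      have n2: "n\<^sup>2 \<le> A j (\<lambda>z. (N z)\<^sup>2) z" unfolding n_def A_def
        by (rule average_square_le[OF ri rn r1 iN iN2])
      have n2': "n\<^sup>2 \<le> norm (a j z)"
      proof -
        have "A j (\<lambda>z. (N z)\<^sup>2) z \<le> norm (A j (\<lambda>z. (N z)\<^sup>2) z, A j N z)"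
          using norm_fst_le[of "A j (\<lambda>z. (N z)\<^sup>2) z" "A j N z"] by simp
        also have "\<dots> \<le> norm (me.FA j z, A j (\<lambda>z. (N z)\<^sup>2) z, A j N z)" by (rule norm_snd_le)
        also have "\<dots> \<le> norm ((LINT y|lborel. \<rho> j y *\<^sub>R D (z - (y, 0))), me.FA j z, A j (\<lambda>z. (N z)\<^sup>2) z, A j N z)" by (rule norm_snd_le)
        also have "\<dots> \<le> norm (a j z)" unfolding aj by (rule norm_snd_le)
        finally show ?thesis using n2 by linarith
      qed
      have FA: "norm (me.FA j z) \<le> n" unfolding me.FA_def n_def A_def
        by (rule order_trans[OF integral_norm_bound]) (simp add: N_def rn)
      have W: "me.W j z = A j w z" and V: "me.V j z = (LINT y|lborel. \<rho> j y *\<^sub>R D (z - (y, 0)))"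
        using elim(2,3) t by auto
      have W0: "0 \<le> me.W j z" by (rule me.W_nonneg[OF t'])
      have Vle: "norm (me.V j z) \<le> (n + C2 * me.W j z) / c"
      proof -
        have "norm (me.V j z) \<le> (LINT y|lborel. norm (\<rho> j y *\<^sub>R D (z - (y, 0))))" unfolding V by (rule integral_norm_bound)
        also have "\<dots> \<le> (LINT y|lborel. (\<rho> j y * N (z - (y, 0)) + C2 * (\<rho> j y * w (z - (y, 0)))) / c)"
        proof (rule integral_mono_AE)
          show "AE y in lborel. norm (\<rho> j y *\<^sub>R D (z - (y, 0))) \<le> (\<rho> j y * N (z - (y, 0)) + C2 * (\<rho> j y * w (z - (y, 0)))) / c"
            using elim(4)
          proof eventually_elim
            case (elim y)
            have "norm (\<rho> j y *\<^sub>R D (z - (y, 0))) \<le> \<rho> j y * ((N (z - (y, 0)) + C2 * w (z - (y, 0))) / c)"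
              using mult_left_mono[OF elim rn[of j y]] rn[of j y] by simp
            also have "\<dots> = (\<rho> j y * N (z - (y, 0)) + C2 * (\<rho> j y * w (z - (y, 0)))) / c"
              by (simp add: algebra_simps)
            finally show ?case .
          qed
        qed (intro integrable_norm iD integrable_divide Bochner_Integration.integrable_add integrable_mult_right iN iw)+
        also have "\<dots> = (n + C2 * me.W j z) / c"
          using iN iw unfolding W n_def A_def by simp
        finally show ?thesis .
      qed
      have g'W: "0 \<le> g' (me.W j z)" "g' (me.W j z) \<le> L" "me.W j z * g' (me.W j z) \<le> 1"
        using g'_nonneg g'_le g'_decay W0 by auto
      have "norm (me.\<Psi> j z) \<le> g (me.W j z) * norm (D\<zeta> (fst z)) + \<zeta> (fst z) * g' (me.W j z) * norm (me.V j z)"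
        unfolding me.\<Psi>_def
        by (rule order_trans[OF norm_triangle_ineq]) (simp add: abs_mult g_nonneg W0 g'W(1) \<zeta>_nonneg)
      also have "\<dots> \<le> M * B + 1 * g' (me.W j z) * ((n + C2 * me.W j z) / c)"
        using Vle B \<zeta>_le \<zeta>_nonneg g_le[OF W0] g_nonneg[OF W0] g'W M_nonneg
        by (intro add_mono mult_mono) auto
      also have "\<dots> = M * B + (g' (me.W j z) * n + C2 * (me.W j z * g' (me.W j z))) / c"
        by (simp add: algebra_simps)
      also have "\<dots> \<le> M * B + (L * n + C2 * 1) / c"
        using g'W n0 C2_ge c_pos by (intro add_left_mono divide_right_mono add_mono mult_right_mono mult_left_mono) auto
      finally have \<Psi>: "norm (me.\<Psi> j z) \<le> M * B + (L * n + C2) / c" by simp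
      have "norm (me.FA j z \<bullet> me.\<Psi>T j z) \<le> norm (me.FA j z) * norm (me.\<Psi>T j z)"
        unfolding real_norm_def by (rule Cauchy_Schwarz_ineq2)
      also have "\<dots> \<le> n * (M * B + (L * n + C2) / c)"
      proof -
        have "me.\<Psi>T j z = me.\<Psi> j z" using t' by (cases z) (simp add: me.\<Psi>T_def)
        then show ?thesis using FA \<Psi> n0 by (intro mult_mono) auto
      qed
      also have "\<dots> = (M * B + C2 / c) * n + (L / c) * n\<^sup>2"
        by (simp add: power2_eq_square algebra_simps add_divide_distrib)
      also have "\<dots> \<le> (M * B + C2 / c) * (1 + n\<^sup>2) + (L / c) * (1 + n\<^sup>2)"
        using linear_le_quadratic[of n] M_nonneg B(1) C2_ge c_pos L0 by (intro add_mono mult_left_mono) auto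
      also have "\<dots> = K * (1 + n\<^sup>2)" by (simp add: K_def algebra_simps)
      also have "\<dots> \<le> K * (1 + norm (a j z))" using n2' K0 by (intro mult_left_mono) auto
      finally show "norm (me.FA j z \<bullet> me.\<Psi>T j z) \<le> K * (1 + norm (a j z))" .
    qed
  qed
  have out: "me.\<Psi>T j z = 0" "energy_density z = 0" if "\<not> (norm (fst z) \<le> S \<and> snd z \<in> {0<..<T})" "snd z \<noteq> 0 \<and> snd z \<noteq> T" for j z
  proof -
    have "S < norm (fst z) \<or> snd z \<notin> {0..T}" using that by auto
    then show "me.\<Psi>T j z = 0" using me.\<Psi>_zero[of z j] by (cases z) (auto simp: me.\<Psi>T_def)
    have "S < norm (fst z) \<or> snd z \<notin> {0<..<T}" using that by auto
    then show "energy_density z = 0"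
      using outside[of z] \<zeta>_zero[of "fst z"] D\<zeta>_zero[of "fst z"] unfolding energy_density_def by auto
  qed
  define H where "H = (\<lambda>z. K * indicator (cball 0 S \<times> {0<..<T}) z + K * h z)"
  have Hi: "integrable lborel H" unfolding H_def
    using slab_finite[of S] hi by (intro Bochner_Integration.integrable_add integrable_mult_right integrable_real_indicator)
      (auto intro!: borel_Times)
  have mX: "(\<lambda>z. me.FA j z \<bullet> me.\<Psi>T j z) \<in> borel_measurable borel" for j
    unfolding me.FA_def by measurable
  have conv_AE: "AE z in lborel. (\<lambda>n. me.FA (r n) z \<bullet> me.\<Psi>T (r n) z) \<longlonglongrightarrow> energy_density z"
    using aeq Weq Veq lim endpoints
  proof eventually_elim
    case (elim z)
    show ?case
    proof (cases "norm (fst z) \<le> S \<and> snd z \<in> {0<..<T}")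
      case False
      then show ?thesis using elim(5) by (simp add: out)
    next
      case True
      then have t': "snd z \<in> {0..T}" by auto
      have aj: "a j z = (me.W j z, me.V j z, me.FA j z, A j (\<lambda>z. (N z)\<^sup>2) z, A j N z)" for j
        using elim(1-3) True by auto
      have fz: "f z = (w z, D z, F z, (N z)\<^sup>2, N z)" using True by (simp add: f_def f0_def)
      have l: "(\<lambda>n. a (r n) z) \<longlonglongrightarrow> f z" by (rule elim(4))
      have lW: "(\<lambda>n. me.W (r n) z) \<longlonglongrightarrow> w z" using tendsto_fst[OF l] unfolding aj fz by simp
      have lV: "(\<lambda>n. me.V (r n) z) \<longlonglongrightarrow> D z" using tendsto_fst[OF tendsto_snd[OF l]] unfolding aj fz by simp
      have lF: "(\<lambda>n. me.FA (r n) z) \<longlonglongrightarrow> F z" using tendsto_fst[OF tendsto_snd[OF tendsto_snd[OF l]]] unfolding aj fz by simp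
      have lg: "(\<lambda>n. g (me.W (r n) z)) \<longlonglongrightarrow> g (w z)"
        by (rule continuous_on_tendsto_compose[OF cont_g lW]) (auto simp: w_nonneg intro!: always_eventually me.W_nonneg t')
      have lg': "(\<lambda>n. g' (me.W (r n) z)) \<longlonglongrightarrow> g' (w z)"
        by (rule continuous_on_tendsto_compose[OF g'_cont lW]) (auto simp: w_nonneg intro!: always_eventually me.W_nonneg t')
      have "me.\<Psi>T j z = me.\<Psi> j z" for j using t' by (cases z) (simp add: me.\<Psi>T_def)
      then show ?thesis unfolding energy_density_def me.\<Psi>_def
        by (simp only:) (intro tendsto_intros lW lV lF lg lg')
    qed
  qed
  have dom_AE: "AE z in lborel. norm (me.FA (r n) z \<bullet> me.\<Psi>T (r n) z) \<le> H z" for n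
    using bound dom endpoints
  proof eventually_elim
    case (elim z)
    have h0: "0 \<le> h z" using elim(2) norm_ge_zero order_trans by blast
    show ?case
    proof (cases "norm (fst z) \<le> S \<and> snd z \<in> {0<..<T}")
      case False
      then show ?thesis using elim(3) h0 K0 by (simp add: out H_def)
    next
      case True
      then have "norm (me.FA (r n) z \<bullet> me.\<Psi>T (r n) z) \<le> K * (1 + norm (a (r n) z))" using elim(1) by blast
      also have "\<dots> \<le> K * (1 + h z)" using elim(2) K0 by (intro mult_left_mono) auto
      also have "\<dots> = H z" using True by (cases z) (simp add: H_def algebra_simps)
      finally show ?thesis .
    qed
  qed
  have mE: "energy_density \<in> borel_measurable borel"
  proof -
    have [measurable]: "(\<lambda>s. indicator {0..} s *\<^sub>R g s) \<in> borel_measurable borel" "(\<lambda>s. indicator {0..} s *\<^sub>R g' s) \<in> borel_measurable borel"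
      by (rule borel_measurable_continuous_on_indicator[OF _ cont_g] borel_measurable_continuous_on_indicator[OF _ g'_cont]; simp)+
    have [measurable]: "\<zeta> \<in> borel_measurable borel" "D\<zeta> \<in> borel_measurable borel"
      by (rule borel_measurable_continuous_onI \<zeta>_cont D\<zeta>_cont)+
    have "energy_density = (\<lambda>z. F z \<bullet> ((indicator {0..} (w z) *\<^sub>R g (w z)) *\<^sub>R D\<zeta> (fst z) +
        (\<zeta> (fst z) * (indicator {0..} (w z) *\<^sub>R g' (w z))) *\<^sub>R D z))"
      using w_nonneg by (auto simp: energy_density_def)
    also have "\<dots> \<in> borel_measurable borel" by measurable
    finally show ?thesis .
  qed
  have *: "integrable lborel energy_density"
    "(\<lambda>n. LINT z|lborel. me.FA (r n) z \<bullet> me.\<Psi>T (r n) z) \<longlonglongrightarrow> integral\<^sup>L lborel energy_density"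
    using integrable_dominated_convergence[of energy_density lborel "\<lambda>n z. me.FA (r n) z \<bullet> me.\<Psi>T (r n) z" H]
      integral_dominated_convergence[of energy_density lborel "\<lambda>n z. me.FA (r n) z \<bullet> me.\<Psi>T (r n) z" H]
      mE mX Hi conv_AE dom_AE by simp_all
  show "integrable lborel energy_density" by (rule *(1))
  show "integral\<^sup>L lborel energy_density \<le> M * integral\<^sup>L lborel (v 0)"
    by (rule LIMSEQ_le_const2[OF *(2)]) (use me.energy_mollified[OF v0] in blast)
qed

end

section \<open>Decay of the flux and conservation of mass\<close>

text \<open>For large R the factor k / sqrt R falls below any prescribed q. After j iterations the
  remainder is q^j \<sigma>(4^j R) <= |C| R^n (4^n q)^j, and q is chosen so that this tends to
  0.\<close>

lemma recursive_growth_bounded: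
  fixes \<sigma> :: "real \<Rightarrow> real"
  assumes rec: "\<And>R. 1 \<le> R \<Longrightarrow> \<sigma> R \<le> K + k / sqrt R * \<sigma> (4 * R)"
    and growth: "\<And>R. 1 \<le> R \<Longrightarrow> \<sigma> R \<le> C * R ^ n"
    and nonneg: "\<And>R. 1 \<le> R \<Longrightarrow> 0 \<le> \<sigma> R" and k: "0 \<le> k"
  obtains R0 where "1 \<le> R0" "\<And>R. R0 \<le> R \<Longrightarrow> \<sigma> R \<le> 2 * \<bar>K\<bar>"
proof -
  \<comment> \<open>The choice makes 4^n q = 1/2, so that the contraction outweighs the polynomial
    growth along R, 4R, 16R, and so on.\<close>
  define q :: real where "q = 1 / (2 * 4 ^ n)"
  have q: "0 < q" "q \<le> 1/2" by (auto simp: q_def divide_simps)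
  define R0 where "R0 = max 1 ((k / q)\<^sup>2)"
  have R01: "1 \<le> R0" by (simp add: R0_def)
  have kq: "k / sqrt R \<le> q" if "R0 \<le> R" for R
  proof -
    have "(k / q)\<^sup>2 \<le> R" and R: "1 \<le> R" using that by (auto simp: R0_def)
    then have "k / q \<le> sqrt R" by (intro real_le_rsqrt) auto
    then show ?thesis using q R by (simp add: field_simps)
  qed
  \<comment> \<open>The coefficient 2 - 2 q^j absorbs the geometric sum: adding q^j gives 2 - q^j,
    which is at most 2 - 2 q^(j+1) because q <= 1/2.\<close>
  have step: "\<sigma> R \<le> (2 - 2 * q ^ j) * \<bar>K\<bar> + q ^ j * \<sigma> (4 ^ j * R)" if R: "R0 \<le> R" for R j
  proof (induction j)
    case (Suc j)
    have R1: "1 \<le> R" using R R01 by simp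
    have ge: "1 * R \<le> 4 ^ j * R" using R1 by (intro mult_right_mono) auto
    then have j1: "1 \<le> 4 ^ j * R" "R0 \<le> 4 ^ j * R" "1 \<le> 4 * (4 ^ j * R)" using R R1 by linarith+
    have "\<sigma> (4 ^ j * R) \<le> K + k / sqrt (4 ^ j * R) * \<sigma> (4 * (4 ^ j * R))" by (rule rec[OF j1(1)])
    also have "\<dots> \<le> \<bar>K\<bar> + q * \<sigma> (4 * (4 ^ j * R))"
      using kq[OF j1(2)] nonneg[OF j1(3)] by (intro add_mono mult_right_mono) auto
    finally have "q ^ j * \<sigma> (4 ^ j * R) \<le> q ^ j * (\<bar>K\<bar> + q * \<sigma> (4 * (4 ^ j * R)))"
      using q by (intro mult_left_mono) auto
    also have "\<dots> = q ^ j * \<bar>K\<bar> + q ^ Suc j * \<sigma> (4 ^ Suc j * R)" by (simp add: algebra_simps)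
    finally have "\<sigma> R \<le> (2 - q ^ j) * \<bar>K\<bar> + q ^ Suc j * \<sigma> (4 ^ Suc j * R)"
      using Suc.IH by (simp add: algebra_simps)
    also have "(2 - q ^ j) * \<bar>K\<bar> \<le> (2 - 2 * q ^ Suc j) * \<bar>K\<bar>"
    proof -
      have "2 * q * q ^ j \<le> 1 * q ^ j" using q by (intro mult_right_mono) auto
      then show ?thesis by (intro mult_right_mono) auto
    qed
    finally show ?case by simp
  qed simp
  show ?thesis
  proof (rule that[OF R01])
    fix R assume R: "R0 \<le> R"
    then have R1: "1 \<le> R" using R01 by simp
    have "\<sigma> R \<le> 2 * \<bar>K\<bar> + (\<bar>C\<bar> * R ^ n) * (1/2) ^ j" for j
    proof -
      have ge: "1 * R \<le> 4 ^ j * R" using R1 by (intro mult_right_mono) auto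
      have "q ^ j * \<sigma> (4 ^ j * R) \<le> q ^ j * (\<bar>C\<bar> * (4 ^ j * R) ^ n)"
      proof (intro mult_left_mono)
        have "\<sigma> (4 ^ j * R) \<le> C * (4 ^ j * R) ^ n" using growth[of "4 ^ j * R"] ge R1 by simp
        also have "\<dots> \<le> \<bar>C\<bar> * (4 ^ j * R) ^ n" using R1 by (intro mult_right_mono) auto
        finally show "\<sigma> (4 ^ j * R) \<le> \<bar>C\<bar> * (4 ^ j * R) ^ n" .
      qed (use q in auto)
      also have "\<dots> = (\<bar>C\<bar> * R ^ n) * (q * 4 ^ n) ^ j"
      proof -
        have "((4::real) ^ j) ^ n = (4 ^ n) ^ j" by (metis power_mult mult.commute)
        then show ?thesis by (simp add: power_mult_distrib)
      qed
      also have "q * 4 ^ n = 1/2" by (simp add: q_def)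
      finally have "q ^ j * \<sigma> (4 ^ j * R) \<le> (\<bar>C\<bar> * R ^ n) * (1/2) ^ j" .
      moreover have "(2 - 2 * q ^ j) * \<bar>K\<bar> \<le> 2 * \<bar>K\<bar>" using q by (intro mult_right_mono) auto
      ultimately show ?thesis using step[OF R, of j] by linarith
    qed
    moreover have "(\<lambda>j. 2 * \<bar>K\<bar> + (\<bar>C\<bar> * R ^ n) * (1/2) ^ j) \<longlonglongrightarrow> 2 * \<bar>K\<bar> + (\<bar>C\<bar> * R ^ n) * 0"
      by (intro tendsto_intros LIMSEQ_realpow_zero) auto
    ultimately show "\<sigma> R \<le> 2 * \<bar>K\<bar>" using LIMSEQ_le_const[of _ _ "\<sigma> R"] by auto
  qed
qed

lemma bump_mono:
  assumes "0 < R" "R \<le> S"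
  shows "bump R x \<le> bump S x"
proof -
  have "norm x / S \<le> norm x / R" using assms by (intro divide_left_mono) auto
  then have "(norm x / S)\<^sup>2 \<le> (norm x / R)\<^sup>2" using assms by (intro power_mono) auto
  then show ?thesis unfolding bump_def by (intro power_mono max.mono) auto
qed

lemma bump_tendsto_1: "((\<lambda>k::nat. bump (real (Suc k)) x) \<longlonglongrightarrow> 1)"
proof -
  have "(\<lambda>k. norm x / real (Suc k)) \<longlonglongrightarrow> 0"
    by (rule LIMSEQ_Suc) (rule lim_const_over_n)
  then have "(\<lambda>k. (max 0 (1 - (norm x / real (Suc k))\<^sup>2))\<^sup>2) \<longlonglongrightarrow> (max 0 (1 - 0\<^sup>2))\<^sup>2"
    by (intro tendsto_intros)
  then show ?thesis by (simp add: bump_def)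
qed

section \<open>Mass and flux over balls\<close>

context parabolic_flow
begin

text \<open>The integrals run over the whole time interval: \<open>w\<close> and \<open>F\<close>
  vanish for times outside (0,T).\<close>

definition mass :: "real \<Rightarrow> real" where "mass R = (LINT z|lborel. indicator (cball 0 R) (fst z) * w z)"
definition fluxmass :: "real \<Rightarrow> real" where "fluxmass R = (LINT z|lborel. indicator (cball 0 R) (fst z) * norm (F z))"

lemma mass_nonneg: "0 \<le> mass R" and fluxmass_nonneg: "0 \<le> fluxmass R"
  unfolding mass_def fluxmass_def using w_nonneg by (intro integral_nonneg_AE AE_I2; simp)+

lemma fluxmass_mono: "R \<le> S \<Longrightarrow> fluxmass R \<le> fluxmass S"
  unfolding fluxmass_def by (intro integral_mono F_integrable) (auto simp: indicator_def)

lemma bump_mass_change: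
  assumes R: "0 < R" and t: "t \<in> {0..T}"
  shows "\<bar>(LINT x|lborel. v t x * bump R x) - (LINT x|lborel. v 0 x * bump R x)\<bar> \<le> 4 / R * fluxmass R"
proof -
  have "(LINT x|lborel. v t x * bump R x) - (LINT x|lborel. v 0 x * bump R x) =
      - (LINT z|lborel. indicator {0<..t} (snd z) * (F z \<bullet> bump_grad R (fst z)))"
    using t by (intro flux bump_test_function R) auto
  then have "\<bar>(LINT x|lborel. v t x * bump R x) - (LINT x|lborel. v 0 x * bump R x)\<bar> =
      \<bar>LINT z|lborel. indicator {0<..t} (snd z) * (F z \<bullet> bump_grad R (fst z))\<bar>" by simp
  also have "\<dots> \<le> (LINT z|lborel. \<bar>indicator {0<..t} (snd z) * (F z \<bullet> bump_grad R (fst z))\<bar>)"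
    by (rule integral_abs_bound)
  also have "\<dots> \<le> (LINT z|lborel. 4 / R * (indicator (cball 0 R) (fst z) * norm (F z)))"
  proof (rule integral_mono')
    show "integrable lborel (\<lambda>z. 4 / R * (indicator (cball 0 R) (fst z) * norm (F z)))"
      by (intro integrable_mult_right F_integrable)
    fix z
    show "0 \<le> 4 / R * (indicator (cball 0 R) (fst z) * norm (F z))" using R by simp
    show "\<bar>indicator {0<..t} (snd z) * (F z \<bullet> bump_grad R (fst z))\<bar> \<le> 4 / R * (indicator (cball 0 R) (fst z) * norm (F z))"
    proof (cases "norm (fst z) \<le> R")
      case True
      have "\<bar>F z \<bullet> bump_grad R (fst z)\<bar> \<le> norm (F z) * norm (bump_grad R (fst z))" by (rule Cauchy_Schwarz_ineq2)
      also have "\<dots> \<le> norm (F z) * (4 / R)" by (intro mult_left_mono bump_grad_le R) auto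
      finally show ?thesis using True R by (auto simp: indicator_def mult.commute)
    next
      case False
      then show ?thesis using R by (simp add: bump_grad_zero)
    qed
  qed
  also have "\<dots> = 4 / R * fluxmass R" by (simp add: fluxmass_def)
  finally show ?thesis .
qed

lemma bump_integrable_v:
  assumes R: "0 < R" and t: "t \<in> {0..T}"
  shows "integrable lborel (\<lambda>x. v t x * bump R x)"
proof -
  have "integrable lborel (\<lambda>x. v t x *\<^sub>R bump R x)"
  proof (rule locally_integrable_mult(1)[OF v_loc[OF t]])
    show "bump R \<in> borel_measurable (borel :: 'a measure)"
      by (rule borel_measurable_continuous_onI[OF bump_continuous[OF R]])
    show "bump R x = 0" if "R < norm x" for x :: 'a using that by (intro bump_zero R) simp
    show "norm (bump R x) \<le> 1" for x :: 'a by (simp add: bump_nonneg bump_le_1)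
  qed
  then show ?thesis by simp
qed

text \<open>At each time the mass in the ball is compared with the cutoff of radius 2R, whose mass
  differs from the initial one by the flux term; integration in time gives the factor T, and 2 / R
  is 4 / (2R).\<close>

lemma mass_le:
  assumes v0: "integrable lborel (v 0)" and R: "0 < R"
  shows "mass R \<le> 16 / 9 * T * (integral\<^sup>L lborel (v 0) + 2 / R * fluxmass (2 * R))"
proof -
  define C where "C = 16 / 9 * (integral\<^sup>L lborel (v 0) + 2 / R * fluxmass (2 * R))"
  have slice: "(LINT x|lborel. indicator (cball 0 R) x * v t x) \<le> C" if t: "t \<in> {0..T}" for t
  proof -
    have "(LINT x|lborel. indicator (cball 0 R) x * v t x) \<le> (LINT x|lborel. 16 / 9 * (v t x * bump (2 * R) x))"
    proof (rule integral_mono)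
      show "integrable lborel (\<lambda>x. indicator (cball 0 R) x * v t x)" using v_loc[OF t] by (simp add: locally_integrable_def)
      show "integrable lborel (\<lambda>x. 16 / 9 * (v t x * bump (2 * R) x))"
        using R t by (intro integrable_mult_right bump_integrable_v) auto
      show "indicator (cball 0 R) x * v t x \<le> 16 / 9 * (v t x * bump (2 * R) x)" for x
      proof (cases "norm x \<le> R")
        case True
        then have "9 / 16 \<le> bump (2 * R) x" using R by (intro bump_ge) auto
        then show ?thesis using True mult_left_mono[OF _ v_nonneg[OF t, of x], of "9/16" "bump (2 * R) x"] by simp
      next
        case False
        then show ?thesis using v_nonneg[OF t, of x] bump_nonneg[of "2 * R" x] by simp
      qed
    qed
    also have "\<dots> = 16 / 9 * (LINT x|lborel. v t x * bump (2 * R) x)" by simp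
    also have "(LINT x|lborel. v t x * bump (2 * R) x) \<le> (LINT x|lborel. v 0 x * bump (2 * R) x) + 4 / (2 * R) * fluxmass (2 * R)"
      using bump_mass_change[of "2 * R" t] R t by (simp add: abs_le_iff)
    also have "(LINT x|lborel. v 0 x * bump (2 * R) x) \<le> integral\<^sup>L lborel (v 0)"
      using v0 T_pos mult_left_mono[OF bump_le_1 v_nonneg[of 0]] v_nonneg[of 0] by (intro integral_mono') auto
    finally show ?thesis by (simp add: C_def)
  qed
  have i: "integrable (lborel \<Otimes>\<^sub>M lborel) (\<lambda>(x, t). indicator (cball 0 R) x * w (x, t))"
    using w_integrable[of R] by (simp add: lborel_prod case_prod_unfold)
  have "mass R = (LINT t|lborel. (LINT x|lborel. indicator (cball 0 R) x * w (x, t)))"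
    using lborel_pair.integral_snd[OF i] by (simp add: mass_def lborel_prod case_prod_unfold)
  also have "\<dots> \<le> (LINT t|lborel. C * indicator {0<..<T} t)"
  proof (rule integral_mono_AE[OF lborel_pair.integrable_snd[OF i]])
    have "emeasure lborel {0<..<T} < \<infinity>" by (subst emeasure_lborel_Ioo) (use T_pos in auto)
    then show "integrable lborel (\<lambda>t. C * indicator {0<..<T} t :: real)"
      by (intro integrable_mult_right integrable_real_indicator) auto
    show "AE t in lborel. (LINT x|lborel. indicator (cball 0 R) x * w (x, t)) \<le> C * indicator {0<..<T} t"
      using w_slice
    proof eventually_elim
      case (elim t)
      show ?case
      proof (cases "t \<in> {0<..<T}")
        case True
        then have t: "t \<in> {0..T}" by auto
        note [measurable] = locally_integrable_borel[OF v_loc[OF t]]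
        have "(LINT x|lborel. indicator (cball 0 R) x * w (x, t)) = (LINT x|lborel. indicator (cball 0 R) x * v t x)"
          by (rule integral_cong_AE) (use elim True in \<open>auto elim: eventually_mono\<close>)
        then show ?thesis using slice[OF t] True by simp
      next
        case False
        then show ?thesis by (simp add: outside)
      qed
    qed
  qed
  also have "\<dots> = C * T" using T_pos by simp
  finally show ?thesis by (simp add: C_def mult_ac)
qed

lemma slab_measure:
  assumes "0 \<le> R"
  shows "measure lborel (cball (0::'a) R \<times> {0<..<T}) = unit_ball_vol DIM('a) * R ^ DIM('a) * T"
  using content_cball[OF assms, of "0::'a"] T_pos
  by (simp add: measure_def lborel_prod[symmetric] lborel.emeasure_pair_measure_Times enn2real_mult)

text \<open>The crude bound |F| <= |F|^2 + 1 on the slab. It provides the a priori polynomial growth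
  without which the recursion could not be closed.\<close>

lemma fluxmass_growth:
  assumes R: "0 \<le> R"
  shows "fluxmass R \<le> (LINT z|lborel. (norm (F z))\<^sup>2) + unit_ball_vol DIM('a) * R ^ DIM('a) * T"
proof -
  have si: "integrable lborel (\<lambda>z. indicator (cball (0::'a) R \<times> {0<..<T}) z :: real)"
    using slab_finite[of R] by (intro integrable_real_indicator) (auto intro!: borel_Times)
  have "fluxmass R \<le> (LINT z|lborel. (norm (F z))\<^sup>2 + indicator (cball 0 R \<times> {0<..<T}) z)"
    unfolding fluxmass_def
  proof (rule integral_mono[OF F_integrable])
    show "integrable lborel (\<lambda>z. (norm (F z))\<^sup>2 + indicator (cball 0 R \<times> {0<..<T}) z)" using F_L2 si by simp
    fix z
    show "indicator (cball 0 R) (fst z) * norm (F z) \<le> (norm (F z))\<^sup>2 + indicator (cball 0 R \<times> {0<..<T}) z"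
      using F_support[of z] linear_le_quadratic[of "norm (F z)"]
      by (cases "F z = 0"; cases "norm (fst z) \<le> R"; cases z) (auto simp: indicator_def)
  qed
  also have "\<dots> = (LINT z|lborel. (norm (F z))\<^sup>2) + measure lborel (cball (0::'a) R \<times> {0<..<T})"
    using F_L2 si by simp
  finally show ?thesis using slab_measure[OF R] by simp
qed

text \<open>For small values of the solution, Young's inequality gives |D| <= \<mu> g' |D|^2 + 1 /
  (4 \<mu> g'), and 1 / (4 g') is at most s + 1/L there. Coercivity multiplied by g' replaces g'
  |D|^2 by g' F . D plus a multiple of s. The weight \<mu> stays free, to be chosen in terms of the
  radius.\<close>

lemma flux_pointwise:
  assumes L: "2 \<le> L" and \<mu>: "0 < \<mu>"
  defines "g' \<equiv> \<lambda>s. (L - 1) / ((1 + L * s) * (1 + s))" and "b \<equiv> C3 * \<mu> / c"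
  shows "AE z in lborel. norm (F z) \<le> (norm (F z))\<^sup>2 + (1 + C4 + C3 / \<mu> + b * C2) * w z
    + b * (g' (w z) * (F z \<bullet> D z)) + C3 / (\<mu> * L)"
  using coercive
proof eventually_elim
  case (elim z)
  interpret entropy "\<lambda>s. (1 + L * s) * ln (1 + L * s) / L - (1 + s) * ln (1 + s)"
    "\<lambda>s. ln (1 + L * s) - ln (1 + s)" g' L "ln L"
    unfolding g'_def by (rule log_entropy[OF L])
  define s p where "s = w z" and "p = norm (D z)"
  have s0: "0 \<le> s" by (simp add: s_def w_nonneg)
  have p0: "0 \<le> p" by (simp add: p_def)
  have b0: "0 \<le> b" using C3_ge \<mu> c_pos by (simp add: b_def)
  have g0: "0 \<le> g' s" by (rule g'_nonneg[OF s0])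
  have gs: "g' s * s\<^sup>2 \<le> s"
    using mult_right_mono[OF g'_decay[OF s0] s0] by (simp add: power2_eq_square mult_ac)
  have e: "c * (g' s * p\<^sup>2) \<le> g' s * (F z \<bullet> D z) + C2 * s"
  proof -
    have "g' s * (c * p\<^sup>2 - C2 * s\<^sup>2) \<le> g' s * (F z \<bullet> D z)"
      using elim g0 by (intro mult_left_mono) (auto simp: s_def p_def)
    moreover have "C2 * (g' s * s\<^sup>2) \<le> C2 * s" using gs C2_ge by (intro mult_left_mono) auto
    ultimately show ?thesis by (simp add: algebra_simps)
  qed
  have be: "0 \<le> C3 * \<mu> * (g' s * p\<^sup>2)" "C3 * \<mu> * (g' s * p\<^sup>2) \<le> b * (g' s * (F z \<bullet> D z)) + b * C2 * s"
  proof -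
    show "0 \<le> C3 * \<mu> * (g' s * p\<^sup>2)" using C3_ge \<mu> g0 by simp
    have "b * (c * (g' s * p\<^sup>2)) \<le> b * (g' s * (F z \<bullet> D z) + C2 * s)" using e b0 by (rule mult_left_mono)
    then show "C3 * \<mu> * (g' s * p\<^sup>2) \<le> b * (g' s * (F z \<bullet> D z)) + b * C2 * s"
      using c_pos by (simp add: b_def algebra_simps)
  qed
  have nn: "0 \<le> C3 / \<mu> * s" "0 \<le> C4 * s" "0 \<le> C3 / (\<mu> * L)" using C3_ge C4_ge \<mu> L s0 by auto
  have "norm (F z) \<le> (norm (F z))\<^sup>2 + s + C4 * s + C3 / \<mu> * s + b * C2 * s + b * (g' s * (F z \<bullet> D z)) + C3 / (\<mu> * L)"
  proof (cases "1 \<le> s")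
    case True
    then show ?thesis using be nn linear_le_quadratic[of "norm (F z)"] by linarith
  next
    case False
    have gpos: "0 < g' s" using s0 L by (auto simp: g'_def intro!: divide_pos_pos mult_pos_pos add_pos_nonneg)
    \<comment> \<open>Uses 1 + s <= 2, from s < 1, and 2 L <= 4 (L - 1), from L >= 2.\<close>
    have inv: "1 \<le> 4 * g' s * (1 / L + s)"
    proof -
      have pp: "1 + L * s > 0" "1 + s > 0" using s0 L by (auto intro: add_pos_nonneg)
      have "(1 + L * s) * (1 + s) * L \<le> (1 + L * s) * 2 * L"
        using pp False L by (intro mult_right_mono mult_left_mono) auto
      also have "(1 + L * s) * 2 * L \<le> 4 * (L - 1) * (1 + L * s)"
      proof -
        have "(1 + L * s) * (2 * L) \<le> (1 + L * s) * (4 * (L - 1))" using pp L by (intro mult_left_mono) auto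
        then show ?thesis by (simp only: mult_ac)
      qed
      finally have "(1 + L * s) * (1 + s) * L \<le> 4 * (L - 1) * (1 + L * s)" .
      then have "1 \<le> 4 * (L - 1) * (1 + L * s) / ((1 + L * s) * (1 + s) * L)"
        using pp L by (simp add: le_divide_eq)
      also have "\<dots> = 4 * g' s * (1 / L + s)"
        using pp L by (simp add: g'_def divide_simps)
      finally show ?thesis .
    qed
    have "p \<le> \<mu> * (g' s * p\<^sup>2) + 1 / \<mu> * (1 / L + s)"
    proof -
      \<comment> \<open>The square of \<open>r\<close> is Young's inequality with denominators
        cleared; the constant 1 it leaves is bounded by \<open>inv\<close>, so that everything can
        be divided by 4 \<mu> g'.\<close>
      define r where "r = 2 * \<mu> * g' s * p - 1"
      have "0 \<le> r\<^sup>2" by simp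
      then have "4 * \<mu> * g' s * p \<le> 4 * \<mu>\<^sup>2 * (g' s)\<^sup>2 * p\<^sup>2 + 1"
        unfolding r_def by (simp add: power2_eq_square algebra_simps)
      also have "\<dots> \<le> 4 * \<mu>\<^sup>2 * (g' s)\<^sup>2 * p\<^sup>2 + 4 * g' s * (1 / L + s)" using inv by simp
      also have "\<dots> = (4 * \<mu> * g' s) * (\<mu> * (g' s * p\<^sup>2) + 1 / \<mu> * (1 / L + s))"
        using \<mu> by (simp add: power2_eq_square algebra_simps)
      finally show ?thesis using \<mu> gpos by (simp add: mult.assoc)
    qed
    then have "C3 * p \<le> C3 * (\<mu> * (g' s * p\<^sup>2) + 1 / \<mu> * (1 / L + s))" using C3_ge by (intro mult_left_mono) auto
    then have "C3 * p \<le> C3 * \<mu> * (g' s * p\<^sup>2) + C3 / \<mu> * s + C3 / (\<mu> * L)" by (simp add: algebra_simps)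
    moreover have "norm (F z) \<le> C3 * p + C4 * s" using elim by (simp add: p_def s_def)
    moreover have "0 \<le> (norm (F z))\<^sup>2" by simp
    ultimately show ?thesis using be s0 by linarith
  qed
  then show ?case by (simp add: s_def algebra_simps)
qed

end

section \<open>The recursive estimate and its consequences\<close>

context parabolic_flow
begin

text \<open>The pointwise bound is integrated against the cutoff of radius 4R, and the energy
  inequality bounds the only term that involves the gradient of the solution. Each remaining
  coefficient is at most a constant times sqrt R.\<close>

lemma fluxmass_le:
  assumes v0: "integrable lborel (v 0)"
  obtains K where "0 \<le> K" "\<And>R. 1 \<le> R \<Longrightarrow> fluxmass (2 * R) \<le> K * sqrt R * (1 + mass (4 * R) + fluxmass (4 * R) / R)"
proof -
  let ?n = "DIM('a)"
  define \<Phi> where "\<Phi> = (LINT z|lborel. (norm (F z))\<^sup>2)"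
  define m0 where "m0 = integral\<^sup>L lborel (v 0)"
  define a where "a = 1 + C4 + C3 + C3 / c * C2"
  define k where "k = C3 / c * (4 * real ?n)"
  define e where "e = C3 * (unit_ball_vol ?n * T)"
  define K where "K = 16 / 9 * (\<Phi> + a + k * m0 + k + e)"
  have \<Phi>0: "0 \<le> \<Phi>" by (simp add: \<Phi>_def)
  have m00: "0 \<le> m0" unfolding m0_def using v_nonneg[of 0] T_pos by (intro integral_nonneg_AE AE_I2) auto
  have a0: "0 \<le> a" and k0: "0 \<le> k" using C2_ge C3_ge C4_ge c_pos by (simp_all add: a_def k_def)
  have e0: "0 \<le> e" using C3_ge T_pos by (simp add: e_def)
  show ?thesis
  proof (rule that)
    show "0 \<le> K" using \<Phi>0 m00 a0 k0 e0 by (simp add: K_def)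
    fix R :: real assume R: "1 \<le> R"
    \<comment> \<open>With this \<open>L\<close> the constant term C3 / (\<mu> L), integrated over
      the ball of radius 4R, no longer depends on R except through 1 / \<mu>.\<close>
    define L where "L = (4 * R) ^ ?n"
    define r where "r = sqrt R"
    have r1: "1 \<le> r" using R by (simp add: r_def)
    have rr: "r * r = R" using R by (simp add: r_def)
    have L4: "4 * R \<le> L" unfolding L_def using R by (intro self_le_power) auto
    then have L2: "2 \<le> L" using R by simp
    \<comment> \<open>A bound linear in R suffices: together with the factor \<mu> = R^(-1/2) in
      \<open>b\<close> it contributes only sqrt R.\<close>
    have lnL: "ln L \<le> 4 * real ?n * R"
    proof -
      have "ln L = real ?n * ln (4 * R)" unfolding L_def by (rule ln_realpow)
      also have "\<dots> \<le> real ?n * (4 * R)" using ln_bound[of "4 * R"] R by (intro mult_left_mono) auto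
      finally show ?thesis by (simp add: mult_ac)
    qed
    have lnL0: "0 \<le> ln L" using L2 by simp
    \<comment> \<open>The losses are of order 1 / \<mu> from the mass and \<mu> R from the entropy
      slope; this value makes both equal to sqrt R.\<close>
    define \<mu> where "\<mu> = 1 / r"
    have \<mu>: "0 < \<mu>" using r1 by (simp add: \<mu>_def)
    define b where "b = C3 * \<mu> / c"
    have b0: "0 \<le> b" using C3_ge \<mu> c_pos by (simp add: b_def)
    let ?G = "\<lambda>s. (1 + L * s) * ln (1 + L * s) / L - (1 + s) * ln (1 + s)"
    let ?g = "\<lambda>s. ln (1 + L * s) - ln (1 + s)"
    let ?g' = "\<lambda>s. (L - 1) / ((1 + L * s) * (1 + s))"
    let ?z = "bump (4 * R) :: 'a \<Rightarrow> real"
    have R4: "0 < 4 * R" using R by simp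
    interpret ent: entropy ?G ?g ?g' L "ln L" by (rule log_entropy[OF L2])
    interpret es: energy_setup v w D F T c C2 C3 C4 ?G ?g ?g' L "ln L" ?z "bump_grad (4 * R)" "4 * R"
    proof unfold_locales
      show "test_function UNIV ?z (bump_grad (4 * R))" by (rule bump_test_function[OF R4])
      show "?z x = 0" if "4 * R < norm x" for x using that by (intro bump_zero R4) simp
    qed (simp_all add: bump_nonneg bump_le_1)
    define A where "A = 1 + C4 + C3 / \<mu> + b * C2"
    define d where "d = C3 / (\<mu> * L)"
    have A0: "0 \<le> A" and d0: "0 \<le> d" using C2_ge C3_ge C4_ge \<mu> b0 L2 by (simp_all add: A_def d_def)
    let ?i = "\<lambda>z :: 'a \<times> real. indicator (cball 0 (4 * R)) (fst z) :: real"
    \<comment> \<open>The part of \<open>energy_density\<close> with the gradient of the cutoff has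
      no sign. Since the slope is at most ln L and that gradient at most 4 / (4R), it is at most ln
      L / R times |F|, and this amount is added back.\<close>
    define B where "B = (\<lambda>z. (norm (F z))\<^sup>2 + A * (?i z * w z) + b * (es.energy_density z + ln L / R * (?i z * norm (F z)))
       + d * indicator (cball 0 (4 * R) \<times> {0<..<T}) z)"
    have si: "integrable lborel (\<lambda>z. indicator (cball (0::'a) (4 * R) \<times> {0<..<T}) z :: real)"
      using slab_finite[of "4 * R"] by (intro integrable_real_indicator) (auto intro!: borel_Times)
    note ints = F_L2 w_integrable F_integrable si es.energy(1)[OF v0]
    have Bi: "integrable lborel B" unfolding B_def
      by (intro Bochner_Integration.integrable_add integrable_mult_right ints)
    have le: "AE z in lborel. ?z (fst z) * norm (F z) \<le> B z"
      using flux_pointwise[OF L2 \<mu>]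
    proof eventually_elim
      case (elim z)
      show ?case
      proof (cases "norm (fst z) \<le> 4 * R \<and> snd z \<in> {0<..<T}")
        case False
        have "?z (fst z) * norm (F z) = 0"
          using False F_support[of z] es.\<zeta>_zero[of "fst z"] by auto
        moreover have "0 \<le> B z"
        proof (cases "norm (fst z) \<le> 4 * R")
          case True
          then have "F z = 0" using False F_support[of z] by blast
          then show ?thesis unfolding B_def es.energy_density_def using A0 d0 w_nonneg[of z] by simp
        next
          case False
          then show ?thesis unfolding B_def es.energy_density_def
            using d0 es.\<zeta>_zero[of "fst z"] es.D\<zeta>_zero[of "fst z"] by simp
        qed
        ultimately show ?thesis by (simp only:)
      next
        case True
        define \<zeta> where "\<zeta> = ?z (fst z)"
        have \<zeta>: "0 \<le> \<zeta>" "\<zeta> \<le> 1" by (simp_all add: \<zeta>_def bump_nonneg bump_le_1)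
        have ed: "\<zeta> * (?g' (w z) * (F z \<bullet> D z)) \<le> es.energy_density z + ln L / R * norm (F z)"
        proof -
          have "es.energy_density z = ?g (w z) * (F z \<bullet> bump_grad (4 * R) (fst z)) + \<zeta> * (?g' (w z) * (F z \<bullet> D z))"
            by (simp add: es.energy_density_def \<zeta>_def inner_add_right)
          moreover have "- (?g (w z) * (F z \<bullet> bump_grad (4 * R) (fst z))) \<le> ln L / R * norm (F z)"
          proof -
            have "\<bar>F z \<bullet> bump_grad (4 * R) (fst z)\<bar> \<le> norm (F z) * norm (bump_grad (4 * R) (fst z))" by (rule Cauchy_Schwarz_ineq2)
            also have "\<dots> \<le> norm (F z) * (4 / (4 * R))" by (intro mult_left_mono bump_grad_le R4) auto
            finally have 1: "\<bar>F z \<bullet> bump_grad (4 * R) (fst z)\<bar> \<le> norm (F z) / R" by simp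
            have "- (?g (w z) * (F z \<bullet> bump_grad (4 * R) (fst z))) \<le> \<bar>?g (w z) * (F z \<bullet> bump_grad (4 * R) (fst z))\<bar>" by simp
            also have "\<dots> = ?g (w z) * \<bar>F z \<bullet> bump_grad (4 * R) (fst z)\<bar>"
              using ent.g_nonneg[OF w_nonneg] by (simp only: abs_mult abs_of_nonneg)
            also have "\<dots> \<le> ln L * (norm (F z) / R)"
              using 1 ent.g_le[OF w_nonneg] ent.g_nonneg[OF w_nonneg] lnL0 by (intro mult_mono) auto
            finally show ?thesis by simp
          qed
          ultimately show ?thesis by linarith
        qed
        have "\<zeta> * norm (F z) \<le> \<zeta> * ((norm (F z))\<^sup>2 + A * w z + b * (?g' (w z) * (F z \<bullet> D z)) + d)"
          using elim \<zeta> by (intro mult_left_mono) (simp_all add: A_def b_def d_def)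
        also have "\<dots> = \<zeta> * ((norm (F z))\<^sup>2 + A * w z + d) + b * (\<zeta> * (?g' (w z) * (F z \<bullet> D z)))"
          by (simp add: algebra_simps)
        also have "\<dots> \<le> 1 * ((norm (F z))\<^sup>2 + A * w z + d) + b * (es.energy_density z + ln L / R * norm (F z))"
          using ed b0 \<zeta> A0 d0 w_nonneg[of z] by (intro add_mono mult_right_mono mult_left_mono) auto
        also have "\<dots> = B z" using True by (cases z) (simp add: B_def)
        finally show ?thesis by (simp add: \<zeta>_def)
      qed
    qed
    have zi: "integrable lborel (\<lambda>z. ?z (fst z) * norm (F z))"
    proof (rule Bochner_Integration.integrable_bound[OF F_integrable[of "4 * R"]])
      have [measurable]: "?z \<in> borel_measurable borel" by (rule borel_measurable_continuous_onI[OF bump_continuous[OF R4]])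
      show "(\<lambda>z. ?z (fst z) * norm (F z)) \<in> borel_measurable lborel" unfolding measurable_lborel1 by measurable
      have "?z x * s \<le> indicator (cball 0 (4 * R)) x * s" if "0 \<le> s" for x s
        using that bump_le_1[of "4 * R" x] es.\<zeta>_zero[of x] by (intro mult_right_mono) (auto simp: indicator_def)
      then show "AE z in lborel. norm (?z (fst z) * norm (F z)) \<le> norm (?i z * norm (F z))"
        by (intro AE_I2) (simp add: bump_nonneg)
    qed
    have "9 / 16 * fluxmass (2 * R) = (LINT z|lborel. 9 / 16 * (indicator (cball 0 (2 * R)) (fst z) * norm (F z)))"
      by (simp add: fluxmass_def)
    also have "\<dots> \<le> (LINT z|lborel. ?z (fst z) * norm (F z))"
    proof (rule integral_mono[OF integrable_mult_right[OF F_integrable] zi])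
      fix z
      show "9 / 16 * (indicator (cball 0 (2 * R)) (fst z) * norm (F z)) \<le> ?z (fst z) * norm (F z)"
      proof (cases "norm (fst z) \<le> 2 * R")
        case True
        then have "9 / 16 \<le> ?z (fst z)" by (intro bump_ge R4) auto
        then show ?thesis using True mult_right_mono[of "9/16" "?z (fst z)" "norm (F z)"] by simp
      next
        case False
        then show ?thesis by (simp add: bump_nonneg)
      qed
    qed
    also have "\<dots> \<le> integral\<^sup>L lborel B" by (rule integral_mono_AE[OF zi Bi le])
    also have "\<dots> = \<Phi> + A * mass (4 * R) + b * (integral\<^sup>L lborel es.energy_density + ln L / R * fluxmass (4 * R))
       + d * measure lborel (cball (0::'a) (4 * R) \<times> {0<..<T})"
      unfolding B_def \<Phi>_def mass_def fluxmass_def using ints by simp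
    also have "\<dots> \<le> \<Phi> + A * mass (4 * R) + b * (ln L * m0 + ln L / R * fluxmass (4 * R))
       + d * (unit_ball_vol ?n * L * T)"
      using es.energy(2)[OF v0] b0 slab_measure[of "4 * R"] R by (simp add: m0_def L_def mult_left_mono)
    also have "\<dots> = \<Phi> + A * mass (4 * R) + b * ln L * (m0 + fluxmass (4 * R) / R) + e * r"
      using L2 by (simp add: d_def e_def \<mu>_def algebra_simps)
    also have "\<dots> \<le> \<Phi> * r + (a * r) * mass (4 * R) + (k * r) * (m0 + fluxmass (4 * R) / R) + e * r"
    proof -
      have "b \<le> C3 / c * 1" using r1 C3_ge c_pos by (simp add: b_def \<mu>_def divide_simps)
      then have "b * C2 \<le> C3 / c * C2" using C2_ge by (intro mult_right_mono) auto
      also have "\<dots> \<le> C3 / c * C2 * r" using mult_left_mono[OF r1, of "C3 / c * C2"] C2_ge C3_ge c_pos by simp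
      finally have "A \<le> a * r"
        using mult_left_mono[OF r1, of "1 + C4"] C4_ge by (simp add: A_def a_def \<mu>_def algebra_simps)
      moreover have "b * ln L \<le> k * r"
      proof -
        have "b * ln L \<le> b * (4 * real ?n * (r * r))" using lnL b0 rr by (intro mult_left_mono) auto
        also have "\<dots> = k * r" using r1 by (simp add: b_def \<mu>_def k_def)
        finally show ?thesis .
      qed
      moreover have "\<Phi> \<le> \<Phi> * r" using mult_left_mono[OF r1 \<Phi>0] by simp
      ultimately show ?thesis
        using mass_nonneg[of "4 * R"] m00 fluxmass_nonneg[of "4 * R"] R r1 by (intro add_mono mult_right_mono) auto
    qed
    also have "\<dots> = r * (\<Phi> * 1 + a * mass (4 * R) + (k * m0) * 1 + k * (fluxmass (4 * R) / R) + e * 1)"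
      by (simp add: algebra_simps)
    also have "\<dots> \<le> r * (\<Phi> * X + a * X + (k * m0) * X + k * X + e * X)"
      if X: "X = 1 + mass (4 * R) + fluxmass (4 * R) / R" for X
    proof -
      have "0 \<le> fluxmass (4 * R) / R" using fluxmass_nonneg[of "4 * R"] R by simp
      then have "1 \<le> X" "mass (4 * R) \<le> X" "fluxmass (4 * R) / R \<le> X" using mass_nonneg[of "4 * R"] by (auto simp: X)
      then show ?thesis using \<Phi>0 a0 k0 m00 e0 r1 by (intro mult_left_mono add_mono) auto
    qed
    finally have "9 / 16 * fluxmass (2 * R) \<le> r * (\<Phi> * X + a * X + (k * m0) * X + k * X + e * X)"
      if "X = 1 + mass (4 * R) + fluxmass (4 * R) / R" for X using that by blast
    note this[OF refl]
    also have "r * (\<Phi> * X + a * X + (k * m0) * X + k * X + e * X) = 9 / 16 * (K * r * X)" for X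
      by (simp add: K_def algebra_simps)
    finally show "fluxmass (2 * R) \<le> K * sqrt R * (1 + mass (4 * R) + fluxmass (4 * R) / R)"
      by (simp add: r_def)
  qed
qed

text \<open>\<open>mass_le\<close> bounds \<sigma>(R) by the scaled flux at 2R, and
  \<open>fluxmass_le\<close> bounds the latter by R^(-1/2) \<sigma>(4R). Once the recursion has
  shown \<sigma> to be bounded, the second estimate alone is the rate.\<close>

lemma fluxmass_sublinear:
  assumes v0: "integrable lborel (v 0)"
  obtains K R0 where "1 \<le> R0" "\<And>R. R0 \<le> R \<Longrightarrow> fluxmass (2 * R) / R \<le> K / sqrt R"
proof -
  obtain K where K: "0 \<le> K" "\<And>R. 1 \<le> R \<Longrightarrow> fluxmass (2 * R) \<le> K * sqrt R * (1 + mass (4 * R) + fluxmass (4 * R) / R)"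
    using fluxmass_le[OF v0] by blast
  define \<sigma> where "\<sigma> = (\<lambda>R. 1 + mass R + fluxmass R / R)"
  define m0 where "m0 = integral\<^sup>L lborel (v 0)"
  have m00: "0 \<le> m0" unfolding m0_def using v_nonneg[of 0] T_pos by (intro integral_nonneg_AE AE_I2) auto
  define k2 where "k2 = 1 + 16 / 9 * T * m0"
  \<comment> \<open>32/9 T is 16/9 T times the factor 2 in \<open>mass_le\<close>; the 1 accounts
    for the summand \<open>fluxmass R / R\<close> of \<sigma>.\<close>
  define k3 where "k3 = 32 / 9 * T + 1"
  have k2: "1 \<le> k2" and k3: "0 \<le> k3" using T_pos m00 by (simp_all add: k2_def k3_def)
  have \<sigma>0: "0 \<le> \<sigma> R" if "1 \<le> R" for R
    using mass_nonneg[of R] fluxmass_nonneg[of R] that by (simp add: \<sigma>_def)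
  have \<sigma>le: "\<sigma> R \<le> k2 + k3 * (fluxmass (2 * R) / R)" if R: "1 \<le> R" for R
  proof -
    have "fluxmass R / R \<le> fluxmass (2 * R) / R" using R by (intro divide_right_mono fluxmass_mono) auto
    moreover have "mass R \<le> 16 / 9 * T * (m0 + 2 / R * fluxmass (2 * R))"
      unfolding m0_def by (rule mass_le[OF v0]) (use R in auto)
    ultimately show ?thesis by (simp add: \<sigma>_def k2_def k3_def algebra_simps)
  qed
  have flux4: "fluxmass (2 * R) / R \<le> 4 * K / sqrt R * \<sigma> (4 * R)" if R: "1 \<le> R" for R
  proof -
    have "fluxmass (2 * R) / R \<le> K * sqrt R * (1 + mass (4 * R) + fluxmass (4 * R) / R) / R"
      using K(2)[OF R] R by (intro divide_right_mono) auto
    also have "\<dots> \<le> K * sqrt R * (4 * \<sigma> (4 * R)) / R"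
    proof (intro divide_right_mono mult_left_mono)
      \<comment> \<open>The factor 4 arises because \<sigma>(4R) divides the flux by 4R and not by
        R.\<close>
      show "1 + mass (4 * R) + fluxmass (4 * R) / R \<le> 4 * \<sigma> (4 * R)"
        using mass_nonneg[of "4 * R"] by (simp add: \<sigma>_def)
    qed (use K R in auto)
    also have "\<dots> = 4 * K * \<sigma> (4 * R) * (sqrt R / R)" by simp
    also have "sqrt R / R = 1 / sqrt R" using R by (simp add: field_simps)
    finally show ?thesis by simp
  qed
  have rec: "\<sigma> R \<le> k2 + (k3 * (4 * K)) / sqrt R * \<sigma> (4 * R)" if R: "1 \<le> R" for R
    using \<sigma>le[OF R] mult_left_mono[OF flux4[OF R] k3] by simp
  define \<Phi> where "\<Phi> = (LINT z|lborel. (norm (F z))\<^sup>2)"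
  define e where "e = unit_ball_vol DIM('a) * 2 ^ DIM('a) * T"
  have \<Phi>0: "0 \<le> \<Phi>" and e0: "0 \<le> e" using T_pos by (simp_all add: \<Phi>_def e_def)
  have growth: "\<sigma> R \<le> (k2 + k3 * (\<Phi> + e)) * R ^ DIM('a)" if R: "1 \<le> R" for R
  proof -
    have Rn: "1 \<le> R ^ DIM('a)" using R by simp
    have "fluxmass (2 * R) \<le> \<Phi> + e * R ^ DIM('a)"
      using fluxmass_growth[of "2 * R"] R by (simp add: \<Phi>_def e_def power_mult_distrib mult_ac)
    also have "\<dots> \<le> (\<Phi> + e) * R ^ DIM('a)"
      using mult_left_mono[OF Rn \<Phi>0] by (simp add: algebra_simps)
    finally have f: "fluxmass (2 * R) \<le> (\<Phi> + e) * R ^ DIM('a)" .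
    have "fluxmass (2 * R) / R \<le> fluxmass (2 * R) / 1"
      using R fluxmass_nonneg[of "2 * R"] by (intro divide_left_mono) auto
    then have "k3 * (fluxmass (2 * R) / R) \<le> k3 * ((\<Phi> + e) * R ^ DIM('a))"
      using f k3 by (intro mult_left_mono) auto
    moreover have "k2 \<le> k2 * R ^ DIM('a)" using mult_left_mono[OF Rn, of k2] k2 by simp
    ultimately show ?thesis using \<sigma>le[OF R] by (simp add: algebra_simps)
  qed
  obtain R0 where R0: "1 \<le> R0" "\<And>R. R0 \<le> R \<Longrightarrow> \<sigma> R \<le> 2 * \<bar>k2\<bar>"
    by (rule recursive_growth_bounded[OF rec growth \<sigma>0]) (use K k3 in auto)
  show ?thesis
  proof (rule that[OF R0(1)])
    fix R assume R: "R0 \<le> R"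
    then have R1: "1 \<le> R" using R0 by simp
    have "4 * K / sqrt R * \<sigma> (4 * R) \<le> 4 * K / sqrt R * (2 * \<bar>k2\<bar>)"
      using R R1 K(1) by (intro mult_left_mono R0(2)) auto
    then show "fluxmass (2 * R) / R \<le> (4 * K * (2 * \<bar>k2\<bar>)) / sqrt R"
      using flux4[OF R1] by simp
  qed
qed

text \<open>The masses inside the cutoffs at time t have the same limit as those at time 0. As the
  cutoffs increase to 1 and the solution is nonnegative, monotone convergence then yields the
  integrability of \<open>v t\<close> together with the value of its integral.\<close>

theorem mass_conservation:
  assumes v0: "integrable lborel (v 0)" and t: "t \<in> {0..T}"
  shows "integrable lborel (v t)" "integral\<^sup>L lborel (v t) = integral\<^sup>L lborel (v 0)"
proof -
  have t0: "0 \<in> {0..T}" using T_pos by auto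
  define I where "I = (\<lambda>s k. LINT x|lborel. v s x * bump (real (Suc k)) x)"
  obtain K R0 where R0: "1 \<le> R0" "\<And>R. R0 \<le> R \<Longrightarrow> fluxmass (2 * R) / R \<le> K / sqrt R"
    using fluxmass_sublinear[OF v0] by blast
  note [measurable] = locally_integrable_borel[OF v_loc[OF t]]
  have lim0: "I 0 \<longlonglongrightarrow> integral\<^sup>L lborel (v 0)"
    unfolding I_def
  proof (rule integral_dominated_convergence[where w = "v 0"])
    show "AE x in lborel. (\<lambda>k. v 0 x * bump (real (Suc k)) x) \<longlonglongrightarrow> v 0 x"
      using tendsto_mult[OF tendsto_const bump_tendsto_1] by (intro AE_I2) fastforce
    show "AE x in lborel. norm (v 0 x * bump (real (Suc k)) x) \<le> v 0 x" for k
      using mult_left_mono[OF bump_le_1 v_nonneg[OF t0]] v_nonneg[OF t0] by (intro AE_I2) (simp add: bump_nonneg)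
    show "(\<lambda>x. v 0 x * bump (real (Suc k)) x) \<in> borel_measurable lborel" for k
      using bump_integrable_v[OF _ t0, of "real (Suc k)"] by (intro borel_measurable_integrable) simp
  qed (use v0 in auto)
  have diff: "(\<lambda>k. I t k - I 0 k) \<longlonglongrightarrow> 0"
  proof (rule Lim_null_comparison)
    show "(\<lambda>k. 2 * (K / sqrt (real (Suc k) / 2))) \<longlonglongrightarrow> 0"
    proof -
      have "filterlim (\<lambda>k. sqrt (real (Suc k) / 2)) at_top sequentially"
        by (intro filterlim_compose[OF sqrt_at_top] filterlim_tendsto_pos_mult_at_top[OF tendsto_const, of "1/2", simplified]
            filterlim_compose[OF filterlim_real_sequentially filterlim_Suc]) 
      from tendsto_mult[OF tendsto_const[of 2] tendsto_divide_0[OF tendsto_const[of K] filterlim_at_top_imp_at_infinity[OF this]]]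
      show ?thesis by simp
    qed
    show "\<forall>\<^sub>F k in sequentially. norm (I t k - I 0 k) \<le> 2 * (K / sqrt (real (Suc k) / 2))"
      using eventually_ge_at_top[of "nat \<lceil>2 * R0\<rceil>"]
    proof eventually_elim
      case (elim k)
      \<comment> \<open>The cutoff radius is \<open>Suc k\<close> = 2R, while the decay estimate is
        stated for the flux at 2R divided by R.\<close>
      define R where "R = real (Suc k) / 2"
      have R: "R0 \<le> R" using elim by (simp add: R_def)
      have "norm (I t k - I 0 k) \<le> 4 / (2 * R) * fluxmass (2 * R)"
      proof -
        have "real (Suc k) = 2 * R" "0 < 2 * R" by (simp_all add: R_def)
        then show ?thesis using bump_mass_change[of "2 * R" t] t by (simp only: I_def real_norm_def)
      qed
      also have "\<dots> = 2 * (fluxmass (2 * R) / R)" by simp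
      also have "\<dots> \<le> 2 * (K / sqrt R)" using R0(2)[OF R] by (intro mult_left_mono) auto
      finally show ?case by (simp add: R_def)
    qed
  qed
  have limt: "I t \<longlonglongrightarrow> integral\<^sup>L lborel (v 0)"
    using tendsto_add[OF diff lim0] by simp
  have mono: "AE x in lborel. mono (\<lambda>k. v t x * bump (real (Suc k)) x)"
    using v_nonneg[OF t] by (intro AE_I2 monoI mult_left_mono bump_mono) auto
  have lim: "AE x in lborel. (\<lambda>k. v t x * bump (real (Suc k)) x) \<longlonglongrightarrow> v t x"
    using tendsto_mult[OF tendsto_const bump_tendsto_1] by (intro AE_I2) fastforce
  have "has_bochner_integral lborel (v t) (integral\<^sup>L lborel (v 0))"
    by (rule has_bochner_integral_monotone_convergence[OF _ mono lim limt[unfolded I_def]])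
       (use bump_integrable_v[OF _ t] in simp_all)
  then show "integrable lborel (v t)" "integral\<^sup>L lborel (v t) = integral\<^sup>L lborel (v 0)"
    by (auto simp: has_bochner_integral_iff)
qed

end

section \<open>From Steklov averages to the integrated equation\<close>

text \<open>Solutions are Lebesgue measurable, whereas Fubini and the changes of variable are used
  for Borel functions; every passage between the two goes through this.\<close>

lemma lebesgue_AE_transfer:
  fixes f g :: "'a::euclidean_space \<Rightarrow> 'b::euclidean_space"
  assumes g: "g \<in> borel_measurable borel" and eq: "AE x in lborel. f x = g x"
  shows "f \<in> borel_measurable lebesgue" "integrable lebesgue f \<longleftrightarrow> integrable lborel g"
    "integral\<^sup>L lebesgue f = integral\<^sup>L lborel g"
proof -
  have gm: "g \<in> borel_measurable lebesgue" using g by (simp add: measurable_completion)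
  have "AE x in lebesgue. g x = f x" using AE_completion[OF eq] by (simp add: eq_commute)
  then show fm: "f \<in> borel_measurable lebesgue" by (rule borel_measurable_AE[OF gm])
  have eq': "AE x in lebesgue. f x = g x" by (rule AE_completion[OF eq])
  have g': "g \<in> lborel \<rightarrow>\<^sub>M borel" using g by simp
  show "integrable lebesgue f \<longleftrightarrow> integrable lborel g"
    using integrable_cong_AE[OF fm gm eq'] integrable_completion[OF g'] by simp
  show "integral\<^sup>L lebesgue f = integral\<^sup>L lborel g"
    using integral_cong_AE[OF fm gm eq'] integral_completion[OF g'] by simp
qed

text \<open>The real-valued case for each coordinate; finitely many null sets are discarded.\<close>

lemma lebesgue_borel_representative:
  fixes f :: "'a::euclidean_space \<Rightarrow> 'b::euclidean_space"
  assumes f: "f \<in> borel_measurable lebesgue"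
  obtains g where "g \<in> borel_measurable borel" "AE x in lborel. f x = g x"
proof -
  have "\<forall>b\<in>Basis. \<exists>g'. g' \<in> borel_measurable lborel \<and> (AE x in lborel. f x \<bullet> b = g' x)"
    using f by (intro ballI) (rule completion_ex_borel_measurable_real[unfolded Bex_def], simp)
  then obtain G where G: "\<And>b. b \<in> Basis \<Longrightarrow> G b \<in> borel_measurable lborel"
    "\<And>b. b \<in> Basis \<Longrightarrow> AE x in lborel. f x \<bullet> b = G b x" by metis
  have [measurable]: "b \<in> Basis \<Longrightarrow> G b \<in> borel_measurable borel" for b using G(1)[of b] by simp
  have "AE x in lborel. \<forall>b\<in>Basis. f x \<bullet> b = G b x" using G(2) by (intro AE_finite_allI) auto
  then have "AE x in lborel. f x = (\<Sum>b\<in>Basis. G b x *\<^sub>R b)"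
  proof eventually_elim
    case (elim x)
    have "f x = (\<Sum>b\<in>Basis. (f x \<bullet> b) *\<^sub>R b)" by (simp add: euclidean_representation)
    then show ?case using elim by simp
  qed
  then show ?thesis by (intro that[of "\<lambda>x. (\<Sum>b\<in>Basis. G b x *\<^sub>R b)"]) measurable
qed

section \<open>Measurability on the half space and of the flux\<close>

lemma loc_integrable_halfspace_measurable:
  fixes f :: "'a::euclidean_space \<times> real \<Rightarrow> 'b::euclidean_space"
  assumes "loc_integrable (UNIV \<times> {0<..}) f"
  shows "(\<lambda>z. indicator (UNIV \<times> {0<..}) z *\<^sub>R f z) \<in> borel_measurable lebesgue"
proof -
  \<comment> \<open>A compact exhaustion of the open half space; the lower time limit decreases to 0
    without reaching it.\<close>
  define K where "K = (\<lambda>k::nat. cball (0::'a) (real k) \<times> {1 / real (Suc k)..real k})"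
  have pos: "0 < 1 / real (Suc k)" for k by simp
  have "compact (K k)" "K k \<subseteq> UNIV \<times> {0<..}" for k
    unfolding K_def by (auto intro!: compact_Times less_le_trans[OF pos] simp del: of_nat_Suc)
  then have m: "(\<lambda>z. indicator (K k) z *\<^sub>R f z) \<in> borel_measurable lebesgue" for k
    using assms unfolding loc_integrable_def set_integrable_def by (intro borel_measurable_integrable) auto
  have "(\<lambda>k. indicator (K k) z *\<^sub>R f z) \<longlonglongrightarrow> indicator (UNIV \<times> {0<..}) z *\<^sub>R f z" for z
  proof (rule tendsto_eventually)
    obtain x t where z: "z = (x, t)" by (cases z)
    show "\<forall>\<^sub>F k in sequentially. indicator (K k) z *\<^sub>R f z = indicator (UNIV \<times> {0<..}) z *\<^sub>R f z"
    proof (cases "0 < t")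
      case True
      have 1: "\<forall>\<^sub>F k in sequentially. 1 / real (Suc k) < t"
        using LIMSEQ_Suc[OF lim_1_over_n] True by (rule order_tendstoD)
      have 2: "\<forall>\<^sub>F k in sequentially. max (norm x) t \<le> real k"
        using filterlim_real_sequentially unfolding filterlim_at_top by blast
      from 1 2 show ?thesis by eventually_elim (auto simp: z K_def True indicator_def)
    next
      case False
      have "\<not> 1 / real (Suc k) \<le> t" for k
        using False pos[of k] by linarith
      then show ?thesis using False by (auto simp: z K_def indicator_def intro!: always_eventually)
    qed
  qed
  then show ?thesis by (rule borel_measurable_LIMSEQ_metric[OF m])
qed

text \<open>For simple arguments the composition is a finite sum of measurable pieces, and
  continuity in (z, p) carries this over to limits of simple functions at almost every
  point.\<close>

lemma caratheodory_measurable: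
  fixes A :: "real ^ 'n \<Rightarrow> real \<Rightarrow> (real ^ 'n) \<times> real \<Rightarrow> real ^ 'n"
  assumes A: "caratheodory_A A"
    and p: "(\<lambda>y. indicator (UNIV \<times> {0<..}) y *\<^sub>R p y) \<in> borel_measurable lebesgue"
    and w: "(\<lambda>y. indicator (UNIV \<times> {0<..}) y *\<^sub>R w y) \<in> borel_measurable lebesgue"
    and w0: "\<And>y. y \<in> UNIV \<times> {0<..} \<Longrightarrow> 0 \<le> w y"
  shows "(\<lambda>y. indicator (UNIV \<times> {0<..}) y *\<^sub>R A (p y) (w y) y) \<in> borel_measurable lebesgue"
proof -
  let ?Q = "UNIV \<times> {0<..} :: ((real ^ 'n) \<times> real) set"
  have Q[measurable]: "?Q \<in> sets lebesgue" 
  proof -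
    have "open ?Q" by (intro open_Times) auto
    then show ?thesis by auto
  qed
  define f where "f = (\<lambda>y. (indicator ?Q y *\<^sub>R p y, indicator ?Q y *\<^sub>R w y))"
  have "f \<in> borel_measurable lebesgue" unfolding f_def by (intro borel_measurable_Pair p w)
  then obtain s where s: "\<And>i. simple_function lebesgue (s i)" "\<And>y. (\<lambda>i. s i y) \<longlonglongrightarrow> f y"
    using borel_measurable_implies_sequence_metric[of f lebesgue 0] by auto
  \<comment> \<open>The simple approximations of \<open>w\<close> may be negative;
    \<open>max 0\<close> keeps them where the measurability and continuity assumptions hold.\<close>
  define a where "a = (\<lambda>i y. indicator ?Q y *\<^sub>R A (fst (s i y)) (max 0 (snd (s i y))) y)"
  have am: "a i \<in> borel_measurable lebesgue" for i
  proof -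
    have fin: "finite (range (s i))" using simple_functionD(1)[OF s(1)[of i]] by simp
    have aeq: "a i = (\<lambda>y. \<Sum>c\<in>range (s i). indicator (s i -` {c}) y *\<^sub>R (indicator ?Q y *\<^sub>R A (fst c) (max 0 (snd c)) y))"
    proof
      fix y
      have "(\<Sum>c\<in>range (s i). indicator (s i -` {c}) y *\<^sub>R (indicator ?Q y *\<^sub>R A (fst c) (max 0 (snd c)) y)) =
        (\<Sum>c\<in>range (s i). if c = s i y then indicator ?Q y *\<^sub>R A (fst c) (max 0 (snd c)) y else 0)"
        by (intro sum.cong) (auto simp: indicator_def)
      also have "\<dots> = a i y" using fin by (simp add: a_def)
      finally show "a i y = (\<Sum>c\<in>range (s i). indicator (s i -` {c}) y *\<^sub>R (indicator ?Q y *\<^sub>R A (fst c) (max 0 (snd c)) y))" by (rule sym)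
    qed
    have meas: "(\<lambda>y. indicator (s i -` {c}) y *\<^sub>R (indicator ?Q y *\<^sub>R A (fst c) (max 0 (snd c)) y)) \<in> borel_measurable lebesgue" for c
    proof -
      have [measurable]: "s i -` {c} \<in> sets lebesgue" using simple_functionD(2)[OF s(1)[of i], of "{c}"] by simp
      have "(\<lambda>y. indicator (UNIV \<times> {0..}) y *\<^sub>R A (fst c) (max 0 (snd c)) y) \<in> borel_measurable lebesgue"
        using A unfolding caratheodory_A_def set_borel_measurable_def by simp
      then have "(\<lambda>y. indicator ?Q y *\<^sub>R (indicator (UNIV \<times> {0..}) y *\<^sub>R A (fst c) (max 0 (snd c)) y)) \<in> borel_measurable lebesgue"
        by measurable
      moreover have "(\<lambda>y. indicator ?Q y *\<^sub>R (indicator (UNIV \<times> {0..}) y *\<^sub>R A (fst c) (max 0 (snd c)) y)) =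
         (\<lambda>y. indicator ?Q y *\<^sub>R A (fst c) (max 0 (snd c)) y)" by (auto simp: indicator_def)
      ultimately have [measurable]: "(\<lambda>y. indicator ?Q y *\<^sub>R A (fst c) (max 0 (snd c)) y) \<in> borel_measurable lebesgue" by simp
      show ?thesis by measurable
    qed
    show ?thesis unfolding aeq by (intro borel_measurable_sum meas)
  qed
  have lim: "AE y in lebesgue. (\<lambda>i. a i y) \<longlonglongrightarrow> indicator ?Q y *\<^sub>R A (p y) (w y) y"
  proof -
    have "AE y in lebesgue. y \<in> UNIV \<times> {0..} \<longrightarrow> continuous_on ({0..} \<times> UNIV) (\<lambda>(z, p). A p z y)"
      using A by (simp add: caratheodory_A_def)
    then show ?thesis
    proof eventually_elim
      case (elim y)
      show ?case
      proof (cases "y \<in> ?Q")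
        case True
        then have c: "continuous_on ({0..} \<times> UNIV) (\<lambda>(z, p). A p z y)" using elim by auto
        have "(\<lambda>i. (max 0 (snd (s i y)), fst (s i y))) \<longlonglongrightarrow> (max 0 (snd (f y)), fst (f y))"
          by (intro tendsto_intros s(2))
        then have l: "(\<lambda>i. (max 0 (snd (s i y)), fst (s i y))) \<longlonglongrightarrow> (w y, p y)"
          using True w0[OF True] by (simp add: f_def)
        have "(\<lambda>i. (\<lambda>(z, p). A p z y) (max 0 (snd (s i y)), fst (s i y))) \<longlonglongrightarrow> (\<lambda>(z, p). A p z y) (w y, p y)"
          by (rule continuous_on_tendsto_compose[OF c l]) (use w0[OF True] in auto)
        then show ?thesis using True by (simp add: a_def)
      qed (simp add: a_def)
    qed
  qed
  \<comment> \<open>The limit is measurable by construction; almost-everywhere equality then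
    transfers measurability because Lebesgue measure is complete.\<close>
  define h where "h = (\<lambda>y. lim (\<lambda>i. a i y))"
  have "h \<in> borel_measurable lebesgue" unfolding h_def by (rule borel_measurable_lim_metric[OF am])
  moreover have "AE y in lebesgue. h y = indicator ?Q y *\<^sub>R A (p y) (w y) y"
    using lim by eventually_elim (simp add: h_def limI)
  ultimately show ?thesis by (rule borel_measurable_AE)
qed

text \<open>\<open>u\<close>, \<open>F0\<close>, \<open>B0\<close> are the functions in the weak
  formulation; \<open>v\<close>, \<open>w\<close>, \<open>F\<close> are Borel versions.
  \<open>w\<close> is integrable only over time intervals away from 0, as local integrability in the
  open half space provides, while the flux is integrable down to t = 0.\<close>

locale steklov_flow =
  fixes u :: "'a::euclidean_space \<times> real \<Rightarrow> real" and F0 B0 F :: "'a \<times> real \<Rightarrow> 'a" and w :: "'a \<times> real \<Rightarrow> real"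
    and v :: "real \<Rightarrow> 'a \<Rightarrow> real" and T :: real
  assumes v_loc: "\<And>t. 0 \<le> t \<Longrightarrow> locally_integrable (v t)"
    and v_eq: "\<And>t. 0 \<le> t \<Longrightarrow> AE x in lborel. u (x, t) = v t x"
    and v_cont: "\<And>t R. 0 \<le> t \<Longrightarrow> ((\<lambda>s. LINT x|lborel. indicator (cball 0 R) x * \<bar>v s x - v t x\<bar>) \<longlongrightarrow> 0) (at t within {0..})"
    and w_borel[measurable]: "w \<in> borel_measurable borel" and F_borel[measurable]: "F \<in> borel_measurable borel"
    and w_eq: "AE z in lborel. 0 < snd z \<longrightarrow> u z = w z"
    and F_eq: "AE z in lborel. 0 < snd z \<longrightarrow> F0 z = F z"
    and B_eq: "AE z in lborel. 0 < snd z \<longrightarrow> B0 z = 0"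
    and w_int: "\<And>R a b. 0 < a \<Longrightarrow> integrable lborel (\<lambda>z. indicator (cball 0 R \<times> {a..b}) z * w z)"
    and F_int: "\<And>R. integrable lborel (\<lambda>z. indicator (cball 0 R \<times> {0<..<T}) z * norm (F z))"
    and weak: "\<And>K. compact K \<Longrightarrow> \<exists>h0>0. \<forall>h. 0 < h \<and> h < h0 \<longrightarrow> (\<forall>t. 0 < t \<and> t < T - h \<longrightarrow>
      (\<exists>w'. L1loc_lim UNIV (\<lambda>s x. (steklov h u s x - steklov h u t x) / (s - t)) w' (at t) \<and>
         (\<forall>\<phi> D\<phi>. H10 K \<phi> D\<phi> \<longrightarrow> has_bochner_integral (lebesgue_on K)
            (\<lambda>x. w' x * \<phi> x + steklov h F0 t x \<bullet> D\<phi> x + steklov h B0 t x \<bullet> D\<phi> x) 0)))"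
begin

text \<open>One null set of x serves all \<open>s\<close> and \<open>h\<close>: for the remaining x
  the two functions agree at almost every time, so their integrals over every window agree.\<close>

lemma steklov_AE:
  fixes f g :: "'a \<times> real \<Rightarrow> 'b::euclidean_space"
  assumes g[measurable]: "g \<in> borel_measurable borel" and eq: "AE z in lborel. 0 < snd z \<longrightarrow> f z = g z"
  shows "AE x in lborel. \<forall>s h. 0 < s \<longrightarrow> steklov h f s x = (1 / h) *\<^sub>R (LINT \<tau>|lborel. indicator {s..s + h} \<tau> *\<^sub>R g (x, \<tau>))"
proof -
  have "AE z in lborel \<Otimes>\<^sub>M lborel. 0 < snd z \<longrightarrow> f z = g z" using eq by (simp only: lborel_prod)
  then have "AE x in lborel. AE \<tau> in lborel. 0 < snd (x, \<tau>) \<longrightarrow> f (x, \<tau>) = g (x, \<tau>)" by (rule lborel_pair.AE_pair)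
  then show ?thesis
  proof eventually_elim
    case (elim x)
    show ?case
    proof (intro allI impI)
      fix s h :: real assume "0 < s"
      have "integral\<^sup>L lebesgue (\<lambda>\<tau>. indicator {s..s + h} \<tau> *\<^sub>R f (x, \<tau>)) = (LINT \<tau>|lborel. indicator {s..s + h} \<tau> *\<^sub>R g (x, \<tau>))"
      proof (rule lebesgue_AE_transfer(3))
        show "AE \<tau> in lborel. indicator {s..s + h} \<tau> *\<^sub>R f (x, \<tau>) = indicator {s..s + h} \<tau> *\<^sub>R g (x, \<tau>)"
          using elim by eventually_elim (use \<open>0 < s\<close> in \<open>auto simp: indicator_def\<close>)
      qed measurable
      then show "steklov h f s x = (1 / h) *\<^sub>R (LINT \<tau>|lborel. indicator {s..s + h} \<tau> *\<^sub>R g (x, \<tau>))"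
        by (simp add: steklov_def set_lebesgue_integral_def)
    qed
  qed
qed

lemma pairing_continuous:
  assumes \<phi>: "continuous_on UNIV \<phi>" "\<And>x. R < norm x \<Longrightarrow> \<phi> x = 0"
  shows "continuous_on {0..} (\<lambda>t. LINT x|lborel. v t x * \<phi> x)"
  unfolding continuous_on_def
proof
  fix t :: real assume "t \<in> {0..}"
  then have t: "0 \<le> t" by simp
  obtain B where B: "B > 0" "\<And>x. norm (\<phi> x) \<le> B" using continuous_compact_support_bounded[OF \<phi>] by blast
  have m: "\<phi> \<in> borel_measurable borel" by (rule borel_measurable_continuous_onI[OF \<phi>(1)])
  have i: "integrable lborel (\<lambda>x. v s x * \<phi> x)" if "0 \<le> s" for s
    using locally_integrable_mult(1)[OF v_loc[OF that] m \<phi>(2) B(2)] by simp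
  have "((\<lambda>s. (LINT x|lborel. indicator (cball 0 R) x * \<bar>v s x - v t x\<bar>) * B) \<longlongrightarrow> 0) (at t within {0..})"
    using tendsto_mult_right[OF v_cont[OF t, of R], of B] by simp
  moreover have "\<forall>\<^sub>F s in at t within {0..}. norm ((LINT x|lborel. v s x * \<phi> x) - (LINT x|lborel. v t x * \<phi> x)) \<le>
      (LINT x|lborel. indicator (cball 0 R) x * \<bar>v s x - v t x\<bar>) * B"
    unfolding eventually_at_filter
  proof (intro always_eventually allI impI)
    fix s :: real assume "s \<in> {0..}"
    then have s: "0 \<le> s" by simp
    have "(LINT x|lborel. v s x * \<phi> x) - (LINT x|lborel. v t x * \<phi> x) = (LINT x|lborel. (v s x - v t x) *\<^sub>R \<phi> x)"
      using i[OF s] i[OF t] by (simp add: left_diff_distrib)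
    also have "norm \<dots> \<le> (LINT x|lborel. indicator (cball 0 R) x * \<bar>v s x - v t x\<bar>) * B"
      by (rule locally_integrable_mult(2)[OF locally_integrable_diff[OF v_loc[OF s] v_loc[OF t]] m \<phi>(2) B(2)])
    finally show "norm ((LINT x|lborel. v s x * \<phi> x) - (LINT x|lborel. v t x * \<phi> x)) \<le>
      (LINT x|lborel. indicator (cball 0 R) x * \<bar>v s x - v t x\<bar>) * B" .
  qed
  ultimately have "((\<lambda>s. (LINT x|lborel. v s x * \<phi> x) - (LINT x|lborel. v t x * \<phi> x)) \<longlongrightarrow> 0) (at t within {0..})"
    by (rule Lim_null_comparison[rotated])
  then show "((\<lambda>s. LINT x|lborel. v s x * \<phi> x) \<longlongrightarrow> (LINT x|lborel. v t x * \<phi> x)) (at t within {0..})"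
    by (rule LIM_zero_cancel)
qed

lemma slice_AE: "AE t in lborel. 0 < t \<longrightarrow> (AE x in lborel. w (x, t) = v t x)"
  using AE_lborel_slice[OF w_eq]
proof eventually_elim
  case (elim t)
  show ?case
  proof
    assume t: "0 < t"
    show "AE x in lborel. w (x, t) = v t x"
      using elim v_eq[OF less_imp_le[OF t]] by eventually_elim (use t in auto)
  qed
qed

lemma product_integrable:
  fixes f :: "'a \<times> real \<Rightarrow> 'b::euclidean_space" and k :: "'a \<Rightarrow> 'b"
  assumes f[measurable]: "f \<in> borel_measurable borel"
    and fi: "integrable lborel (\<lambda>z. indicator (cball 0 R \<times> I) z * norm (f z))" and I[measurable]: "I \<in> sets borel"
    and k: "continuous_on UNIV k" "\<And>x. R < norm x \<Longrightarrow> k x = 0"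
  shows "integrable (lborel \<Otimes>\<^sub>M lborel) (\<lambda>(x, \<tau>). indicator I \<tau> * (f (x, \<tau>) \<bullet> k x))"
proof -
  obtain B where B: "B > 0" "\<And>x. norm (k x) \<le> B" using continuous_compact_support_bounded[OF k] by blast
  have [measurable]: "k \<in> borel_measurable borel" by (rule borel_measurable_continuous_onI[OF k(1)])
  have "integrable lborel (\<lambda>z. indicator I (snd z) * (f z \<bullet> k (fst z)))"
  proof (rule Bochner_Integration.integrable_bound[OF integrable_mult_left[OF fi, of B]])
    show "(\<lambda>z. indicator I (snd z) * (f z \<bullet> k (fst z))) \<in> borel_measurable lborel"
      unfolding measurable_lborel1 by measurable
    show "AE z in lborel. norm (indicator I (snd z) * (f z \<bullet> k (fst z))) \<le> norm (indicator (cball 0 R \<times> I) z * norm (f z) * B)"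
    proof (rule AE_I2)
      fix z :: "'a \<times> real"
      show "norm (indicator I (snd z) * (f z \<bullet> k (fst z))) \<le> norm (indicator (cball 0 R \<times> I) z * norm (f z) * B)"
      proof (cases "norm (fst z) \<le> R")
        case True
        have "\<bar>f z \<bullet> k (fst z)\<bar> \<le> norm (f z) * norm (k (fst z))" by (rule Cauchy_Schwarz_ineq2)
        also have "\<dots> \<le> norm (f z) * B" by (intro mult_left_mono B) auto
        finally show ?thesis using True B(1) by (cases z) (auto simp: indicator_def)
      qed (simp add: k(2))
    qed
  qed
  then show ?thesis by (simp add: lborel_prod case_prod_unfold)
qed

text \<open>Fubini turns the pairing of the averaged solution with \<phi> into the integral of the
  continuous function \<gamma> over a moving window, which can be differentiated in
  \<open>s\<close>.\<close>

lemma steklov_pairing: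
  assumes \<phi>: "continuous_on UNIV \<phi>" "\<And>x. R < norm x \<Longrightarrow> \<phi> x = 0" and s: "0 < s" and h: "0 < h"
  defines "\<gamma> \<equiv> \<lambda>t. LINT x|lborel. v t x * \<phi> x"
  shows "integrable lborel (\<lambda>x. (LINT \<tau>|lborel. indicator {s..s + h} \<tau> *\<^sub>R w (x, \<tau>)) * \<phi> x)"
    and "(LINT x|lborel. (LINT \<tau>|lborel. indicator {s..s + h} \<tau> *\<^sub>R w (x, \<tau>)) * \<phi> x) = integral {s..s + h} \<gamma>"
proof -
  have "integrable lborel (\<lambda>z. norm (indicator (cball 0 R \<times> {s..s + h}) z * w z))"
    by (intro integrable_norm w_int s)
  then have i0: "integrable lborel (\<lambda>z. indicator (cball 0 R \<times> {s..s + h}) z * norm (w z))" by (simp add: abs_mult)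
  have i: "integrable (lborel \<Otimes>\<^sub>M lborel) (\<lambda>(x, \<tau>). indicator {s..s + h} \<tau> * (w (x, \<tau>) \<bullet> \<phi> x))"
    by (rule product_integrable[OF w_borel i0 _ \<phi>]) simp
  have eq: "(LINT \<tau>|lborel. indicator {s..s + h} \<tau> * (w (x, \<tau>) \<bullet> \<phi> x)) =
     (LINT \<tau>|lborel. indicator {s..s + h} \<tau> *\<^sub>R w (x, \<tau>)) * \<phi> x" for x
    by (simp add: mult.assoc[symmetric])
  show "integrable lborel (\<lambda>x. (LINT \<tau>|lborel. indicator {s..s + h} \<tau> *\<^sub>R w (x, \<tau>)) * \<phi> x)"
    using lborel_pair.integrable_fst[OF i] unfolding eq .
  have gc: "continuous_on {s..s + h} \<gamma>"
    unfolding \<gamma>_def by (rule continuous_on_subset[OF pairing_continuous[OF \<phi>]]) (use s in auto)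
  have gi: "set_integrable lborel {s..s + h} \<gamma>"
    unfolding set_integrable_def by (intro borel_integrable_compact gc) auto
  have "(LINT x|lborel. (LINT \<tau>|lborel. indicator {s..s + h} \<tau> *\<^sub>R w (x, \<tau>)) * \<phi> x) =
    (LINT x|lborel. (LINT \<tau>|lborel. indicator {s..s + h} \<tau> * (w (x, \<tau>) \<bullet> \<phi> x)))" by (simp only: eq)
  also have "\<dots> = (LINT \<tau>|lborel. (LINT x|lborel. indicator {s..s + h} \<tau> * (w (x, \<tau>) \<bullet> \<phi> x)))"
    by (rule lborel_pair.Fubini_integral[OF i, symmetric])
  also have "\<dots> = (LINT \<tau>|lborel. indicator {s..s + h} \<tau> *\<^sub>R \<gamma> \<tau>)"
  proof (rule integral_cong_AE)
    show "(\<lambda>\<tau>. LINT x|lborel. indicator {s..s + h} \<tau> * (w (x, \<tau>) \<bullet> \<phi> x)) \<in> borel_measurable lborel"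
      using lborel_pair.integrable_snd[OF i] by (rule borel_measurable_integrable)
    show "(\<lambda>\<tau>. indicator {s..s + h} \<tau> *\<^sub>R \<gamma> \<tau>) \<in> borel_measurable lborel"
      using gi unfolding set_integrable_def by (rule borel_measurable_integrable)
    show "AE \<tau> in lborel. (LINT x|lborel. indicator {s..s + h} \<tau> * (w (x, \<tau>) \<bullet> \<phi> x)) = indicator {s..s + h} \<tau> *\<^sub>R \<gamma> \<tau>"
      using slice_AE
    proof eventually_elim
      case (elim \<tau>)
      show ?case
      proof (cases "\<tau> \<in> {s..s + h}")
        case True
        then have \<tau>: "0 < \<tau>" "0 \<le> \<tau>" using s by auto
        note [measurable] = locally_integrable_borel[OF v_loc[OF \<tau>(2)]] borel_measurable_continuous_onI[OF \<phi>(1)]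
        have "(LINT x|lborel. w (x, \<tau>) * \<phi> x) = \<gamma> \<tau>" unfolding \<gamma>_def
          by (rule integral_cong_AE) (use elim \<tau> in \<open>auto elim: eventually_mono\<close>)
        then show ?thesis using True by simp
      qed simp
    qed
  qed
  also have "\<dots> = integral {s..s + h} \<gamma>"
    using set_borel_integral_eq_integral(2)[OF gi] by (simp add: set_lebesgue_integral_def)
  finally show "(LINT x|lborel. (LINT \<tau>|lborel. indicator {s..s + h} \<tau> *\<^sub>R w (x, \<tau>)) * \<phi> x) = integral {s..s + h} \<gamma>" .
qed

end

lemma continuous_set_integrable_lebesgue:
  fixes f :: "'a::euclidean_space \<Rightarrow> 'b::euclidean_space"
  assumes c: "continuous_on UNIV f"
  shows "set_integrable lebesgue (cball a r) f"
proof -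
  have "set_integrable lborel (cball a r) f"
    unfolding set_integrable_def by (intro borel_integrable_compact continuous_on_subset[OF c]) auto
  then show ?thesis unfolding set_integrable_def
    by (subst integrable_completion) (auto dest: borel_measurable_integrable)
qed

text \<open>The constant sequence approximates. The radius is enlarged by 1 because the support has
  to lie in the interior of the ball.\<close>

lemma test_function_H10:
  assumes t: "test_function UNIV \<phi> D\<phi>" and R: "\<And>x. R < norm x \<Longrightarrow> \<phi> x = 0"
  shows "H10 (cball 0 (R + 1)) \<phi> D\<phi>"
proof -
  have c: "continuous_on UNIV \<phi>" "continuous_on UNIV D\<phi>"
    by (rule test_functionE[OF t]; assumption)+
  have "{x. \<phi> x \<noteq> 0} \<subseteq> cball 0 R" using R by (auto simp: not_less[symmetric])
  then have "closure {x. \<phi> x \<noteq> 0} \<subseteq> cball 0 R" by (rule closure_minimal) auto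
  also have "cball 0 R \<subseteq> interior (cball (0::'a) (R + 1))" by (auto simp: interior_cball)
  finally have tf: "test_function (cball 0 (R + 1)) \<phi> D\<phi>" using t by (auto simp: test_function_def)
  have L2: "L2_on (cball 0 (R + 1)) f" if f: "continuous_on UNIV f" for f :: "'a \<Rightarrow> 'c::euclidean_space"
    unfolding L2_on_def
  proof
    show "set_borel_measurable lebesgue (cball 0 (R + 1)) f"
      using continuous_set_integrable_lebesgue[OF f, of 0 "R + 1"]
      unfolding set_borel_measurable_def set_integrable_def by (rule borel_measurable_integrable)
    show "set_integrable lebesgue (cball 0 (R + 1)) (\<lambda>x. (norm (f x))\<^sup>2)"
      by (intro continuous_set_integrable_lebesgue continuous_intros f)
  qed
  show ?thesis unfolding H10_def H10_wrt_def
    using L2[OF c(1)] L2[OF c(2)] tf by (intro conjI exI[of _ "\<lambda>_. \<phi>"] exI[of _ "\<lambda>_. D\<phi>"]) auto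
qed

lemma moving_integral_DERIV:
  fixes \<gamma> :: "real \<Rightarrow> real"
  assumes c: "continuous_on {0..} \<gamma>" and t: "0 < t" and h: "0 < h"
  shows "((\<lambda>s. integral {s..s + h} \<gamma>) has_real_derivative \<gamma> (t + h) - \<gamma> t) (at t)"
proof -
  define I where "I = (\<lambda>s. integral {0..s} \<gamma>)"
  have DI: "(I has_real_derivative \<gamma> s) (at s)" if s: "0 < s" for s
  proof -
    have "(I has_real_derivative \<gamma> s) (at s within {0..s + 1})"
      unfolding I_def by (rule integral_has_real_derivative[OF continuous_on_subset[OF c]]) (use s in auto)
    then show ?thesis using s by (simp add: at_within_Icc_at)
  qed
  have "((\<lambda>s. I (s + h) - I s) has_real_derivative \<gamma> (t + h) * 1 - \<gamma> t) (at t)"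
    by (intro DERIV_diff DERIV_chain2[OF DI] DI) (use t h in \<open>auto intro!: derivative_eq_intros\<close>)
  then have "((\<lambda>s. I (s + h) - I s) has_real_derivative \<gamma> (t + h) - \<gamma> t) (at t)" by simp
  then show ?thesis
  proof (rule has_field_derivative_transform_within_open[of _ _ _ "{0<..}"])
    fix s :: real assume "s \<in> {0<..}"
    then have s: "0 < s" by simp
    have "integral {0..s} \<gamma> + integral {s..s + h} \<gamma> = integral {0..s + h} \<gamma>"
      using s h by (intro Henstock_Kurzweil_Integration.integral_combine integrable_continuous_real continuous_on_subset[OF c]) auto
    then show "I (s + h) - I s = integral {s..s + h} \<gamma>" by (simp add: I_def)
  qed (use t in auto)
qed

section \<open>The weak formulation integrated in time\<close>

context steklov_flow
begin

lemma flux_integrable: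
  assumes \<phi>: "test_function UNIV \<phi> D\<phi>" and I[measurable]: "I \<in> sets borel" and IT: "I \<subseteq> {0<..<T}"
  shows "integrable lborel (\<lambda>z. indicator I (snd z) * (F z \<bullet> D\<phi> (fst z)))"
    and "integrable (lborel \<Otimes>\<^sub>M lborel) (\<lambda>(x, \<tau>). indicator I \<tau> * (F (x, \<tau>) \<bullet> D\<phi> x))"
proof -
  obtain R where z: "\<And>x. R < norm x \<Longrightarrow> D\<phi> x = 0" and c: "continuous_on UNIV D\<phi>"
    by (rule test_functionE[OF \<phi>], rule that)
  have "integrable lborel (\<lambda>z. indicator (cball 0 R \<times> I) z * norm (F z))"
  proof (rule Bochner_Integration.integrable_bound[OF F_int[of R]])
    have [measurable]: "cball (0::'a) R \<times> I \<in> sets borel" by (intro borel_Times) auto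
    show "(\<lambda>z. indicator (cball 0 R \<times> I) z * norm (F z)) \<in> borel_measurable lborel"
      unfolding measurable_lborel1 by measurable
    show "AE z in lborel. norm (indicator (cball 0 R \<times> I) z * norm (F z)) \<le> norm (indicator (cball 0 R \<times> {0<..<T}) z * norm (F z))"
      using IT by (intro AE_I2) (auto simp: indicator_def)
  qed
  from product_integrable[OF F_borel this I c z]
  show "integrable (lborel \<Otimes>\<^sub>M lborel) (\<lambda>(x, \<tau>). indicator I \<tau> * (F (x, \<tau>) \<bullet> D\<phi> x))" .
  then show "integrable lborel (\<lambda>z. indicator I (snd z) * (F z \<bullet> D\<phi> (fst z)))"
    by (simp add: lborel_prod case_prod_unfold)
qed

text \<open>
  The time derivative of a Steklov average of \<open>\<gamma>\<close> is a difference quotient of \<open>\<gamma>\<close>, so each fixed \<open>h\<close> already gives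
  an exact increment and no limit \<open>h \<rightarrow> 0\<close> is taken.
\<close>

lemma steklov_step:
  assumes \<phi>: "test_function UNIV \<phi> D\<phi>"
  defines "\<gamma> \<equiv> \<lambda>t. LINT x|lborel. v t x * \<phi> x"
  obtains h0 where "0 < h0" "\<And>h t. 0 < h \<Longrightarrow> h < h0 \<Longrightarrow> 0 < t \<Longrightarrow> t + h < T \<Longrightarrow>
    \<gamma> (t + h) - \<gamma> t = - (LINT z|lborel. indicator {t..t + h} (snd z) * (F z \<bullet> D\<phi> (fst z)))"
proof -
  obtain R B where z: "\<And>x. R < norm x \<Longrightarrow> \<phi> x = 0" "\<And>x. R < norm x \<Longrightarrow> D\<phi> x = 0"
    and B: "\<And>x. norm (\<phi> x) \<le> B" and c: "continuous_on UNIV \<phi>" "continuous_on UNIV D\<phi>"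
    by (rule test_functionE[OF \<phi>], rule that)
  note [measurable] = borel_measurable_continuous_onI[OF c(1)] borel_measurable_continuous_onI[OF c(2)]
  define K where "K = cball (0::'a) (R + 1)"
  have K: "compact K" by (simp add: K_def)
  have [measurable]: "K \<in> sets lebesgue" by (simp add: K_def)
  have Kz: "\<phi> x = 0 \<and> D\<phi> x = 0" if "x \<notin> K" for x using that z by (simp add: K_def)
  have H10: "H10 K \<phi> D\<phi>" unfolding K_def by (rule test_function_H10[OF \<phi> z(1)])
  have \<gamma>c: "continuous_on {0..} \<gamma>" unfolding \<gamma>_def by (rule pairing_continuous[OF c(1) z(1)])
  obtain h0 where h0: "h0 > 0" and wk: "\<And>h t. 0 < h \<Longrightarrow> h < h0 \<Longrightarrow> 0 < t \<Longrightarrow> t < T - h \<Longrightarrow>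
      \<exists>w'. L1loc_lim UNIV (\<lambda>s x. (steklov h u s x - steklov h u t x) / (s - t)) w' (at t) \<and>
         (\<forall>\<phi> D\<phi>. H10 K \<phi> D\<phi> \<longrightarrow> has_bochner_integral (lebesgue_on K)
            (\<lambda>x. w' x * \<phi> x + steklov h F0 t x \<bullet> D\<phi> x + steklov h B0 t x \<bullet> D\<phi> x) 0)"
    using weak[OF K] by blast
  show ?thesis
  proof (rule that[OF h0])
    fix h t assume h: "0 < h" "h < h0" and t: "0 < t" and th: "t + h < T"
    define q where "q = (\<lambda>s x. (steklov h u s x - steklov h u t x) / (s - t))"
    have "t < T - h" using th by simp
    from wk[OF h t this] obtain w' where lim: "L1loc_lim UNIV q w' (at t)"
      and hb: "has_bochner_integral (lebesgue_on K)
            (\<lambda>x. w' x * \<phi> x + steklov h F0 t x \<bullet> D\<phi> x + steklov h B0 t x \<bullet> D\<phi> x) 0"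
      unfolding q_def using H10 by blast
    define S where "S = (\<lambda>s x. LINT \<tau>|lborel. indicator {s..s + h} \<tau> *\<^sub>R w (x, \<tau>))"
    have stu: "AE x in lborel. \<forall>s. 0 < s \<longrightarrow> steklov h u s x = (1 / h) * S s x"
      using steklov_AE[OF w_borel w_eq] by eventually_elim (simp add: S_def)
    have \<phi>m: "\<phi> \<in> borel_measurable lebesgue" by (simp add: measurable_completion)
    have mult: "integrable lebesgue (\<lambda>x. indicator K x * (f x * \<phi> x))"
      "\<bar>LINT x|lebesgue. indicator K x * (f x * \<phi> x)\<bar> \<le> B * (LINT x:K|lebesgue. \<bar>f x\<bar>)"
      if f: "set_integrable lebesgue K f" for f :: "'a \<Rightarrow> real"
    proof -
      have i: "integrable lebesgue (\<lambda>x. indicator K x * f x)" using f by (simp add: set_integrable_def)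
      have ia: "integrable lebesgue (\<lambda>x. indicator K x * \<bar>f x\<bar>)"
        using integrable_abs[OF i] by (simp add: abs_mult)
      have b: "\<bar>indicator K x * (f x * \<phi> x)\<bar> \<le> B * (indicator K x * \<bar>f x\<bar>)" for x
        using mult_right_mono[OF B[of x], of "\<bar>f x\<bar>"] by (auto simp: indicator_def abs_mult mult_ac)
      have "(\<lambda>x. (indicator K x * f x) * \<phi> x) \<in> borel_measurable lebesgue"
        by (rule borel_measurable_times[OF borel_measurable_integrable[OF i] \<phi>m])
      then have m: "(\<lambda>x. indicator K x * (f x * \<phi> x)) \<in> borel_measurable lebesgue" by (simp add: mult.assoc)
      show int: "integrable lebesgue (\<lambda>x. indicator K x * (f x * \<phi> x))"
        by (rule Bochner_Integration.integrable_bound[OF integrable_mult_right[OF ia, of B] m])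
           (use b order_trans[OF b abs_ge_self] in auto)
      have "\<bar>LINT x|lebesgue. indicator K x * (f x * \<phi> x)\<bar> \<le> (LINT x|lebesgue. \<bar>indicator K x * (f x * \<phi> x)\<bar>)"
        by (rule integral_abs_bound)
      also have "\<dots> \<le> (LINT x|lebesgue. B * (indicator K x * \<bar>f x\<bar>))"
        by (intro integral_mono integrable_abs int integrable_mult_right ia b)
      finally show "\<bar>LINT x|lebesgue. indicator K x * (f x * \<phi> x)\<bar> \<le> B * (LINT x:K|lebesgue. \<bar>f x\<bar>)"
        by (simp add: set_lebesgue_integral_def)
    qed
    have w'i: "set_integrable lebesgue K w'"
      using lim K by (auto simp: L1loc_lim_def loc_integrable_def)
    \<comment> \<open>The pairing of the time derivative with \<phi> is computed twice: as the limit
      of the difference quotients of \<open>G\<close>, and from the weak identity.\<close>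
    define l0 where "l0 = (LINT x|lebesgue. indicator K x * (w' x * \<phi> x))"
    define G where "G = (\<lambda>s. (1 / h) * integral {s..s + h} \<gamma>)"
    have quot: "(LINT x|lebesgue. indicator K x * (q s x * \<phi> x)) = (G s - G t) / (s - t)" if s: "0 < s" for s
    proof -
      have p': "integrable lborel (\<lambda>x. S a x * \<phi> x)" "(LINT x|lborel. S a x * \<phi> x) = integral {a..a + h} \<gamma>" if "0 < a" for a
        unfolding S_def \<gamma>_def by (rule steklov_pairing[OF c(1) z(1) that h(1)]; assumption)+
      note p = p'[OF s] p'[OF t]
      have Pi: "integrable lborel (\<lambda>x. ((1 / h) * (S s x * \<phi> x) - (1 / h) * (S t x * \<phi> x)) / (s - t))"
        using p by (intro integrable_divide Bochner_Integration.integrable_diff integrable_mult_right)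
      have "(LINT x|lebesgue. indicator K x * (q s x * \<phi> x)) = (LINT x|lborel. ((1 / h) * (S s x * \<phi> x) - (1 / h) * (S t x * \<phi> x)) / (s - t))"
      proof (rule lebesgue_AE_transfer(3))
        show "(\<lambda>x. ((1 / h) * (S s x * \<phi> x) - (1 / h) * (S t x * \<phi> x)) / (s - t)) \<in> borel_measurable borel"
          using borel_measurable_integrable[OF Pi] by simp
        show "AE x in lborel. indicator K x * (q s x * \<phi> x) = ((1 / h) * (S s x * \<phi> x) - (1 / h) * (S t x * \<phi> x)) / (s - t)"
          using stu
        proof eventually_elim
          case (elim x)
          have "q s x = ((1 / h) * S s x - (1 / h) * S t x) / (s - t)" using elim s t by (simp add: q_def)
          then have "q s x * \<phi> x = ((1 / h) * (S s x * \<phi> x) - (1 / h) * (S t x * \<phi> x)) / (s - t)"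
            by (simp add: algebra_simps)
          then show ?case using Kz[of x] by (cases "x \<in> K") auto
        qed
      qed
      also have "\<dots> = (G s - G t) / (s - t)"
        using p by (simp add: G_def)
      finally show ?thesis .
    qed
    have "((\<lambda>s. (G s - G t) / (s - t)) \<longlongrightarrow> l0) (at t)"
    proof -
      have "\<forall>\<^sub>F s in at t. 0 < s" using t by (intro order_tendstoD[OF tendsto_ident_at])
      moreover have "\<forall>\<^sub>F s in at t. set_integrable lebesgue K (q s)"
        using lim K by (auto simp: L1loc_lim_def)
      \<comment> \<open>Local L1 convergence of the quotients suffices, because \<phi> is bounded
        and supported in the compact set \<open>K\<close>.\<close>
      ultimately have ev: "\<forall>\<^sub>F s in at t. norm ((G s - G t) / (s - t) - l0) \<le> B * (LINT x:K|lebesgue. \<bar>q s x - w' x\<bar>)"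
      proof eventually_elim
        case (elim s)
        have d: "set_integrable lebesgue K (\<lambda>x. q s x - w' x)" using elim(2) w'i by (rule set_integral_diff)
        have "(G s - G t) / (s - t) - l0 = (LINT x|lebesgue. indicator K x * (q s x * \<phi> x) - indicator K x * (w' x * \<phi> x))"
          unfolding quot[OF elim(1), symmetric] l0_def
          by (rule Bochner_Integration.integral_diff[symmetric]) (rule mult(1) elim(2) w'i)+
        also have "\<dots> = (LINT x|lebesgue. indicator K x * ((q s x - w' x) * \<phi> x))" by (simp add: algebra_simps)
        finally show ?case using mult(2)[OF d] by simp
      qed
      have "((\<lambda>s. B * (LINT x:K|lebesgue. \<bar>q s x - w' x\<bar>)) \<longlongrightarrow> 0) (at t)"
        using lim K tendsto_mult_right_zero[of "\<lambda>s. LINT x:K|lebesgue. \<bar>q s x - w' x\<bar>" "at t" B] by (auto simp: L1loc_lim_def)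
      from Lim_null_comparison[OF ev this] show ?thesis by (rule LIM_zero_cancel)
    qed
    moreover have "((\<lambda>s. (G s - G t) / (s - t)) \<longlongrightarrow> (1 / h) * (\<gamma> (t + h) - \<gamma> t)) (at t)"
      using DERIV_cmult[OF moving_integral_DERIV[OF \<gamma>c t h(1)], of "1 / h"]
      unfolding has_field_derivative_iff G_def .
    ultimately have l0: "l0 = (1 / h) * (\<gamma> (t + h) - \<gamma> t)" by (rule tendsto_unique[rotated]) simp
    let ?W = "\<lambda>x. w' x * \<phi> x + steklov h F0 t x \<bullet> D\<phi> x + steklov h B0 t x \<bullet> D\<phi> x"
    have X: "integrable lebesgue (\<lambda>x. indicator K x * ?W x)" "(LINT x|lebesgue. indicator K x * ?W x) = 0"
      using hb integrable_restrict_space[of K lebesgue ?W] integral_restrict_space[of K lebesgue ?W]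
      by (auto simp: has_bochner_integral_iff)
    have IT: "{t..t + h} \<subseteq> {0<..<T}" using t h th by auto
    have fi: "integrable (lborel \<Otimes>\<^sub>M lborel) (\<lambda>(x, \<tau>). indicator {t..t + h} \<tau> * (F (x, \<tau>) \<bullet> D\<phi> x))"
      by (rule flux_integrable(2)[OF \<phi> _ IT]) simp
    define P where "P = (\<lambda>x. LINT \<tau>|lborel. indicator {t..t + h} \<tau> * (F (x, \<tau>) \<bullet> D\<phi> x))"
    have Pi: "integrable lborel (\<lambda>x. (1 / h) * P x)"
      unfolding P_def by (intro integrable_mult_right lborel_pair.integrable_fst[OF fi])
    have Peq: "AE x in lborel. steklov h F0 t x \<bullet> D\<phi> x + steklov h B0 t x \<bullet> D\<phi> x = (1 / h) * P x"
    proof -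
      have "integrable (lborel \<Otimes>\<^sub>M lborel) (\<lambda>z. indicator (cball 0 R \<times> {0<..<T}) z * norm (F z))"
        using F_int[of R] by (simp add: lborel_prod)
      then have sl: "AE x in lborel. integrable lborel (\<lambda>\<tau>. indicator (cball 0 R \<times> {0<..<T}) (x, \<tau>) * norm (F (x, \<tau>)))"
        by (rule lborel_pair.AE_integrable_fst')
      have 0: "AE z in lborel. 0 < snd z \<longrightarrow> B0 z = (\<lambda>z. 0) z" using B_eq by simp
      have sF: "AE x in lborel. \<forall>s h. 0 < s \<longrightarrow> steklov h F0 s x = (1 / h) *\<^sub>R (LINT \<tau>|lborel. indicator {s..s + h} \<tau> *\<^sub>R F (x, \<tau>))"
        by (rule steklov_AE[OF F_borel F_eq])
      have sB: "AE x in lborel. \<forall>s h. 0 < s \<longrightarrow> steklov h B0 s x = (1 / h) *\<^sub>R (LINT \<tau>|lborel. indicator {s..s + h} \<tau> *\<^sub>R (\<lambda>z. 0) (x, \<tau>))"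
        by (rule steklov_AE[OF _ 0]) simp
      from sl sF sB show ?thesis
      proof eventually_elim
        case (elim x)
        have B0: "steklov h B0 t x = 0" using elim(3) t by simp
        show ?case
        proof (cases "norm x \<le> R")
          case True
          have i: "integrable lborel (\<lambda>\<tau>. indicator {t..t + h} \<tau> *\<^sub>R F (x, \<tau>))"
          proof (rule Bochner_Integration.integrable_bound[OF elim(1)])
            show "AE \<tau> in lborel. norm (indicator {t..t + h} \<tau> *\<^sub>R F (x, \<tau>)) \<le> norm (indicator (cball 0 R \<times> {0<..<T}) (x, \<tau>) * norm (F (x, \<tau>)))"
              using True IT by (intro AE_I2) (auto simp: indicator_def)
          qed measurable
          have "(LINT \<tau>|lborel. indicator {t..t + h} \<tau> *\<^sub>R F (x, \<tau>)) \<bullet> D\<phi> x = P x"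
            unfolding P_def using integral_inner_left[OF i, of "D\<phi> x"] by simp
          then show ?thesis using elim(2) t B0 by simp
        next
          case False
          then have "D\<phi> x = 0" by (intro z) simp
          then show ?thesis by (simp add: P_def)
        qed
      qed
    qed
    have "- l0 = (LINT x|lebesgue. indicator K x * ?W x - indicator K x * (w' x * \<phi> x))"
      using X mult(1)[OF w'i] by (simp add: l0_def)
    also have "\<dots> = (LINT x|lborel. (1 / h) * P x)"
    proof (rule lebesgue_AE_transfer(3))
      show "(\<lambda>x. (1 / h) * P x) \<in> borel_measurable borel" using borel_measurable_integrable[OF Pi] by simp
      show "AE x in lborel. indicator K x * ?W x - indicator K x * (w' x * \<phi> x) = (1 / h) * P x"
        using Peq
      proof eventually_elim
        case (elim x)
        then show ?case using Kz[of x] by (cases "x \<in> K") (simp_all add: P_def)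
      qed
    qed
    also have "\<dots> = (1 / h) * (LINT z|lborel. indicator {t..t + h} (snd z) * (F z \<bullet> D\<phi> (fst z)))"
      using lborel_pair.integral_fst[OF fi] by (simp add: P_def lborel_prod case_prod_unfold)
    finally have "(1 / h) * (\<gamma> (t + h) - \<gamma> t) = (1 / h) * - (LINT z|lborel. indicator {t..t + h} (snd z) * (F z \<bullet> D\<phi> (fst z)))"
      unfolding l0 by linarith
    then show "\<gamma> (t + h) - \<gamma> t = - (LINT z|lborel. indicator {t..t + h} (snd z) * (F z \<bullet> D\<phi> (fst z)))"
      using h(1) by (subst (asm) mult_left_cancel) simp_all
  qed
qed

text \<open>\<open>steklov_step\<close> says that \<gamma> plus the accumulated flux has no
  increment over short steps inside the open interval. \<open>increments_nonpos\<close>, applied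
  with zero error to this function and to its negative, chains the steps; t = 0 is reached by
  continuity of \<gamma> and dominated convergence of the flux.\<close>

lemma flux_identity:
  assumes \<phi>: "test_function UNIV \<phi> D\<phi>" and st: "0 \<le> s" "s \<le> t" "t < T"
  shows "(LINT x|lborel. v t x * \<phi> x) - (LINT x|lborel. v s x * \<phi> x) =
    - (LINT z|lborel. indicator {s<..t} (snd z) * (F z \<bullet> D\<phi> (fst z)))"
proof -
  define \<gamma> where "\<gamma> = (\<lambda>t. LINT x|lborel. v t x * \<phi> x)"
  define f where "f = (\<lambda>z. F z \<bullet> D\<phi> (fst z))"
  define J where "J = (\<lambda>t. LINT z|lborel. indicator {0<..t} (snd z) * f z)"
  define H where "H = (\<lambda>t. \<gamma> t + J t)"
  obtain R where z: "\<And>x. R < norm x \<Longrightarrow> \<phi> x = 0" and c: "continuous_on UNIV \<phi>" "continuous_on UNIV D\<phi>"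
    by (rule test_functionE[OF \<phi>], rule that)
  have \<gamma>c: "continuous_on {0..} \<gamma>" unfolding \<gamma>_def by (rule pairing_continuous[OF c(1) z])
  have fi: "integrable lborel (\<lambda>z. indicator I (snd z) * f z)" if "I \<in> sets borel" "I \<subseteq> {0<..<T}" for I
    unfolding f_def by (rule flux_integrable(1)[OF \<phi> that])
  have Jdiff: "J b - J a = (LINT z|lborel. indicator {a<..b} (snd z) * f z)" if "0 \<le> a" "a \<le> b" "b < T" for a b
  proof -
    have "J b - J a = (LINT z|lborel. indicator {0<..b} (snd z) * f z - indicator {0<..a} (snd z) * f z)"
      unfolding J_def by (rule Bochner_Integration.integral_diff[symmetric]) (use that in \<open>auto intro!: fi\<close>)
    also have "\<dots> = (LINT z|lborel. indicator {a<..b} (snd z) * f z)"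
      using that by (intro Bochner_Integration.integral_cong) (auto simp: indicator_def)
    finally show ?thesis .
  qed
  obtain h0 where h0: "0 < h0" and step: "\<And>h t. 0 < h \<Longrightarrow> h < h0 \<Longrightarrow> 0 < t \<Longrightarrow> t + h < T \<Longrightarrow>
    \<gamma> (t + h) - \<gamma> t = - (LINT z|lborel. indicator {t..t + h} (snd z) * f z)"
    unfolding \<gamma>_def f_def using steklov_step[OF \<phi>] by blast
  have Hstep: "H b = H a" if ab: "0 < a" "a \<le> b" "b - a < h0" "b < T" for a b
  proof (cases "a = b")
    case False
    have m: "(\<lambda>z. indicator {a<..b} (snd z) * f z) \<in> borel_measurable lborel" "(\<lambda>z. indicator {a..b} (snd z) * f z) \<in> borel_measurable lborel"
      by (rule borel_measurable_integrable, rule fi; use ab in auto)+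
    \<comment> \<open>The Steklov window is closed and the increments are half open; they differ by
      a null time slice.\<close>
    have "AE z in (lborel :: ('a \<times> real) measure). snd z \<noteq> a"
      by (rule AE_lborel_snd) (rule AE_lborel_singleton)
    then have "AE z in lborel. indicator {a..b} (snd z) * f z = indicator {a<..b} (snd z) * f z"
      by eventually_elim (auto simp: indicator_def)
    then have "(LINT z|lborel. indicator {a..b} (snd z) * f z) = (LINT z|lborel. indicator {a<..b} (snd z) * f z)"
      by (rule integral_cong_AE[OF m(2,1)])
    then have "\<gamma> b - \<gamma> a = - (J b - J a)"
      using step[of "b - a" a] ab False Jdiff[of a b] by simp
    then show ?thesis by (simp add: H_def)
  qed simp
  have Hconst: "H b = H a" if ab: "0 < a" "a \<le> b" "b < T" for a b
  proof (cases "a = b")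
    case False
    \<comment> \<open>Shifting by a > 0 keeps all times positive, as \<open>Hstep\<close>
      requires.\<close>
    have sm: "\<exists>d>0. \<forall>s t. 0 \<le> s \<and> s \<le> t \<and> t \<le> b - a \<and> t - s < d \<longrightarrow> H (a + t) = H (a + s)"
      using h0 ab by (intro exI[of _ h0]) (auto intro!: Hstep)
    have "H (a + (b - a)) \<le> H (a + 0)"
      by (rule increments_nonpos[of "b - a" "\<lambda>x. H (a + x)" "\<lambda>_. 0"]) (use ab False sm in auto)
    moreover have "- H (a + (b - a)) \<le> - H (a + 0)"
      by (rule increments_nonpos[of "b - a" "\<lambda>x. - H (a + x)" "\<lambda>_. 0"]) (use ab False sm in auto)
    ultimately show ?thesis by simp
  qed simp
  have H0: "H b = H 0" if b: "0 < b" "b < T" for b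
  proof -
    define a where "a = (\<lambda>n. b / real (Suc n))"
    have a: "0 < a n" "a n \<le> b" for n using b by (auto simp: a_def field_simps)
    have al: "a \<longlonglongrightarrow> 0" unfolding a_def by (rule LIMSEQ_Suc) (rule lim_const_over_n)
    have "(\<lambda>n. \<gamma> (a n)) \<longlonglongrightarrow> \<gamma> 0"
      by (rule continuous_on_tendsto_compose[OF \<gamma>c al]) (use a in \<open>auto intro: always_eventually less_imp_le\<close>)
    moreover have "(\<lambda>n. J (a n)) \<longlonglongrightarrow> (LINT z::'a \<times> real|lborel. 0)"
      unfolding J_def
    proof (rule integral_dominated_convergence[where w = "\<lambda>z. \<bar>indicator {0<..b} (snd z) * f z\<bar>"])
      show "integrable lborel (\<lambda>z. \<bar>indicator {0<..b} (snd z) * f z\<bar>)" by (intro integrable_abs fi) (use b in auto)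
      show "(\<lambda>z. indicator {0<..a n} (snd z) * f z) \<in> borel_measurable lborel" for n
        by (intro borel_measurable_integrable fi) (use a[of n] b in auto)
      show "AE z in lborel. norm (indicator {0<..a n} (snd z) * f z) \<le> \<bar>indicator {0<..b} (snd z) * f z\<bar>" for n
        using a[of n] by (intro AE_I2) (auto simp: indicator_def)
      show "AE z in lborel. (\<lambda>n. indicator {0<..a n} (snd z) * f z) \<longlonglongrightarrow> 0"
      proof (rule AE_I2)
        fix z :: "'a \<times> real"
        show "(\<lambda>n. indicator {0<..a n} (snd z) * f z) \<longlonglongrightarrow> 0"
        proof (cases "0 < snd z")
          case True
          then have "\<forall>\<^sub>F n in sequentially. a n < snd z" using al by (intro order_tendstoD)
          then have "\<forall>\<^sub>F n in sequentially. indicator {0<..a n} (snd z) * f z = 0" by eventually_elim simp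
          then show ?thesis by (rule tendsto_eventually)
        qed (auto simp: indicator_def)
      qed
    qed simp
    ultimately have "(\<lambda>n. H (a n)) \<longlonglongrightarrow> \<gamma> 0 + 0" unfolding H_def by (intro tendsto_add) simp_all
    moreover have "H (a n) = H b" for n using Hconst[of "a n" b] a b by simp
    ultimately have "H b = \<gamma> 0" by (simp add: LIMSEQ_const_iff)
    then show ?thesis by (simp add: H_def J_def)
  qed
  have "H t = H s"
  proof (cases "s = 0")
    case True
    then show ?thesis using H0[of t] st by (cases "t = 0") auto
  next
    case False
    then show ?thesis using Hconst[of s t] st by simp
  qed
  then have "\<gamma> t - \<gamma> s = - (J t - J s)" by (simp add: H_def)
  then show ?thesis using Jdiff[OF st] by (simp add: \<gamma>_def f_def)
qed

end

section \<open>Mass conservation for weak solutions\<close>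

lemma test_function_product:
  assumes \<phi>: "test_function UNIV \<phi> D\<phi>" and \<theta>: "test_function {0<..<T} \<theta> D\<theta>"
  shows "test_function (UNIV \<times> {0<..}) (\<lambda>z. \<theta> (snd z) * \<phi> (fst z))
    (\<lambda>z. (\<theta> (snd z) *\<^sub>R D\<phi> (fst z), D\<theta> (snd z) * \<phi> (fst z)))"
proof -
  have \<theta>U: "test_function UNIV \<theta> D\<theta>" using \<theta> by (auto simp: test_function_def)
  have c: "continuous_on UNIV \<phi>" "continuous_on UNIV D\<phi>" and g: "\<And>x. GDERIV \<phi> x :> D\<phi> x"
    by (rule test_functionE[OF \<phi>]; assumption)+
  have c': "continuous_on UNIV \<theta>" "continuous_on UNIV D\<theta>" and g': "\<And>x. GDERIV \<theta> x :> D\<theta> x"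
    by (rule test_functionE[OF \<theta>U]; assumption)+
  let ?S = "closure {x. \<phi> x \<noteq> 0} \<times> closure {t. \<theta> t \<noteq> 0}"
  have S: "compact ?S" using \<phi> \<theta> by (auto simp: test_function_def intro!: compact_Times)
  have cl: "closure {z. \<theta> (snd z) * \<phi> (fst z) \<noteq> 0} \<subseteq> ?S"
  proof (rule closure_minimal)
    show "{z. \<theta> (snd z) * \<phi> (fst z) \<noteq> 0} \<subseteq> ?S"
    proof
      fix z assume "z \<in> {z. \<theta> (snd z) * \<phi> (fst z) \<noteq> 0}"
      then have "fst z \<in> {x. \<phi> x \<noteq> 0}" "snd z \<in> {t. \<theta> t \<noteq> 0}" by auto
      then show "z \<in> ?S" using closure_subset[of "{x. \<phi> x \<noteq> 0}"] closure_subset[of "{t. \<theta> t \<noteq> 0}"]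
        by (simp add: mem_Times_iff subset_iff)
    qed
  qed (use S compact_imp_closed in blast)
  have "open (UNIV \<times> {0<..} :: ('a \<times> real) set)" by (intro open_Times) auto
  moreover have "?S \<subseteq> UNIV \<times> {0<..}" using \<theta> by (auto simp: test_function_def)
  ultimately have sub: "closure {z. \<theta> (snd z) * \<phi> (fst z) \<noteq> 0} \<subseteq> interior (UNIV \<times> {0<..})"
    using cl by (simp add: interior_open)
  show ?thesis
    unfolding test_function_def
  proof (intro conjI allI)
    fix z :: "'a \<times> real"
    have d1: "((\<lambda>z. \<phi> (fst z)) has_derivative (\<lambda>h. fst h \<bullet> D\<phi> (fst z))) (at z)"
      by (rule has_derivative_compose[OF has_derivative_fst[OF has_derivative_ident]]) (use g in \<open>simp add: gderiv_def\<close>)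
    have d2: "((\<lambda>z. \<theta> (snd z)) has_derivative (\<lambda>h. snd h * D\<theta> (snd z))) (at z)"
      by (rule has_derivative_compose[OF has_derivative_snd[OF has_derivative_ident], where g = \<theta>, unfolded o_def])
         (use g'[of "snd z", unfolded gderiv_def] in simp)
    show "GDERIV (\<lambda>z. \<theta> (snd z) * \<phi> (fst z)) z :> (\<theta> (snd z) *\<^sub>R D\<phi> (fst z), D\<theta> (snd z) * \<phi> (fst z))"
      unfolding gderiv_def
      by (rule has_derivative_eq_rhs[OF has_derivative_mult[OF d2 d1]]) (auto simp: inner_prod_def algebra_simps)
    show "continuous_on UNIV (\<lambda>z. (\<theta> (snd z) *\<^sub>R D\<phi> (fst z), D\<theta> (snd z) * \<phi> (fst z)))"
      by (intro continuous_intros continuous_on_compose2[OF c(1)] continuous_on_compose2[OF c(2)]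
          continuous_on_compose2[OF c'(1)] continuous_on_compose2[OF c'(2)]) auto
    show "compact (closure {z. \<theta> (snd z) * \<phi> (fst z) \<noteq> 0})"
      using closed_Int_compact[OF closed_closure S, of "{z. \<theta> (snd z) * \<phi> (fst z) \<noteq> 0}"] cl by (simp add: Int_absorb2)
  qed (rule sub)
qed

text \<open>For \<open>m = 1\<close> this turns the weight U^(m-1) of the weak formulation into 1,
  also where U vanishes.\<close>

lemma rpow_0 [simp]: "rpow x 0 = 1"
  by (simp add: rpow_def)

theorem theorem1p4:
  fixes U :: "real ^ 'k \<Rightarrow> real"
    and A :: "real ^ 'n \<Rightarrow> real \<Rightarrow> (real ^ 'n) \<times> real \<Rightarrow> real ^ 'n"
    and B :: "real \<Rightarrow> (real ^ 'n) \<times> real \<Rightarrow> real ^ 'n"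
    and u :: "(real ^ 'n) \<times> real \<Rightarrow> real ^ 'k"
    and Du :: "'k \<Rightarrow> (real ^ 'n) \<times> real \<Rightarrow> real ^ 'n"
    and u0 :: "real ^ 'n \<Rightarrow> real ^ 'k"
    and lam \<beta> :: "'k \<Rightarrow> real"
    and m q c C1 C2 C3 C4 C5 p :: real
  assumes "CARD('n) \<ge> 2"
    and "m = 1"
    and "caratheodory_A A" and "caratheodory_B B"
    and "0 < c" "c \<le> 1" "1 \<le> C1" "1 \<le> C2" "1 \<le> C3" "1 \<le> C4"
    and "C5 = 0"
    and "\<forall>i x. 0 < u0 x $ i"
    and "weak_solution_ivp m U A B u0 u Du"
    and "structure_conditions m U A B lam \<beta> q c C1 C2 C3 C4 C5 u Du"
    and "p > 1"
    and "\<forall>i. integrable lebesgue (\<lambda>x. u0 x $ i) \<and> Lp_fun p (\<lambda>x. u0 x $ i)"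
  shows "\<forall>i. \<forall>t>0. integrable lebesgue (\<lambda>x. u (x, t) $ i) \<and>
           (LINT x|lebesgue. u (x, t) $ i) = (LINT x|lebesgue. u0 x $ i)"
proof (intro allI impI)
  fix i and T :: real assume T: "0 < T"
  let ?Q = "UNIV \<times> {0<..} :: ((real ^ 'n) \<times> real) set"
  define y where "y = (\<lambda>z. u z $ i)"
  define F0 where "F0 = (\<lambda>z. A (Du i z) (y z) z)"
  define B0 where "B0 = (\<lambda>z. B (y z) z)"
  have m: "m = 1" and C5: "C5 = 0" using assms by auto
  note sc = \<open>structure_conditions m U A B lam \<beta> q c C1 C2 C3 C4 C5 u Du\<close>[unfolded structure_conditions_def Let_def]
  have y_nonneg: "0 \<le> y z" if "z \<in> ?Q" for z using sc that unfolding y_def by blast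
  have grad: "has_sgrad ?Q y (Du i)" using sc unfolding y_def by blast
  have gen: "\<forall>v g. has_sgrad ?Q v g \<and> (\<forall>z\<in>?Q. 0 \<le> v z) \<longrightarrow>
        (AE z in lebesgue. z \<in> ?Q \<longrightarrow>
           c * (norm (g z))\<^sup>2 - C2 * (v z)\<^sup>2 \<le> A (g z) (v z) z \<bullet> g z \<and>
           norm (A (g z) (v z) z) \<le> C3 * norm (g z) + C4 * v z \<and>
           norm (B (v z) z) \<le> C5 * rpow (v z) q)"
    using sc by (elim conjE)
  have "AE z in lebesgue. z \<in> ?Q \<longrightarrow>
     c * (norm (Du i z))\<^sup>2 - C2 * (y z)\<^sup>2 \<le> F0 z \<bullet> Du i z \<and>
     norm (F0 z) \<le> C3 * norm (Du i z) + C4 * y z \<and> norm (B0 z) \<le> C5 * rpow (y z) q"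
    unfolding F0_def B0_def using gen[rule_format, of y "Du i"] grad y_nonneg by blast
  \<comment> \<open>With \<open>C5 = 0\<close> the growth bound becomes
    \<open>norm (B0 z) \<le> 0\<close>, so the flux consists of \<open>F0\<close> alone almost
    everywhere.\<close>
  then have str: "AE z in lborel. 0 < snd z \<longrightarrow>
     c * (norm (Du i z))\<^sup>2 - C2 * (y z)\<^sup>2 \<le> F0 z \<bullet> Du i z \<and>
     norm (F0 z) \<le> C3 * norm (Du i z) + C4 * y z \<and> B0 z = 0"
    unfolding AE_completion_iff by eventually_elim (auto simp: C5 mem_Times_iff)
  note ivp = \<open>weak_solution_ivp m U A B u0 u Du\<close>[unfolded weak_solution_ivp_def]
  have ic: "AE x in lebesgue. y (x, 0) = u0 x $ i" using ivp by (simp add: y_def)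
  have cont: "L1loc_lim UNIV (\<lambda>s x. y (x, s)) (\<lambda>x. y (x, t)) (at t within {0..})" if "0 \<le> t" for t
    using ivp that unfolding y_def by blast
  \<comment> \<open>\<open>flux_identity\<close> holds strictly before the final time; solving up to
    T + 1 makes the time T itself available.\<close>
  have "weak_solution UNIV (T + 1) m U A B u Du" using ivp T by simp
  then have ws: "L2_on (UNIV \<times> {0<..<T + 1}) (\<lambda>z. norm (F0 z))"
    "\<And>K. compact K \<Longrightarrow> \<exists>h0>0. \<forall>h. 0 < h \<and> h < h0 \<longrightarrow> (\<forall>t. 0 < t \<and> t < (T + 1) - h \<longrightarrow>
      (\<exists>w'. L1loc_lim UNIV (\<lambda>s x. (steklov h y s x - steklov h y t x) / (s - t)) w' (at t) \<and>
         (\<forall>\<phi> D\<phi>. H10 K \<phi> D\<phi> \<longrightarrow> has_bochner_integral (lebesgue_on K)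
            (\<lambda>x. w' x * \<phi> x + steklov h F0 t x \<bullet> D\<phi> x + steklov h B0 t x \<bullet> D\<phi> x) 0)))"
    unfolding weak_solution_def m y_def F0_def B0_def by simp_all

  have ym: "(\<lambda>z. indicator ?Q z *\<^sub>R y z) \<in> borel_measurable lebesgue"
    and Dm: "(\<lambda>z. indicator ?Q z *\<^sub>R Du i z) \<in> borel_measurable lebesgue"
    using grad by (auto simp only: has_sgrad_def intro!: loc_integrable_halfspace_measurable)
  have Fm: "(\<lambda>z. indicator ?Q z *\<^sub>R F0 z) \<in> borel_measurable lebesgue"
    unfolding F0_def by (rule caratheodory_measurable[OF \<open>caratheodory_A A\<close> Dm ym y_nonneg])
  obtain w1 where w1[measurable]: "w1 \<in> borel_measurable borel" and w1e: "AE z in lborel. indicator ?Q z *\<^sub>R y z = w1 z"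
    by (rule lebesgue_borel_representative[OF ym])
  obtain D1 where D1[measurable]: "D1 \<in> borel_measurable borel" and D1e: "AE z in lborel. indicator ?Q z *\<^sub>R Du i z = D1 z"
    by (rule lebesgue_borel_representative[OF Dm])
  obtain F1 where F1[measurable]: "F1 \<in> borel_measurable borel" and F1e: "AE z in lborel. indicator ?Q z *\<^sub>R F0 z = F1 z"
    by (rule lebesgue_borel_representative[OF Fm])
  \<comment> \<open>\<open>parabolic_flow\<close> asks for nonnegativity at every point. Truncation
    at 0 provides it and changes nothing almost everywhere at positive times.\<close>
  define w where "w = (\<lambda>z. max 0 (w1 z))"
  have w[measurable]: "w \<in> borel_measurable borel" unfolding w_def by measurable
  have we: "AE z in lborel. 0 < snd z \<longrightarrow> y z = w z"
    using w1e
  proof eventually_elim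
    case (elim z)
    show ?case
    proof
      assume "0 < snd z"
      then have z: "z \<in> ?Q" by (cases z) auto
      then show "y z = w z" using elim y_nonneg[OF z] by (simp add: w_def)
    qed
  qed
  have De: "AE z in lborel. 0 < snd z \<longrightarrow> Du i z = D1 z"
    using D1e by eventually_elim (auto simp: mem_Times_iff)
  have Fe: "AE z in lborel. 0 < snd z \<longrightarrow> F0 z = F1 z"
    using F1e by eventually_elim (auto simp: mem_Times_iff)

  have lt: "loc_integrable UNIV (\<lambda>x. y (x, t))" if "0 \<le> t" for t
    using cont[OF that] by (simp add: L1loc_lim_def)
  have "\<exists>g. g \<in> borel_measurable borel \<and> (\<forall>x. 0 \<le> g x) \<and> (AE x in lborel. y (x, t) = g x)" if t: "0 \<le> t" for t
  proof -
    have "(\<lambda>x. y (x, t)) \<in> borel_measurable lebesgue"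
    proof -
      have ml: "(\<lambda>x. indicator (cball 0 (real k)) x *\<^sub>R y (x, t)) \<in> borel_measurable lebesgue" for k
        using lt[OF t] unfolding loc_integrable_def set_integrable_def by (intro borel_measurable_integrable) auto
      have "(\<lambda>k. indicator (cball 0 (real k)) x *\<^sub>R y (x, t)) \<longlonglongrightarrow> y (x, t)" for x
      proof (rule tendsto_eventually)
        obtain N where "norm x \<le> real N" using real_arch_simple by blast
        then show "\<forall>\<^sub>F k in sequentially. indicator (cball 0 (real k)) x *\<^sub>R y (x, t) = y (x, t)"
          unfolding eventually_sequentially by (intro exI[of _ N]) auto
      qed
      then show ?thesis by (rule borel_measurable_LIMSEQ_metric[OF ml])
    qed
    then obtain g where g[measurable]: "g \<in> borel_measurable borel" and ge: "AE x in lborel. y (x, t) = g x"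
      by (rule lebesgue_borel_representative)
    \<comment> \<open>The structure conditions give the sign for positive times only; at t = 0 it
      comes from the initial data.\<close>
    have nn: "AE x in lborel. 0 \<le> y (x, t)"
    proof (cases "t = 0")
      case True
      have "AE x in lborel. y (x, 0) = u0 x $ i" using ic by (simp only: AE_completion_iff)
      then show ?thesis
      proof eventually_elim
        case (elim x)
        have "0 < u0 x $ i" using assms(12) by blast
        then show ?case using elim True by simp
      qed
    next
      case False
      then show ?thesis using t by (intro AE_I2 y_nonneg) auto
    qed
    from ge nn have "AE x in lborel. y (x, t) = max 0 (g x)" by eventually_elim simp
    then show ?thesis by (intro exI[of _ "\<lambda>x. max 0 (g x)"]) auto
  qed
  then obtain v where vm: "\<And>t. 0 \<le> t \<Longrightarrow> v t \<in> borel_measurable borel"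
    and v0: "\<And>t x. 0 \<le> t \<Longrightarrow> 0 \<le> v t x" and ve: "\<And>t. 0 \<le> t \<Longrightarrow> AE x in lborel. y (x, t) = v t x"
    by metis
  have v_loc: "locally_integrable (v t)" if t: "0 \<le> t" for t
    unfolding locally_integrable_def
  proof
    fix R
    have "integrable lebesgue (\<lambda>x. indicator (cball 0 R) x *\<^sub>R y (x, t))"
      using lt[OF t] by (auto simp: loc_integrable_def set_integrable_def)
    moreover have "AE x in lborel. indicator (cball 0 R) x *\<^sub>R y (x, t) = indicator (cball 0 R) x *\<^sub>R v t x"
      using ve[OF t] by eventually_elim simp
    moreover note [measurable] = vm[OF t]
    ultimately show "integrable lborel (\<lambda>x. indicator (cball 0 R) x *\<^sub>R v t x)"
      using lebesgue_AE_transfer(2)[of "\<lambda>x. indicator (cball 0 R) x *\<^sub>R v t x" "\<lambda>x. indicator (cball 0 R) x *\<^sub>R y (x, t)"]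
      by simp
  qed
  have v_cont: "((\<lambda>s. LINT x|lborel. indicator (cball 0 R) x * \<bar>v s x - v t x\<bar>) \<longlongrightarrow> 0) (at t within {0..})"
    if t: "0 \<le> t" for t R
  proof -
    have lim: "((\<lambda>s. LINT x:cball 0 R|lebesgue. \<bar>y (x, s) - y (x, t)\<bar>) \<longlongrightarrow> 0) (at t within {0..})"
      using cont[OF t] by (simp add: L1loc_lim_def)
    have eq: "(LINT x:cball 0 R|lebesgue. \<bar>y (x, s) - y (x, t)\<bar>) = (LINT x|lborel. indicator (cball 0 R) x * \<bar>v s x - v t x\<bar>)"
      if s: "0 \<le> s" for s
      unfolding set_lebesgue_integral_def
    proof (rule lebesgue_AE_transfer(3))
      note [measurable] = vm[OF s] vm[OF t]
      show "(\<lambda>x. indicator (cball 0 R) x * \<bar>v s x - v t x\<bar>) \<in> borel_measurable borel" by measurable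
      show "AE x in lborel. indicator (cball 0 R) x *\<^sub>R \<bar>y (x, s) - y (x, t)\<bar> = indicator (cball 0 R) x * \<bar>v s x - v t x\<bar>"
        using ve[OF s] ve[OF t] by eventually_elim simp
    qed
    have "\<forall>\<^sub>F s in at t within {0..}. (LINT x:cball 0 R|lebesgue. \<bar>y (x, s) - y (x, t)\<bar>) =
        (LINT x|lborel. indicator (cball 0 R) x * \<bar>v s x - v t x\<bar>)"
      unfolding eventually_at_filter by (intro always_eventually allI impI eq) simp
    with lim show ?thesis by (rule Lim_transform_eventually)
  qed
  have F_sq: "integrable lborel (\<lambda>z. indicator (UNIV \<times> {0<..<T + 1}) z * (norm (F1 z))\<^sup>2)"
  proof -
    have "integrable lebesgue (\<lambda>z. indicator (UNIV \<times> {0<..<T + 1}) z *\<^sub>R (norm (norm (F0 z)))\<^sup>2)"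
      using ws(1) by (simp add: L2_on_def set_integrable_def)
    moreover have "AE z in lborel. indicator (UNIV \<times> {0<..<T + 1}) z *\<^sub>R (norm (norm (F0 z)))\<^sup>2 = indicator (UNIV \<times> {0<..<T + 1}) z * (norm (F1 z))\<^sup>2"
      using Fe by eventually_elim (auto simp: indicator_def)
    moreover have [measurable]: "(UNIV \<times> {0<..<T + 1} :: ((real ^ 'n) \<times> real) set) \<in> sets borel" by (intro borel_Times) auto
    have "(\<lambda>z. indicator (UNIV \<times> {0<..<T + 1}) z * (norm (F1 z))\<^sup>2) \<in> borel_measurable borel" by measurable
    ultimately show ?thesis by (simp only: lebesgue_AE_transfer(2))
  qed
  interpret sf: steklov_flow y F0 B0 F1 w v "T + 1"
  proof
    show "AE z in lborel. 0 < snd z \<longrightarrow> B0 z = 0" using str by eventually_elim auto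
    show "integrable lborel (\<lambda>z. indicator (cball 0 R \<times> {a..b}) z * w z)" if a: "0 < a" for R a b
    proof -
      have "compact (cball (0::real ^ 'n) R \<times> {a..b})" "cball 0 R \<times> {a..b} \<subseteq> ?Q"
        using a by (auto intro!: compact_Times)
      then have "integrable lebesgue (\<lambda>z. indicator (cball 0 R \<times> {a..b}) z *\<^sub>R y z)"
        using grad by (simp add: has_sgrad_def loc_integrable_def set_integrable_def)
      moreover have "AE z in lborel. indicator (cball 0 R \<times> {a..b}) z *\<^sub>R y z = indicator (cball 0 R \<times> {a..b}) z * w z"
        using we by eventually_elim (use a in \<open>auto simp: indicator_def\<close>)
      moreover have [measurable]: "(cball 0 R \<times> {a..b} :: ((real ^ 'n) \<times> real) set) \<in> sets borel" by (intro borel_Times) auto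
      have "(\<lambda>z. indicator (cball 0 R \<times> {a..b}) z * w z) \<in> borel_measurable borel" by measurable
      ultimately show ?thesis by (simp only: lebesgue_AE_transfer(2))
    qed
    show "integrable lborel (\<lambda>z. indicator (cball 0 R \<times> {0<..<T + 1}) z * norm (F1 z))" for R
    proof (rule Bochner_Integration.integrable_bound)
      have "emeasure lborel (cball (0::real ^ 'n) R \<times> {0<..<T + 1}) < \<infinity>"
        using emeasure_lborel_cball_finite[of "0::real ^ 'n" R] T
        by (simp add: lborel_prod[symmetric] lborel.emeasure_pair_measure_Times ennreal_mult_less_top)
      moreover have [measurable]: "(cball 0 R \<times> {0<..<T + 1} :: ((real ^ 'n) \<times> real) set) \<in> sets borel" by (intro borel_Times) auto
      ultimately show "integrable lborel (\<lambda>z. indicator (cball (0::real ^ 'n) R \<times> {0<..<T + 1}) z + indicator (UNIV \<times> {0<..<T + 1}) z * (norm (F1 z))\<^sup>2)"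
        by (intro Bochner_Integration.integrable_add F_sq integrable_real_indicator) auto
      show "(\<lambda>z. indicator (cball 0 R \<times> {0<..<T + 1}) z * norm (F1 z)) \<in> borel_measurable lborel"
        unfolding measurable_lborel1 by measurable
      show "AE z in lborel. norm (indicator (cball 0 R \<times> {0<..<T + 1}) z * norm (F1 z)) \<le>
         norm (indicator (cball (0::real ^ 'n) R \<times> {0<..<T + 1}) z + indicator (UNIV \<times> {0<..<T + 1}) z * (norm (F1 z))\<^sup>2)"
        using linear_le_quadratic[of "norm (F1 z)" for z] by (intro AE_I2) (auto simp: indicator_def)
    qed
  qed (fact v_loc ve v_cont w F1 we Fe ws(2))+
  \<comment> \<open>Restriction to the open time interval installs the convention that all fields
    vanish outside (0,T).\<close>
  let ?I = "indicator (UNIV \<times> {0<..<T}) :: (real ^ 'n) \<times> real \<Rightarrow> real"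
  have I[measurable]: "?I \<in> borel_measurable borel" by (intro borel_measurable_indicator borel_Times) auto
  interpret pf: parabolic_flow v "\<lambda>z. ?I z * w z" "\<lambda>z. ?I z *\<^sub>R D1 z" "\<lambda>z. ?I z *\<^sub>R F1 z" T c C2 C3 C4
  proof
    show "(\<lambda>z. ?I z * w z) \<in> borel_measurable borel" "(\<lambda>z. ?I z *\<^sub>R D1 z) \<in> borel_measurable borel"
      "(\<lambda>z. ?I z *\<^sub>R F1 z) \<in> borel_measurable borel" by measurable
    show "0 \<le> ?I z * w z" for z by (simp add: w_def)
    show "?I z * w z = 0 \<and> ?I z *\<^sub>R D1 z = 0 \<and> ?I z *\<^sub>R F1 z = 0" if "snd z \<notin> {0<..<T}" for z
      using that by (auto simp: indicator_def)
    show "((\<lambda>s. LINT x|lborel. indicator (cball 0 R) x * \<bar>v s x - v t x\<bar>) \<longlongrightarrow> 0) (at t within {0..T})" if "t \<in> {0..T}" for t R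
      by (rule tendsto_within_subset[OF v_cont]) (use that in auto)
    show "AE t in lborel. t \<in> {0<..<T} \<longrightarrow> (AE x in lborel. ?I (x, t) * w (x, t) = v t x)"
      using sf.slice_AE by eventually_elim (auto simp: indicator_def)
    show "integrable lborel (\<lambda>z. (norm (?I z *\<^sub>R F1 z))\<^sup>2)"
    proof (rule Bochner_Integration.integrable_bound[OF F_sq])
      show "(\<lambda>z. (norm (?I z *\<^sub>R F1 z))\<^sup>2) \<in> borel_measurable lborel" unfolding measurable_lborel1 by measurable
    qed (auto simp: indicator_def)
    fix \<phi> :: "real ^ 'n \<Rightarrow> real" and D\<phi> assume \<phi>: "test_function UNIV \<phi> D\<phi>"
    have c: "continuous_on UNIV \<phi>" "continuous_on UNIV D\<phi>"
      by (rule test_functionE[OF \<phi>]; assumption)+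
    note [measurable] = borel_measurable_continuous_onI[OF c(1)] borel_measurable_continuous_onI[OF c(2)]
    show "(LINT x|lborel. v t x * \<phi> x) - (LINT x|lborel. v s x * \<phi> x) =
        - (LINT z|lborel. indicator {s<..t} (snd z) * ((?I z *\<^sub>R F1 z) \<bullet> D\<phi> (fst z)))"
      if st: "0 \<le> s" "s \<le> t" "t \<le> T" for s t
    proof -
      have "(LINT x|lborel. v t x * \<phi> x) - (LINT x|lborel. v s x * \<phi> x) =
        - (LINT z|lborel. indicator {s<..t} (snd z) * (F1 z \<bullet> D\<phi> (fst z)))"
        by (rule sf.flux_identity[OF \<phi> st(1,2)]) (use st in simp)
      also have "(LINT z|lborel. indicator {s<..t} (snd z) * (F1 z \<bullet> D\<phi> (fst z))) =
         (LINT z|lborel. indicator {s<..t} (snd z) * ((?I z *\<^sub>R F1 z) \<bullet> D\<phi> (fst z)))"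
      proof (rule integral_cong_AE)
        \<comment> \<open>For t = T the window \<open>{s<..t}\<close> contains the end slice that
          \<open>?I\<close> removes; that slice is null.\<close>
        have "AE z in (lborel :: ((real ^ 'n) \<times> real) measure). snd z \<noteq> T"
          by (rule AE_lborel_snd) (rule AE_lborel_singleton)
        then show "AE z in lborel. indicator {s<..t} (snd z) * (F1 z \<bullet> D\<phi> (fst z)) =
          indicator {s<..t} (snd z) * ((?I z *\<^sub>R F1 z) \<bullet> D\<phi> (fst z))"
          by eventually_elim (use st in \<open>auto simp: indicator_def\<close>)
        show "(\<lambda>z. indicator {s<..t} (snd z) * (F1 z \<bullet> D\<phi> (fst z))) \<in> borel_measurable lborel"
          "(\<lambda>z. indicator {s<..t} (snd z) * ((?I z *\<^sub>R F1 z) \<bullet> D\<phi> (fst z))) \<in> borel_measurable lborel"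
          unfolding measurable_lborel1 by measurable
      qed
      finally show ?thesis .
    qed
    fix \<theta> D\<theta> assume \<theta>: "test_function {0<..<T} \<theta> D\<theta>"
    have \<theta>U: "test_function UNIV \<theta> D\<theta>" using \<theta> by (auto simp: test_function_def)
    have "continuous_on UNIV \<theta>" by (rule test_functionE[OF \<theta>U])
    note [measurable] = borel_measurable_continuous_onI[OF this]
    have \<theta>z: "\<theta> s = 0" if "s \<notin> {0<..<T}" for s
      using \<theta> that closure_subset[of "{s. \<theta> s \<noteq> 0}"] by (auto simp: test_function_def)
    \<comment> \<open>\<open>has_sgrad\<close> sees only the spatial component of the gradient of
      the product test function, so no derivative of \<theta> appears.\<close>
    have "(LINT z:?Q|lebesgue. y z *\<^sub>R (\<theta> (snd z) *\<^sub>R D\<phi> (fst z))) = - (LINT z:?Q|lebesgue. (\<theta> (snd z) * \<phi> (fst z)) *\<^sub>R Du i z)"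
      using grad test_function_product[OF \<phi> \<theta>] unfolding has_sgrad_def by force
    moreover have "(LINT z:?Q|lebesgue. y z *\<^sub>R (\<theta> (snd z) *\<^sub>R D\<phi> (fst z))) =
        (LINT z|lborel. (?I z * w z) *\<^sub>R (\<theta> (snd z) *\<^sub>R D\<phi> (fst z)))"
      unfolding set_lebesgue_integral_def
    proof (rule lebesgue_AE_transfer(3))
      show "AE z in lborel. indicator ?Q z *\<^sub>R y z *\<^sub>R \<theta> (snd z) *\<^sub>R D\<phi> (fst z) = (?I z * w z) *\<^sub>R (\<theta> (snd z) *\<^sub>R D\<phi> (fst z))"
        using we
      proof eventually_elim
        case (elim z)
        show ?case using elim \<theta>z[of "snd z"] by (cases "snd z \<in> {0<..<T}"; cases z) auto
      qed
    qed measurable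
    moreover have "(LINT z:?Q|lebesgue. (\<theta> (snd z) * \<phi> (fst z)) *\<^sub>R Du i z) =
        (LINT z|lborel. (\<theta> (snd z) * \<phi> (fst z)) *\<^sub>R (?I z *\<^sub>R D1 z))"
      unfolding set_lebesgue_integral_def
    proof (rule lebesgue_AE_transfer(3))
      show "AE z in lborel. indicator ?Q z *\<^sub>R (\<theta> (snd z) * \<phi> (fst z)) *\<^sub>R Du i z = (\<theta> (snd z) * \<phi> (fst z)) *\<^sub>R (?I z *\<^sub>R D1 z)"
        using De
      proof eventually_elim
        case (elim z)
        show ?case using elim \<theta>z[of "snd z"] by (cases "snd z \<in> {0<..<T}"; cases z) auto
      qed
    qed measurable
    ultimately show "(LINT z|lborel. (?I z * w z) *\<^sub>R (\<theta> (snd z) *\<^sub>R D\<phi> (fst z))) =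
       - (LINT z|lborel. (\<theta> (snd z) * \<phi> (fst z)) *\<^sub>R (?I z *\<^sub>R D1 z))" by simp
  next
    show "AE z in lborel. c * (norm (?I z *\<^sub>R D1 z))\<^sup>2 - C2 * (?I z * w z)\<^sup>2 \<le> (?I z *\<^sub>R F1 z) \<bullet> (?I z *\<^sub>R D1 z) \<and>
      norm (?I z *\<^sub>R F1 z) \<le> C3 * norm (?I z *\<^sub>R D1 z) + C4 * (?I z * w z)"
      using str we De Fe
    proof eventually_elim
      case (elim z)
      show ?case
      proof (cases "snd z \<in> {0<..<T}")
        case True
        then have "?I z = 1" by (cases z) simp
        then show ?thesis using elim True by auto
      next
        case False
        then have "?I z = 0" by (cases z) simp
        then show ?thesis by simp
      qed
    qed
  qed (use assms T v_loc v0 in auto)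
  have ve0: "AE x in lborel. u0 x $ i = v 0 x"
  proof -
    have "AE x in lborel. y (x, 0) = u0 x $ i" using ic by (simp only: AE_completion_iff)
    with ve[OF order_refl] show ?thesis by eventually_elim simp
  qed
  have v0m: "v 0 \<in> borel_measurable borel" and vTm: "v T \<in> borel_measurable borel" using vm T by auto
  note t0 = lebesgue_AE_transfer[OF v0m ve0]
  have veT: "AE x in lborel. y (x, T) = v T x" using ve T by simp
  note tT = lebesgue_AE_transfer[OF vTm veT]
  have "integrable lborel (v 0)" using t0(2) assms(16) by simp
  from pf.mass_conservation[OF this, of T] T
  have "integrable lborel (v T)" "integral\<^sup>L lborel (v T) = integral\<^sup>L lborel (v 0)" by auto
  then show "integrable lebesgue (\<lambda>x. u (x, T) $ i) \<and> (LINT x|lebesgue. u (x, T) $ i) = (LINT x|lebesgue. u0 x $ i)"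
    using t0 tT by (simp add: y_def)
qed

end
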